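(* Let $N\ge1$ be an integer and $\beta\in\mathbb C$ with $\beta^4=(-1)^N$. Then the data $(Q,\cdot,1,\Delta,\varepsilon,\Phi,S,\boldsymbol\alpha,\boldsymbol\beta,R,v)$ of $Q=Q(N,\beta)$ defines a ribbon quasi-Hopf algebra over $\mathbb C$.
   Context: $Q=Q(N,\beta)$ is the unital associative $\mathbb C$-algebra generated by $K$, $f_i^\pm$ ($1\le i\le N$) with relations $\{f_i^\pm,K\}=0$, $\{f_i^+,f_j^-\}=\delta_{ij}e_1$, $\{f_i^\pm,f_j^\pm\}=0$, $K^4=1$, where $\{x,y\}=xy+yx$, $e_0=\frac12(1+K^2)$, $e_1=\frac12(1-K^2)$. Put $\omega_\pm=(e_0\pm ie_1)K$. Data ($\Delta,\varepsilon$ extended multiplicatively, $S$ anti-multiplicatively): - $\Delta(K)=K\otimes K-(1+(-1)^N)(e_1\otimes e_1)(K\otimes K)$, $\Delta(f_i^\pm)=f_i^\pm\otimes1+\omega_\pm\otimes f_i^\pm$, $\varepsilon(K)=1$, $\varepsilon(f_i^\pm)=0$; - $\Phi^{\pm1}=1\otimes1\otimes1+e_1\otimes e_1\otimes\{(K^N-1)e_0+(\beta^2(\pm iK)^N-1)e_1\}$; - $S(K)=K^{(-1)^N}=(e_0+(-1)^Ne_1)K$, $S(f_k^\pm)=f_k^\pm(e_0\pm(-1)^Nie_1)K$, $\boldsymbol\alpha=1$, $\boldsymbol\beta=e_0+\beta^2(iK)^Ne_1$; - $R=\big(\sum_{n,m\in\{0,1\}}\beta^{nm}\rho_{n,m}\,e_n\otimes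 e_m\big)\prod_{k=1}^N(1\otimes1-2f_k^-\omega_-\otimes f_k^+)$, $R^{-1}=\prod_{k=1}^N(1\otimes1+2f_k^-\omega_-\otimes f_k^+)\big(\sum_{n,m}\beta^{-nm}\rho_{n,m}\,e_n\otimes e_m\big)$, with $\rho_{n,m}=\frac12\sum_{p,q=0}^1(-1)^{pq}i^{-pn+qm}K^p\otimes K^q$; - $v=(e_0-\beta iKe_1)\prod_{k=1}^N(1-2f_k^+f_k^-)$, $v^{-1}=(e_0-\beta^{-1}iKe_1)\prod_{k=1}^N(1+2f_k^+f_k^-K^2)$. Conventions. A quasi-Hopf algebra is an algebra $A$ with algebra maps $\Delta,\varepsilon$ (with $\varepsilon$ a counit for $\Delta$), invertible $\Phi\in A^{\otimes3}$, an algebra anti-homomorphism $S$ and $\boldsymbol\alpha,\boldsymbol\beta\in A$ such that $(\Delta\otimes\mathrm{id})(\Delta(a))\,\Phi=\Phi\,(\mathrm{id}\otimes\Delta)(\Delta(a))$; $(\Delta\otimes\mathrm{id}\otimes\mathrm{id})(\Phi)\,(\mathrm{id}\otimes\mathrm{id}\otimes\Delta)(\Phi)=(\Phi\otimes1)\,(\mathrm{id}\otimes\Delta\otimes\mathrm{id})(\Phi)\,(1\otimes\Phi)$; $(\mathrm{id}\otimes\varepsilon\otimes\mathrm{id})(\Phi)=1\otimes1$; $\sum S(a')\boldsymbol\alpha a''=\varepsilon(a)\boldsymbol\alpha$, $\sum a'\boldsymbol\beta S(a'')=\varepsilon(a)\boldsymbol\beta$; $\sum S(\Phi_1)\boldsymbol\alpha\Phi_2\boldsymbol\beta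 S(\Phi_3)=1$ and $\sum(\Phi^{-1})_1\boldsymbol\beta S((\Phi^{-1})_2)\boldsymbol\alpha(\Phi^{-1})_3=1$. Thus the associator $U\otimes(V\otimes W)\to(U\otimes V)\otimes W$ on modules is the action of $\Phi$. It is quasi-triangular with invertible $R\in A\otimes A$ if the maps $x\otimes y\mapsto$ flip of $R.(x\otimes y)$ are $A$-module maps and satisfy the two hexagon identities with respect to this associator, i.e. define a braiding on $A$-modules. It is ribbon with ribbon element $v$ if $v$ is central, invertible, $S(v)=v$ and $R_{21}R=(v\otimes v)\,\Delta(v^{-1})$ (so that $\theta=$ action of $v^{-1}$ is a ribbon twist). *)

theory Defs
  imports Complex_Main "HOL-Library.Cardinality"
begin

section \<open>Complex vector spaces and unital complex algebras\<close>

class complex_vector = ab_group_add +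
  fixes scaleC :: "complex \<Rightarrow> 'a \<Rightarrow> 'a" (infixr "*\<^sub>C" 75)
  assumes scaleC_add_right: "c *\<^sub>C (x + y) = c *\<^sub>C x + c *\<^sub>C y"
    and scaleC_add_left: "(c + d) *\<^sub>C x = c *\<^sub>C x + d *\<^sub>C x"
    and scaleC_scaleC [simp]: "c *\<^sub>C d *\<^sub>C x = (c * d) *\<^sub>C x"
    and scaleC_one [simp]: "1 *\<^sub>C x = x"

global_interpretation complex_vector: vector_space "scaleC :: complex \<Rightarrow> 'a \<Rightarrow> 'a::complex_vector"
  by unfold_locales (simp_all add: scaleC_add_right scaleC_add_left)

abbreviation clinear :: "('u::complex_vector \<Rightarrow> 'v::complex_vector) \<Rightarrow> bool" where
  "clinear \<equiv> Vector_Spaces.linear scaleC scaleC"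

lemma clinearI:
  assumes "\<And>x y. f (x + y) = f x + f y" "\<And>c x. f (c *\<^sub>C x) = c *\<^sub>C f x"
  shows "clinear f"
  using assms by unfold_locales auto

lemma clinear_iff:
  "clinear f \<longleftrightarrow> (\<forall>x y. f (x + y) = f x + f y) \<and> (\<forall>c x. f (c *\<^sub>C x) = c *\<^sub>C f x)"
  by (metis clinearI complex_vector.vector_space_axioms Vector_Spaces.linear_iff)

definition cbilinear ::
    "('u::complex_vector \<Rightarrow> 'v::complex_vector \<Rightarrow> 'w::complex_vector) \<Rightarrow> bool" where
  "cbilinear f \<longleftrightarrow> (\<forall>u. clinear (\<lambda>v. f u v)) \<and> (\<forall>v. clinear (\<lambda>u. f u v))"

text \<open>The zero algebra is allowed: \<^class>\<open>ring_1\<close> would add the axiom \<open>0 \<noteq> 1\<close>.\<close>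

class complex_algebra_1 = complex_vector + ring + monoid_mult +
  assumes mult_scaleC_left [simp]: "(c *\<^sub>C x) * y = c *\<^sub>C (x * y)"
    and mult_scaleC_right [simp]: "x * (c *\<^sub>C y) = c *\<^sub>C (x * y)"

instantiation complex :: complex_algebra_1
begin
definition scaleC_complex :: "complex \<Rightarrow> complex \<Rightarrow> complex" where
  "scaleC_complex c z = c * z"
instance by standard (simp_all add: scaleC_complex_def algebra_simps)
end

definition algebra_hom :: "('a::complex_algebra_1 \<Rightarrow> 'b::complex_algebra_1) \<Rightarrow> bool" where
  "algebra_hom f \<longleftrightarrow> clinear f \<and> f 1 = 1 \<and> (\<forall>x y. f (x * y) = f x * f y)"

definition algebra_antihom :: "('a::complex_algebra_1 \<Rightarrow> 'b::complex_algebra_1) \<Rightarrow> bool" where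
  "algebra_antihom f \<longleftrightarrow> clinear f \<and> f 1 = 1 \<and> (\<forall>x y. f (x * y) = f y * f x)"


section \<open>Tensor products over the complex numbers\<close>

text \<open>A list stands for the formal sum of the pure tensors in it.\<close>

inductive tensor_cong ::
    "('u::complex_vector \<times> 'v::complex_vector) list \<Rightarrow> ('u \<times> 'v) list \<Rightarrow> bool" where
  refl: "tensor_cong xs xs"
| sym: "tensor_cong xs ys \<Longrightarrow> tensor_cong ys xs"
| trans: "tensor_cong xs ys \<Longrightarrow> tensor_cong ys zs \<Longrightarrow> tensor_cong xs zs"
| append: "tensor_cong xs xs' \<Longrightarrow> tensor_cong ys ys' \<Longrightarrow> tensor_cong (xs @ ys) (xs' @ ys')"
| comm: "tensor_cong (xs @ ys) (ys @ xs)"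
| add_left: "tensor_cong [(u + u', v)] [(u, v), (u', v)]"
| add_right: "tensor_cong [(u, v + v')] [(u, v), (u, v')]"
| scale: "tensor_cong [(c *\<^sub>C u, v)] [(u, c *\<^sub>C v)]"
| zero: "tensor_cong [(0, v)] []"

quotient_type (overloaded) ('u, 'v) tensor (infixl "\<otimes>" 68) =
    "('u::complex_vector \<times> 'v::complex_vector) list" / tensor_cong
  by (rule equivpI)
    (auto intro!: reflpI sympI transpI intro: tensor_cong.refl tensor_cong.sym tensor_cong.trans)

lift_definition pure_tensor ::
    "'u::complex_vector \<Rightarrow> 'v::complex_vector \<Rightarrow> 'u \<otimes> 'v" (infixl "\<otimes>" 68)
  is "\<lambda>u v. [(u, v)]" .

lemma tensor_cong_scale:
  "tensor_cong xs ys \<Longrightarrow>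
    tensor_cong (map (\<lambda>(u, v). (c *\<^sub>C u, v)) xs) (map (\<lambda>(u, v). (c *\<^sub>C u, v)) ys)"
proof (induction rule: tensor_cong.induct)
  case (scale d u v)
  have "tensor_cong [(d *\<^sub>C c *\<^sub>C u, v)] [(c *\<^sub>C u, d *\<^sub>C v)]"
    by (rule tensor_cong.scale)
  then show ?case by (simp add: mult.commute)
qed (auto simp: scaleC_add_right intro: tensor_cong.intros)

instantiation tensor :: (complex_vector, complex_vector) comm_monoid_add
begin
lift_definition zero_tensor :: "'a \<otimes> 'b" is "[]" .
lift_definition plus_tensor :: "'a \<otimes> 'b \<Rightarrow> 'a \<otimes> 'b \<Rightarrow> 'a \<otimes> 'b" is "(@)"
  by (rule tensor_cong.append)
instance
proof
  fix a b c :: "'a \<otimes> 'b"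
  show "a + b + c = a + (b + c)" by transfer (simp add: tensor_cong.refl)
  show "a + b = b + a" by transfer (rule tensor_cong.comm)
  show "0 + a = a" by transfer (simp add: tensor_cong.refl)
qed
end

lemma tensor_add_left: "(u + u') \<otimes> v = u \<otimes> v + u' \<otimes> v"
  by transfer (simp add: tensor_cong.add_left)

lemma tensor_add_right: "u \<otimes> (v + v') = u \<otimes> v + u \<otimes> v'"
  by transfer (simp add: tensor_cong.add_right)

lemma tensor_scale_swap: "(c *\<^sub>C u) \<otimes> v = u \<otimes> (c *\<^sub>C v)"
  by transfer (rule tensor_cong.scale)

lemma tensor_zero_left [simp]: "0 \<otimes> v = 0"
  by transfer (rule tensor_cong.zero)

lemma tensor_induct [case_names zero add]:
  assumes "P 0" "\<And>u v t. P t \<Longrightarrow> P (u \<otimes> v + t)"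
  shows "P (t :: 'u::complex_vector \<otimes> 'v::complex_vector)"
proof -
  have "P (abs_tensor xs)" for xs :: "('u \<times> 'v) list"
  proof (induction xs)
    case Nil
    then show ?case using assms(1) by (simp add: zero_tensor_def)
  next
    case (Cons x xs)
    obtain u v where x: "x = (u, v)" by fastforce
    have "abs_tensor (x # xs) = u \<otimes> v + abs_tensor xs"
      by (simp add: x pure_tensor.abs_eq plus_tensor.abs_eq)
    then show ?case using assms(2)[OF Cons] by simp
  qed
  then show ?thesis by (metis Quotient_abs_rep Quotient_tensor)
qed

instantiation tensor :: (complex_vector, complex_vector) complex_vector
begin
lift_definition scaleC_tensor :: "complex \<Rightarrow> 'a \<otimes> 'b \<Rightarrow> 'a \<otimes> 'b"
  is "\<lambda>c. map (\<lambda>(u, v). (c *\<^sub>C u, v))" by (rule tensor_cong_scale)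
definition uminus_tensor :: "'a \<otimes> 'b \<Rightarrow> 'a \<otimes> 'b" where
  "uminus_tensor t = (- 1) *\<^sub>C t"
definition minus_tensor :: "'a \<otimes> 'b \<Rightarrow> 'a \<otimes> 'b \<Rightarrow> 'a \<otimes> 'b" where
  "minus_tensor s t = s + - t"
instance
proof
  have pure: "c *\<^sub>C (u \<otimes> v) = (c *\<^sub>C u) \<otimes> v" for c and u :: 'a and v :: 'b
    by transfer (simp add: tensor_cong.refl)
  have scale0: "c *\<^sub>C (0 :: 'a \<otimes> 'b) = 0" for c
    by transfer (simp add: tensor_cong.refl)
  fix c d :: complex and a b :: "'a \<otimes> 'b"
  show add: "c *\<^sub>C (a + b) = c *\<^sub>C a + c *\<^sub>C b" for c and a b :: "'a \<otimes> 'b"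
    by transfer (simp add: tensor_cong.refl)
  show add': "(c + d) *\<^sub>C a = c *\<^sub>C a + d *\<^sub>C a" for c d
    by (induction a rule: tensor_induct)
      (simp_all add: scale0 add pure scaleC_add_left tensor_add_left ac_simps)
  show "c *\<^sub>C d *\<^sub>C a = (c * d) *\<^sub>C a"
    by (induction a rule: tensor_induct) (simp_all add: scale0 add pure)
  show one: "1 *\<^sub>C a = a" for a :: "'a \<otimes> 'b"
    by (induction a rule: tensor_induct) (simp_all add: scale0 add pure)
  have zero: "0 *\<^sub>C a = 0" for a :: "'a \<otimes> 'b"
    by (induction a rule: tensor_induct) (simp_all add: scale0 add pure)
  show "- a + a = 0"
    using add'[of "- 1" 1] by (simp add: uminus_tensor_def one zero)
  show "a - b = a + - b" by (rule minus_tensor_def)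
qed
end

lemma tensor_scale_left: "(c *\<^sub>C u) \<otimes> v = c *\<^sub>C (u \<otimes> v)"
  by transfer (simp add: tensor_cong.refl)

lemma tensor_scale_right: "u \<otimes> (c *\<^sub>C v) = c *\<^sub>C (u \<otimes> v)"
  by (simp flip: tensor_scale_swap add: tensor_scale_left)

lemma cbilinear_pure_tensor: "cbilinear (\<otimes>)"
  by (auto simp: cbilinear_def clinear_iff tensor_add_left tensor_add_right tensor_scale_left
      tensor_scale_right)

lemma tensor_universal:
  fixes f :: "'u::complex_vector \<Rightarrow> 'v::complex_vector \<Rightarrow> 'w::complex_vector"
  assumes "cbilinear f"
  shows "\<exists>!h. clinear h \<and> (\<forall>u v. h (u \<otimes> v) = f u v)"
proof
  have f: "f (u + u') v = f u v + f u' v" "f u (v + v') = f u v + f u v'"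
    "f (c *\<^sub>C u) v = c *\<^sub>C f u v" "f u (c *\<^sub>C v) = c *\<^sub>C f u v" for c u u' v v'
    using assms by (auto simp: cbilinear_def clinear_iff)
  have f0: "f 0 v = 0" for v using f(3)[of 0 0 v] by simp
  define F where "F xs = (\<Sum>(u, v)\<leftarrow>xs. f u v)" for xs
  have resp: "F xs = F ys" if "tensor_cong xs ys" for xs ys
    using that by induction (auto simp: F_def f f0 add.commute)
  define h where "h t = F (rep_tensor t)" for t
  have h_abs: "h (abs_tensor xs) = F xs" for xs
    unfolding h_def by (rule resp) (metis Quotient_rep_abs Quotient_tensor tensor_cong.refl)
  have h_pure: "h (u \<otimes> v) = f u v" for u v
    by (simp add: pure_tensor.abs_eq h_abs F_def)
  have h_add: "h (s + t) = h s + h t" for s t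
    by (induction s rule: tensor.abs_induct, induction t rule: tensor.abs_induct)
      (simp add: plus_tensor.abs_eq h_abs F_def)
  have h_zero: "h 0 = 0" by (simp add: zero_tensor_def h_abs F_def)
  have h_scale: "h (c *\<^sub>C t) = c *\<^sub>C h t" for c t
    by (induction t rule: tensor_induct)
      (simp_all add: h_zero h_add scaleC_add_right h_pure f flip: tensor_scale_left)
  show "clinear h \<and> (\<forall>u v. h (u \<otimes> v) = f u v)"
    by (simp add: clinear_iff h_add h_scale h_pure)
  fix g assume g: "clinear g \<and> (\<forall>u v. g (u \<otimes> v) = f u v)"
  then have g0: "g 0 = 0" by (metis clinear_iff complex_vector.scale_zero_left)
  have "g t = h t" for t
    by (induction t rule: tensor_induct)
      (use g g0 in \<open>simp_all add: h_zero h_add h_pure clinear_iff\<close>)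
  then show "g = h" by blast
qed

text \<open>Meaningful only for bilinear \<open>f\<close>.\<close>

definition tensor_lift ::
    "('u::complex_vector \<Rightarrow> 'v::complex_vector \<Rightarrow> 'w::complex_vector) \<Rightarrow> 'u \<otimes> 'v \<Rightarrow> 'w" where
  "tensor_lift f = (THE h. clinear h \<and> (\<forall>u v. h (u \<otimes> v) = f u v))"

lemma
  assumes "cbilinear f"
  shows clinear_tensor_lift: "clinear (tensor_lift f)"
    and tensor_lift_pure: "tensor_lift f (u \<otimes> v) = f u v"
  using theI'[OF tensor_universal[OF assms]] by (auto simp: tensor_lift_def)

definition tensor_map :: "('u::complex_vector \<Rightarrow> 'u'::complex_vector) \<Rightarrow>
    ('v::complex_vector \<Rightarrow> 'v'::complex_vector) \<Rightarrow> 'u \<otimes> 'v \<Rightarrow> 'u' \<otimes> 'v'" where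
  "tensor_map f g = tensor_lift (\<lambda>u v. f u \<otimes> g v)"

definition tensor_swap :: "'u::complex_vector \<otimes> 'v::complex_vector \<Rightarrow> 'v \<otimes> 'u" where
  "tensor_swap = tensor_lift (\<lambda>u v. v \<otimes> u)"

definition tensor_assoc :: "'u::complex_vector \<otimes> ('v::complex_vector \<otimes> 'w::complex_vector) \<Rightarrow>
    'u \<otimes> 'v \<otimes> 'w" where
  "tensor_assoc = tensor_lift (\<lambda>u. tensor_lift (\<lambda>v w. u \<otimes> v \<otimes> w))"

definition tensor_unassoc :: "'u::complex_vector \<otimes> 'v::complex_vector \<otimes> 'w::complex_vector \<Rightarrow>
    'u \<otimes> ('v \<otimes> 'w)" where
  "tensor_unassoc = tensor_lift (\<lambda>t w. tensor_lift (\<lambda>u v. u \<otimes> (v \<otimes> w)) t)"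

lemma cbilinear_tensor_mult:
  fixes a :: "'a::complex_algebra_1" and b :: "'b::complex_algebra_1"
  shows "cbilinear (\<lambda>c d. (a * c) \<otimes> (b * d))"
    and "cbilinear (\<lambda>a b. tensor_lift (\<lambda>c d. (a * c) \<otimes> (b * d)) (t :: 'a \<otimes> 'b))"
proof -
  have bil: "cbilinear (\<lambda>c d. (a * c) \<otimes> (b * d))" for a :: 'a and b :: 'b
    by (auto simp: cbilinear_def clinear_iff distrib_left tensor_add_left tensor_add_right
        tensor_scale_left tensor_scale_right)
  then show "cbilinear (\<lambda>c d. (a * c) \<otimes> (b * d))" .
  define L where "L a b = tensor_lift (\<lambda>c d. (a * c) \<otimes> (b * d))" for a :: 'a and b :: 'b
  have L_pure: "L a b (c \<otimes> d) = (a * c) \<otimes> (b * d)" for a b c d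
    unfolding L_def by (rule tensor_lift_pure[OF bil])
  have "clinear (L a b)" for a b
    unfolding L_def by (rule clinear_tensor_lift[OF bil])
  then have L_add: "L a b (s + t) = L a b s + L a b t"
    and L_scale: "L a b (z *\<^sub>C t) = z *\<^sub>C L a b t" for a b s t z
    by (auto simp: clinear_iff)
  have L_zero: "L a b 0 = 0" for a b using L_scale[of a b 0 0] by simp
  have "L (a + a') b t = L a b t + L a' b t \<and> L a (b + b') t = L a b t + L a b' t \<and>
      L (z *\<^sub>C a) b t = z *\<^sub>C L a b t \<and> L a (z *\<^sub>C b) t = z *\<^sub>C L a b t" for a a' b b' z
    by (induction t rule: tensor_induct)
      (simp_all add: L_zero L_add L_pure distrib_right tensor_add_left tensor_add_right
        tensor_scale_left tensor_scale_right scaleC_add_right)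
  then show "cbilinear (\<lambda>a b. tensor_lift (\<lambda>c d. (a * c) \<otimes> (b * d)) t)"
    by (auto simp: cbilinear_def clinear_iff simp flip: L_def)
qed

instantiation tensor :: (complex_algebra_1, complex_algebra_1) complex_algebra_1
begin

definition one_tensor :: "'a \<otimes> 'b" where
  "one_tensor = 1 \<otimes> 1"

definition times_tensor :: "'a \<otimes> 'b \<Rightarrow> 'a \<otimes> 'b \<Rightarrow> 'a \<otimes> 'b" where
  "times_tensor s t = tensor_lift (\<lambda>a b. tensor_lift (\<lambda>c d. (a * c) \<otimes> (b * d)) t) s"

lemma tensor_mult_pure: "(a \<otimes> b) * (c \<otimes> d) = (a * c) \<otimes> (b * d)" for a c :: 'a and b d :: 'b
  unfolding times_tensor_def
  by (subst tensor_lift_pure[OF cbilinear_tensor_mult(2)], rule tensor_lift_pure,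
      rule cbilinear_tensor_mult(1))

instance
proof
  have "clinear (\<lambda>s :: 'a \<otimes> 'b. s * t)" for t
    unfolding times_tensor_def by (intro clinear_tensor_lift cbilinear_tensor_mult)
  then have dr: "(s + s') * t = s * t + s' * t" and sl: "(z *\<^sub>C s) * t = z *\<^sub>C (s * t)"
    for s s' t :: "'a \<otimes> 'b" and z
    by (auto simp: clinear_iff)
  have zl: "0 * t = 0" for t :: "'a \<otimes> 'b" using sl[of 0 0 t] by simp
  have pure: "(a \<otimes> b) * t = tensor_lift (\<lambda>c d. (a * c) \<otimes> (b * d)) t" for a :: 'a and b :: 'b and t
    unfolding times_tensor_def by (rule tensor_lift_pure[OF cbilinear_tensor_mult(2)])
  have "clinear (\<lambda>t. (a \<otimes> b) * t)" for a :: 'a and b :: 'b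
    unfolding pure by (intro clinear_tensor_lift cbilinear_tensor_mult)
  then have pl: "(a \<otimes> b) * (t + t') = (a \<otimes> b) * t + (a \<otimes> b) * t'"
    and pr: "(a \<otimes> b) * (z *\<^sub>C t) = z *\<^sub>C ((a \<otimes> b) * t)"
    for t t' and z and a :: 'a and b :: 'b
    by (auto simp: clinear_iff)
  have dl: "s * (t + t') = s * t + s * t'" for s t t' :: "'a \<otimes> 'b"
    by (induction s rule: tensor_induct) (simp_all add: zl dr pl)
  have sr: "s * (z *\<^sub>C t) = z *\<^sub>C (s * t)" for s t :: "'a \<otimes> 'b" and z
    by (induction s rule: tensor_induct) (simp_all add: zl dr pr scaleC_add_right)
  have zr: "s * 0 = 0" for s :: "'a \<otimes> 'b" using sr[of s 0 0] by simp
  fix s t r :: "'a \<otimes> 'b" and z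
  show "(s + t) * r = s * r + t * r" by (rule dr)
  show "s * (t + r) = s * t + s * r" by (rule dl)
  show "(z *\<^sub>C s) * t = z *\<^sub>C (s * t)" by (rule sl)
  show "s * (z *\<^sub>C t) = z *\<^sub>C (s * t)" by (rule sr)
  show "1 * s = s"
    by (induction s rule: tensor_induct) (simp_all add: zr dl one_tensor_def tensor_mult_pure)
  show "s * 1 = s"
    by (induction s rule: tensor_induct) (simp_all add: zl dr one_tensor_def tensor_mult_pure)
  have 1: "(a \<otimes> b) * (c \<otimes> d) * r = (a \<otimes> b) * ((c \<otimes> d) * r)" for a c :: 'a and b d :: 'b
    by (induction r rule: tensor_induct) (simp_all add: zr dl tensor_mult_pure mult.assoc)
  have 2: "(a \<otimes> b) * t * r = (a \<otimes> b) * (t * r)" for a :: 'a and b :: 'b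
    by (induction t rule: tensor_induct) (simp_all add: zl zr dl dr 1)
  show "s * t * r = s * (t * r)"
    by (induction s rule: tensor_induct) (simp_all add: zl dr 2)
qed

end


section \<open>Ribbon quasi-Hopf algebras\<close>

definition module_action :: "('a::complex_algebra_1 \<Rightarrow> 'u::complex_vector \<Rightarrow> 'u) \<Rightarrow> bool" where
  "module_action \<rho> \<longleftrightarrow> cbilinear \<rho> \<and> (\<forall>x. \<rho> 1 x = x) \<and> (\<forall>a b x. \<rho> (a * b) x = \<rho> a (\<rho> b x))"

definition module_map :: "('a::complex_algebra_1 \<Rightarrow> 'u::complex_vector \<Rightarrow> 'u) \<Rightarrow>
    ('a \<Rightarrow> 'v::complex_vector \<Rightarrow> 'v) \<Rightarrow> ('u \<Rightarrow> 'v) \<Rightarrow> bool" where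
  "module_map \<rho> \<sigma> f \<longleftrightarrow> clinear f \<and> (\<forall>a x. f (\<rho> a x) = \<sigma> a (f x))"

text \<open>The action of \<open>A \<otimes> B\<close> on \<open>U \<otimes> V\<close>.\<close>

definition tensor_action :: "('a::complex_algebra_1 \<Rightarrow> 'u::complex_vector \<Rightarrow> 'u) \<Rightarrow>
    ('b::complex_algebra_1 \<Rightarrow> 'v::complex_vector \<Rightarrow> 'v) \<Rightarrow> 'a \<otimes> 'b \<Rightarrow> 'u \<otimes> 'v \<Rightarrow> 'u \<otimes> 'v" where
  "tensor_action \<rho> \<sigma> s t = tensor_lift (\<lambda>a b. tensor_map (\<rho> a) (\<sigma> b) t) s"

definition braiding :: "'a \<otimes> 'a \<Rightarrow> ('a::complex_algebra_1 \<Rightarrow> 'u::complex_vector \<Rightarrow> 'u) \<Rightarrow>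
    ('a \<Rightarrow> 'v::complex_vector \<Rightarrow> 'v) \<Rightarrow> 'u \<otimes> 'v \<Rightarrow> 'v \<otimes> 'u" where
  "braiding R \<rho> \<sigma> t = tensor_swap (tensor_action \<rho> \<sigma> R t)"

text \<open>
  All tensor powers of \<open>A\<close> are bracketed to the left, so the legs of the axioms that land in
  another bracketing are transported by \<^const>\<open>tensor_assoc\<close>. The inverse \<open>\<Phi>'\<close> of the
  associator is a parameter.
\<close>

locale quasi_hopf_algebra =
  fixes \<Delta> :: "'a::complex_algebra_1 \<Rightarrow> 'a \<otimes> 'a"
    and \<epsilon> :: "'a \<Rightarrow> complex"
    and \<Phi> \<Phi>' :: "'a \<otimes> 'a \<otimes> 'a"
    and S :: "'a \<Rightarrow> 'a"
    and \<alpha> \<beta> :: 'a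
  assumes comult_hom: "algebra_hom \<Delta>"
    and counit_hom: "algebra_hom \<epsilon>"
    and counit_left: "tensor_lift (\<lambda>a b. \<epsilon> a *\<^sub>C b) (\<Delta> x) = x"
    and counit_right: "tensor_lift (\<lambda>a b. \<epsilon> b *\<^sub>C a) (\<Delta> x) = x"
    and associator_inverse: "\<Phi> * \<Phi>' = 1" "\<Phi>' * \<Phi> = 1"
    and quasi_coassociative:
      "tensor_map \<Delta> id (\<Delta> x) * \<Phi> = \<Phi> * tensor_assoc (tensor_map id \<Delta> (\<Delta> x))"
    and pentagon:
      "tensor_map (tensor_map \<Delta> id) id \<Phi> * tensor_assoc (tensor_map id \<Delta> \<Phi>) =
        (\<Phi> \<otimes> 1) * tensor_map tensor_assoc id (tensor_map (tensor_map id \<Delta>) id \<Phi>)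
          * tensor_map tensor_assoc id (tensor_assoc (1 \<otimes> \<Phi>))"
    and counit_associator:
      "tensor_map (tensor_lift (\<lambda>a b. \<epsilon> b *\<^sub>C a)) id \<Phi> = 1 \<otimes> 1"
    and antipode_antihom: "algebra_antihom S"
    and antipode_left: "tensor_lift (\<lambda>a b. S a * \<alpha> * b) (\<Delta> x) = \<epsilon> x *\<^sub>C \<alpha>"
    and antipode_right: "tensor_lift (\<lambda>a b. a * \<beta> * S b) (\<Delta> x) = \<epsilon> x *\<^sub>C \<beta>"
    and antipode_associator:
      "tensor_lift (\<lambda>t c. tensor_lift (\<lambda>a b. S a * \<alpha> * b * \<beta> * S c) t) \<Phi> = 1"
    and antipode_associator_inverse:
      "tensor_lift (\<lambda>t c. tensor_lift (\<lambda>a b. a * \<beta> * S b * \<alpha> * c) t) \<Phi>' = 1"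
begin

definition tensor_module :: "('a \<Rightarrow> 'u::complex_vector \<Rightarrow> 'u) \<Rightarrow>
    ('a \<Rightarrow> 'v::complex_vector \<Rightarrow> 'v) \<Rightarrow> 'a \<Rightarrow> 'u \<otimes> 'v \<Rightarrow> 'u \<otimes> 'v" where
  "tensor_module \<rho> \<sigma> a = tensor_action \<rho> \<sigma> (\<Delta> a)"

definition associator :: "('a \<Rightarrow> 'u::complex_vector \<Rightarrow> 'u) \<Rightarrow> ('a \<Rightarrow> 'v::complex_vector \<Rightarrow> 'v) \<Rightarrow>
    ('a \<Rightarrow> 'w::complex_vector \<Rightarrow> 'w) \<Rightarrow> 'u \<otimes> ('v \<otimes> 'w) \<Rightarrow> 'u \<otimes> 'v \<otimes> 'w" where
  "associator \<rho> \<sigma> \<tau> t = tensor_action (tensor_action \<rho> \<sigma>) \<tau> \<Phi> (tensor_assoc t)"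

definition associator_inv :: "('a \<Rightarrow> 'u::complex_vector \<Rightarrow> 'u) \<Rightarrow> ('a \<Rightarrow> 'v::complex_vector \<Rightarrow> 'v) \<Rightarrow>
    ('a \<Rightarrow> 'w::complex_vector \<Rightarrow> 'w) \<Rightarrow> 'u \<otimes> 'v \<otimes> 'w \<Rightarrow> 'u \<otimes> ('v \<otimes> 'w)" where
  "associator_inv \<rho> \<sigma> \<tau> t = tensor_unassoc (tensor_action (tensor_action \<rho> \<sigma>) \<tau> \<Phi>' t)"

text \<open>
  A definition cannot quantify over types, so this speaks about all modules whose underlying vector
  spaces are \<open>'u\<close>, \<open>'v\<close>, \<open>'w\<close>. The braiding on all modules is obtained by leaving these three
  type variables free in a theorem.
\<close>

definition braids_modules :: "'a \<otimes> 'a \<Rightarrow> 'u::complex_vector itself \<Rightarrow> 'v::complex_vector itself \<Rightarrow>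
    'w::complex_vector itself \<Rightarrow> bool" where
  "braids_modules R U V W \<longleftrightarrow>
    (\<forall>(\<rho> :: 'a \<Rightarrow> 'u \<Rightarrow> 'u) (\<sigma> :: 'a \<Rightarrow> 'v \<Rightarrow> 'v) (\<tau> :: 'a \<Rightarrow> 'w \<Rightarrow> 'w).
      module_action \<rho> \<longrightarrow> module_action \<sigma> \<longrightarrow> module_action \<tau> \<longrightarrow>
        module_map (tensor_module \<rho> \<sigma>) (tensor_module \<sigma> \<rho>) (braiding R \<rho> \<sigma>) \<and>
        associator_inv \<sigma> \<tau> \<rho> \<circ> braiding R \<rho> (tensor_module \<sigma> \<tau>) \<circ> associator_inv \<rho> \<sigma> \<tau> =
          tensor_map id (braiding R \<rho> \<tau>) \<circ> associator_inv \<sigma> \<rho> \<tau> \<circ> tensor_map (braiding R \<rho> \<sigma>) id \<and>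
        associator \<tau> \<rho> \<sigma> \<circ> braiding R (tensor_module \<rho> \<sigma>) \<tau> \<circ> associator \<rho> \<sigma> \<tau> =
          tensor_map (braiding R \<rho> \<tau>) id \<circ> associator \<rho> \<tau> \<sigma> \<circ> tensor_map id (braiding R \<sigma> \<tau>))"

end

locale quasitriangular_quasi_hopf_algebra =
  quasi_hopf_algebra \<Delta> \<epsilon> \<Phi> \<Phi>' S \<alpha> \<beta>
  for \<Delta> :: "'a::complex_algebra_1 \<Rightarrow> 'a \<otimes> 'a" and \<epsilon> \<Phi> \<Phi>' S \<alpha> \<beta> +
  fixes R R' :: "'a \<otimes> 'a"
    and U :: "'u::complex_vector itself"
    and V :: "'v::complex_vector itself"
    and W :: "'w::complex_vector itself"
  assumes R_inverse: "R * R' = 1" "R' * R = 1"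
    and braids_modules: "braids_modules R U V W"

locale ribbon_quasi_hopf_algebra =
  quasitriangular_quasi_hopf_algebra \<Delta> \<epsilon> \<Phi> \<Phi>' S \<alpha> \<beta> R R' U V W
  for \<Delta> :: "'a::complex_algebra_1 \<Rightarrow> 'a \<otimes> 'a" and \<epsilon> \<Phi> \<Phi>' S \<alpha> \<beta> R R'
    and U :: "'u::complex_vector itself"
    and V :: "'v::complex_vector itself"
    and W :: "'w::complex_vector itself" +
  fixes v v' :: 'a
  assumes ribbon_central: "v * x = x * v"
    and ribbon_inverse: "v * v' = 1" "v' * v = 1"
    and antipode_ribbon: "S v = v"
    and ribbon_monodromy: "tensor_swap R * R = (v \<otimes> v) * \<Delta> v'"


section \<open>Algebras given by generators and relations\<close>

text \<open>\<open>Scal c\<close> stands for the scalar multiple \<open>c *\<^sub>C 1\<close> of the unit.\<close>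

datatype 'g alg_term =
    Gen 'g
  | Scal complex
  | Add "'g alg_term" "'g alg_term" (infixl "\<oplus>" 65)
  | Mul "'g alg_term" "'g alg_term" (infixl "\<odot>" 70)

inductive alg_cong :: "('g alg_term \<Rightarrow> 'g alg_term \<Rightarrow> bool) \<Rightarrow> 'g alg_term \<Rightarrow> 'g alg_term \<Rightarrow> bool"
  for rel where
  relation: "rel s t \<Longrightarrow> alg_cong rel s t"
| refl: "alg_cong rel s s"
| sym: "alg_cong rel s t \<Longrightarrow> alg_cong rel t s"
| trans: "alg_cong rel s t \<Longrightarrow> alg_cong rel t r \<Longrightarrow> alg_cong rel s r"
| add: "alg_cong rel s s' \<Longrightarrow> alg_cong rel t t' \<Longrightarrow> alg_cong rel (s \<oplus> t) (s' \<oplus> t')"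
| mult: "alg_cong rel s s' \<Longrightarrow> alg_cong rel t t' \<Longrightarrow> alg_cong rel (s \<odot> t) (s' \<odot> t')"
| add_assoc: "alg_cong rel (s \<oplus> t \<oplus> r) (s \<oplus> (t \<oplus> r))"
| add_comm: "alg_cong rel (s \<oplus> t) (t \<oplus> s)"
| add_zero: "alg_cong rel (Scal 0 \<oplus> s) s"
| mult_assoc: "alg_cong rel (s \<odot> t \<odot> r) (s \<odot> (t \<odot> r))"
| mult_one: "alg_cong rel (Scal 1 \<odot> s) s"
| mult_zero: "alg_cong rel (Scal 0 \<odot> s) (Scal 0)"
| distrib_left: "alg_cong rel (s \<odot> (t \<oplus> r)) (s \<odot> t \<oplus> s \<odot> r)"
| distrib_right: "alg_cong rel ((s \<oplus> t) \<odot> r) (s \<odot> r \<oplus> t \<odot> r)"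
| scal_add: "alg_cong rel (Scal (c + d)) (Scal c \<oplus> Scal d)"
| scal_mult: "alg_cong rel (Scal (c * d)) (Scal c \<odot> Scal d)"
| scal_central: "alg_cong rel (Scal c \<odot> s) (s \<odot> Scal c)"

lemma equivp_alg_cong: "equivp (alg_cong rel)"
  by (rule equivpI)
    (auto intro!: reflpI sympI transpI intro: alg_cong.refl alg_cong.sym alg_cong.trans)

primrec alg_eval :: "('g \<Rightarrow> 'a::complex_algebra_1) \<Rightarrow> 'g alg_term \<Rightarrow> 'a" where
  "alg_eval g (Gen x) = g x"
| "alg_eval g (Scal c) = c *\<^sub>C 1"
| "alg_eval g (s \<oplus> t) = alg_eval g s + alg_eval g t"
| "alg_eval g (s \<odot> t) = alg_eval g s * alg_eval g t"

primrec alg_eval_op :: "('g \<Rightarrow> 'a::complex_algebra_1) \<Rightarrow> 'g alg_term \<Rightarrow> 'a" where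
  "alg_eval_op g (Gen x) = g x"
| "alg_eval_op g (Scal c) = c *\<^sub>C 1"
| "alg_eval_op g (s \<oplus> t) = alg_eval_op g s + alg_eval_op g t"
| "alg_eval_op g (s \<odot> t) = alg_eval_op g t * alg_eval_op g s"

lemma alg_eval_cong:
  assumes "alg_cong rel s t" and "\<And>s t. rel s t \<Longrightarrow> alg_eval g s = alg_eval g t"
  shows "alg_eval g s = alg_eval g t"
  using assms(1)
  by induction (simp_all add: assms(2) algebra_simps scaleC_add_left)

lemma alg_eval_op_cong:
  assumes "alg_cong rel s t" and "\<And>s t. rel s t \<Longrightarrow> alg_eval_op g s = alg_eval_op g t"
  shows "alg_eval_op g s = alg_eval_op g t"
  using assms(1)
  by induction (simp_all add: assms(2) algebra_simps scaleC_add_left)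


section \<open>The algebra \<open>Q\<close>\<close>

text \<open>
  The indices \<open>1, \<dots>, N\<close> are the elements of a finite linearly ordered type \<open>'n\<close>, so that
  \<open>N = CARD('n)\<close>.
\<close>

datatype sign = Pos | Neg

primrec sgn_of :: "sign \<Rightarrow> complex" where
  "sgn_of Pos = 1"
| "sgn_of Neg = - 1"

datatype 'n gen = GenK | GenF sign 'n

abbreviation "tK \<equiv> Gen GenK"
abbreviation "tF s i \<equiv> Gen (GenF s i)"

text \<open>The right-hand side of the second relation is the term for \<open>e\<^sub>1 = (1 - K\<^sup>2) / 2\<close>.\<close>

inductive Q_rel :: "'n gen alg_term \<Rightarrow> 'n gen alg_term \<Rightarrow> bool" where
  "Q_rel (tF s i \<odot> tK \<oplus> tK \<odot> tF s i) (Scal 0)"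
| "Q_rel (tF Pos i \<odot> tF Neg i \<oplus> tF Neg i \<odot> tF Pos i)
    (Scal (1/2) \<odot> (Scal 1 \<oplus> Scal (- 1) \<odot> (tK \<odot> tK)))"
| "i \<noteq> j \<Longrightarrow> Q_rel (tF Pos i \<odot> tF Neg j \<oplus> tF Neg j \<odot> tF Pos i) (Scal 0)"
| "Q_rel (tF s i \<odot> tF s j \<oplus> tF s j \<odot> tF s i) (Scal 0)"
| "Q_rel (tK \<odot> tK \<odot> tK \<odot> tK) (Scal 1)"

quotient_type 'n Q = "'n gen alg_term" / "alg_cong Q_rel"
  by (rule equivp_alg_cong)

instantiation Q :: (type) complex_algebra_1
begin

lift_definition zero_Q :: "'a Q" is "Scal 0" .
lift_definition one_Q :: "'a Q" is "Scal 1" .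
lift_definition plus_Q :: "'a Q \<Rightarrow> 'a Q \<Rightarrow> 'a Q" is Add by (rule alg_cong.add)
lift_definition times_Q :: "'a Q \<Rightarrow> 'a Q \<Rightarrow> 'a Q" is Mul by (rule alg_cong.mult)
lift_definition scaleC_Q :: "complex \<Rightarrow> 'a Q \<Rightarrow> 'a Q" is "\<lambda>c t. Scal c \<odot> t"
  by (intro alg_cong.mult alg_cong.refl)
lift_definition uminus_Q :: "'a Q \<Rightarrow> 'a Q" is "\<lambda>t. Scal (- 1) \<odot> t"
  by (intro alg_cong.mult alg_cong.refl)
definition minus_Q :: "'a Q \<Rightarrow> 'a Q \<Rightarrow> 'a Q" where "minus_Q x y = x + - y"

instance
proof
  fix x y z :: "'a Q" and c d :: complex
  show "x + y + z = x + (y + z)" by transfer (rule alg_cong.add_assoc)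
  show "x + y = y + x" by transfer (rule alg_cong.add_comm)
  show "0 + x = x" by transfer (rule alg_cong.add_zero)
  show "x - y = x + - y" by (rule minus_Q_def)
  show "x * y * z = x * (y * z)" by transfer (rule alg_cong.mult_assoc)
  show "1 * x = x" by transfer (rule alg_cong.mult_one)
  show "x * 1 = x" by transfer (meson alg_cong.intros)
  show "(x + y) * z = x * z + y * z" by transfer (rule alg_cong.distrib_right)
  show "x * (y + z) = x * y + x * z" by transfer (rule alg_cong.distrib_left)
  show "c *\<^sub>C (x + y) = c *\<^sub>C x + c *\<^sub>C y" by transfer (rule alg_cong.distrib_left)
  show sl: "(c + d) *\<^sub>C x = c *\<^sub>C x + d *\<^sub>C x" for c d
    by transfer (meson alg_cong.intros)
  show "c *\<^sub>C d *\<^sub>C x = (c * d) *\<^sub>C x" by transfer (meson alg_cong.intros)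
  show one: "1 *\<^sub>C x = x" by transfer (rule alg_cong.mult_one)
  show "(c *\<^sub>C x) * y = c *\<^sub>C (x * y)" by transfer (rule alg_cong.mult_assoc)
  show "x * (c *\<^sub>C y) = c *\<^sub>C (x * y)" by transfer (meson alg_cong.intros)
  have "- x = (- 1) *\<^sub>C x" by transfer (rule alg_cong.refl)
  moreover have "0 *\<^sub>C x = 0" by transfer (rule alg_cong.mult_zero)
  ultimately show "- x + x = 0" using sl[of "- 1" 1] one by simp
qed

end

lift_definition qK :: "'n Q" is tK .
lift_definition qf :: "sign \<Rightarrow> 'n \<Rightarrow> 'n Q" is "\<lambda>s i. tF s i" .

definition qe0 :: "'n Q" where "qe0 = (1/2) *\<^sub>C (1 + qK\<^sup>2)"
definition qe1 :: "'n Q" where "qe1 = (1/2) *\<^sub>C (1 - qK\<^sup>2)"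

definition q\<omega> :: "sign \<Rightarrow> 'n Q" where
  "q\<omega> s = (qe0 + (sgn_of s * \<i>) *\<^sub>C qe1) * qK"

lemma qf_qK: "qf s i * qK + qK * qf s i = 0"
  by transfer (intro alg_cong.relation Q_rel.intros)

lemma qf_Pos_Neg: "qf Pos i * qf Neg j + qf Neg j * qf Pos i = (if i = j then qe1 else 0)"
proof (cases "i = j")
  case True
  have "qf Pos i * qf Neg i + qf Neg i * qf Pos i = qe1"
    unfolding qe1_def power2_eq_square minus_Q_def
    by transfer (intro alg_cong.relation Q_rel.intros)
  with True show ?thesis by simp
next
  case False
  then have "qf Pos i * qf Neg j + qf Neg j * qf Pos i = 0"
    by transfer (intro alg_cong.relation Q_rel.intros)
  with False show ?thesis by simp
qed

lemma qf_same: "qf s i * qf s j + qf s j * qf s i = 0"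
  by transfer (intro alg_cong.relation Q_rel.intros)

lemma qK_power4: "qK ^ 4 = 1"
proof -
  have "qK * qK * qK * qK = (1 :: 'n Q)"
    by transfer (intro alg_cong.relation Q_rel.intros)
  then show ?thesis by (simp add: numeral_eq_Suc mult.assoc)
qed

lemma qK_simps:
  "qK * (qK * (qK * qK)) = 1" "qK * (qK * (qK * (qK * x))) = x"
  "qf s i * qK = - (qK * qf s i)" "qf s i * (qK * x) = - (qK * (qf s i * x))"
proof -
  show 1: "qK * (qK * (qK * qK)) = 1"
    using qK_power4 by (simp add: numeral_eq_Suc mult.assoc)
  show "qK * (qK * (qK * (qK * x))) = x"
    using arg_cong[OF 1, of "\<lambda>y. y * x"] by (simp add: mult.assoc)
  show 2: "qf s i * qK = - (qK * qf s i)"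
    using qf_qK[of s i] by (simp add: eq_neg_iff_add_eq_0)
  show "qf s i * (qK * x) = - (qK * (qf s i * x))"
    using arg_cong[OF 2, of "\<lambda>y. y * x"] by (simp add: mult.assoc)
qed

lemma half_scaleC: "(1/2) *\<^sub>C x + (1/2) *\<^sub>C x = x" for x :: "'a::complex_vector"
  by (simp flip: scaleC_add_left)

lemma e_sum: "qe0 + qe1 = (1 :: 'n Q)"
proof -
  have "qe0 + qe1 = (1/2) *\<^sub>C 1 + (1/2) *\<^sub>C (1 :: 'n Q)"
    by (simp add: qe0_def qe1_def scaleC_add_right complex_vector.scale_right_diff_distrib)
  then show ?thesis by (simp only: half_scaleC)
qed

lemma qK2: "qK * qK = (qe0 - qe1 :: 'n Q)"
proof -
  have "qe0 - qe1 = (1/2) *\<^sub>C (qK * qK) + (1/2) *\<^sub>C (qK * qK :: 'n Q)"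
    by (simp add: qe0_def qe1_def scaleC_add_right complex_vector.scale_right_diff_distrib
        power2_eq_square)
  then show ?thesis by (simp only: half_scaleC)
qed

lemma qe1_idem: "qe1 * qe1 = qe1"
proof -
  have "qe1 * qe1 = (1/2) *\<^sub>C (qe1 - qK * qK * qe1 :: 'n Q)"
    unfolding qe1_def by (simp add: power2_eq_square algebra_simps)
  also have "qK * qK * qe1 = (- qe1 :: 'n Q)"
    unfolding qe1_def by (simp add: power2_eq_square algebra_simps qK_simps flip: complex_vector.scale_minus_right)
  finally show ?thesis
    by (metis diff_minus_eq_add half_scaleC scaleC_add_right)
qed

lemma qe0_eq: "qe0 = 1 - qe1"
  using e_sum by (simp add: eq_diff_eq)

lemma qe1_commute:
  "qe1 * qK = qK * qe1" "qe1 * qf s i = qf s i * qe1"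
  by (simp_all add: qe1_def power2_eq_square algebra_simps qK_simps)

lemma qe1_commute':
  "qe1 * (qK * x) = qK * (qe1 * x)" "qe1 * (qf s i * x) = qf s i * (qe1 * x)"
  by (simp_all add: qe1_commute flip: mult.assoc)

lemma qe1_idem': "qe1 * (qe1 * x) = qe1 * x"
  by (simp add: qe1_idem flip: mult.assoc)

lemma q\<omega>_eq: "q\<omega> s = qK + (sgn_of s * \<i> - 1) *\<^sub>C (qK * qe1)"
  by (simp add: q\<omega>_def qe0_eq algebra_simps qe1_commute scaleC_add_left
      complex_vector.scale_left_diff_distrib)

lemma q\<omega>_qK: "q\<omega> s * qK = qK * q\<omega> s"
  by (simp add: q\<omega>_eq algebra_simps qe1_commute)

lemma q\<omega>_qf: "q\<omega> t * qf s i = - (qf s i * q\<omega> t)"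
  by (simp add: q\<omega>_eq algebra_simps qe1_commute qK_simps)

lemma scaleC_collect:
  "c *\<^sub>C x + d *\<^sub>C x = (c + d) *\<^sub>C x"
  "c *\<^sub>C x + (d *\<^sub>C x + y) = (c + d) *\<^sub>C x + y" for x :: "'a::complex_vector"
  by (simp_all add: scaleC_add_left add.assoc)

lemma q\<omega>_Pos_Neg: "q\<omega> Pos * q\<omega> Neg = qK\<^sup>2" "q\<omega> Neg * q\<omega> Pos = qK\<^sup>2"
proof -
  have "q\<omega> s * q\<omega> t = qK\<^sup>2 + ((sgn_of s * \<i> - 1) + (sgn_of t * \<i> - 1) +
      (sgn_of s * \<i> - 1) * (sgn_of t * \<i> - 1)) *\<^sub>C (qK\<^sup>2 * qe1)" for s t
  proof -
    have "(qK + c *\<^sub>C (qK * qe1)) * (qK + d *\<^sub>C (qK * qe1)) =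
        qK\<^sup>2 + (c + d + c * d) *\<^sub>C (qK\<^sup>2 * qe1)" for c d
      by (simp add: algebra_simps qe1_commute' qe1_commute qe1_idem power2_eq_square
          scaleC_add_left)
    then show ?thesis unfolding q\<omega>_eq .
  qed
  note * = this[of Pos Neg] this[of Neg Pos]
  show "q\<omega> Pos * q\<omega> Neg = qK\<^sup>2" "q\<omega> Neg * q\<omega> Pos = qK\<^sup>2"
    by (simp_all add: * algebra_simps)
qed

lemma tensor_zero_right [simp]: "u \<otimes> 0 = 0"
  using tensor_scale_right[of u 0 0] by simp

lemma tensor_minus_left: "(- u) \<otimes> v = - (u \<otimes> v)"
  using tensor_add_left[of u "- u" v] by (simp add: eq_neg_iff_add_eq_0 add.commute)

lemma tensor_minus_right: "u \<otimes> (- v) = - (u \<otimes> v)"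
  using tensor_add_right[of u v "- v"] by (simp add: eq_neg_iff_add_eq_0 add.commute)

lemma tensor_diff_left: "(u - u') \<otimes> v = u \<otimes> v - u' \<otimes> v"
  using tensor_add_left[of u "- u'" v] by (simp add: tensor_minus_left)

lemma tensor_diff_right: "u \<otimes> (v - v') = u \<otimes> v - u \<otimes> v'"
  using tensor_add_right[of u v "- v'"] by (simp add: tensor_minus_right)

primrec Q_comult_gen :: "'n gen \<Rightarrow> 'n Q \<otimes> 'n Q" where
  "Q_comult_gen GenK =
    qK \<otimes> qK - (1 + (- 1) ^ CARD('n)) *\<^sub>C ((qe1 \<otimes> qe1) * (qK \<otimes> qK))"
| "Q_comult_gen (GenF s i) = qf s i \<otimes> 1 + q\<omega> s \<otimes> qf s i"

lemma Q_comult_gen_K2: "Q_comult_gen GenK * Q_comult_gen GenK = qK\<^sup>2 \<otimes> (qK\<^sup>2 :: 'n Q)"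
proof -
  define c :: complex where "c = 1 + (- 1) ^ CARD('n)"
  have c: "c * c = c + c" by (cases "even (CARD('n))") (simp_all add: c_def)
  have "Q_comult_gen GenK = qK \<otimes> qK - c *\<^sub>C ((qK * qe1) \<otimes> (qK * qe1) :: 'n Q \<otimes> 'n Q)"
    by (simp add: c_def tensor_mult_pure qe1_commute)
  then show ?thesis
    by (simp add: algebra_simps tensor_mult_pure qe1_commute qe1_commute' qe1_idem qe1_idem' c
        power2_eq_square scaleC_add_left)
qed

lemma Q_comult_gen_F:
  "Q_comult_gen (GenF s i) * Q_comult_gen (GenF t j) + Q_comult_gen (GenF t j) * Q_comult_gen (GenF s i)
    = (qf s i * qf t j + qf t j * qf s i) \<otimes> 1
      + (q\<omega> s * q\<omega> t) \<otimes> (qf s i * qf t j) + (q\<omega> t * q\<omega> s) \<otimes> (qf t j * qf s i)"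
  by (simp add: algebra_simps tensor_mult_pure tensor_add_left q\<omega>_qf tensor_minus_left)

lemma Q_comult_rel:
  assumes "Q_rel s t"
  shows "alg_eval Q_comult_gen s = (alg_eval Q_comult_gen t :: 'n Q \<otimes> 'n Q)"
  using assms
proof cases
  case (1 s i)
  have "(qf s i \<otimes> 1 + q\<omega> s \<otimes> qf s i) * (x \<otimes> x) + (x \<otimes> x) * (qf s i \<otimes> 1 + q\<omega> s \<otimes> qf s i) = 0"
    if "qf s i * x + x * qf s i = 0" "x * q\<omega> s = q\<omega> s * x" for x :: "'n Q"
  proof -
    have "(qf s i \<otimes> 1 + q\<omega> s \<otimes> qf s i) * (x \<otimes> x) + (x \<otimes> x) * (qf s i \<otimes> 1 + q\<omega> s \<otimes> qf s i)
        = (qf s i * x + x * qf s i) \<otimes> x + (q\<omega> s * x) \<otimes> (qf s i * x + x * qf s i)"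
      by (simp add: algebra_simps tensor_mult_pure tensor_add_left tensor_add_right that(2))
    then show ?thesis by (simp add: that(1))
  qed
  note * = this[of qK] this[of "qK * qe1"]
  have "qf s i * (qK * qe1) + qK * qe1 * qf s i = 0"
    by (simp add: mult.assoc qe1_commute qK_simps)
  moreover have "qK * qe1 * q\<omega> s = q\<omega> s * (qK * qe1)"
    by (simp add: q\<omega>_eq algebra_simps qe1_commute qe1_commute')
  ultimately have "(qf s i \<otimes> 1 + q\<omega> s \<otimes> qf s i) * ((qK * qe1) \<otimes> (qK * qe1))
      + ((qK * qe1) \<otimes> (qK * qe1)) * (qf s i \<otimes> 1 + q\<omega> s \<otimes> qf s i) = 0" by (rule *(2))
  with *(1)[OF qf_qK q\<omega>_qK[symmetric]] show ?thesis
    unfolding 1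
    by (simp add: tensor_mult_pure qe1_commute right_diff_distrib left_diff_distrib
        add_diff_add[symmetric] flip: scaleC_add_right)
next
  case (5)
  have "Q_comult_gen GenK * Q_comult_gen GenK * (Q_comult_gen GenK * Q_comult_gen GenK) =
      (1 :: 'n Q \<otimes> 'n Q)"
    unfolding Q_comult_gen_K2 
    by (simp add: tensor_mult_pure one_tensor_def power2_eq_square mult.assoc qK_simps)
  then show ?thesis by (simp add: 5 mult.assoc)
next
  case (4 s i j)
  have "(q\<omega> s * q\<omega> s) \<otimes> (qf s i * qf s j) + (q\<omega> s * q\<omega> s) \<otimes> (qf s j * qf s i) = (0 :: 'n Q \<otimes> 'n Q)"
    by (simp add: qf_same flip: tensor_add_right)
  then show ?thesis
    unfolding 4 by (simp only: alg_eval.simps Q_comult_gen_F) (simp add: qf_same add.assoc)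
next
  case (2 i)
  have "Q_comult_gen (GenF Pos i) * Q_comult_gen (GenF Neg i)
      + Q_comult_gen (GenF Neg i) * Q_comult_gen (GenF Pos i) = qe1 \<otimes> 1 + qK\<^sup>2 \<otimes> (qe1 :: 'n Q)"
    unfolding Q_comult_gen_F qf_Pos_Neg q\<omega>_Pos_Neg
    by (simp add: qf_Pos_Neg add.assoc flip: tensor_add_right)
  also have "\<dots> = (1/2) *\<^sub>C (1 - qK\<^sup>2 \<otimes> (qK\<^sup>2 :: 'n Q))"
    by (simp add: qe1_def one_tensor_def tensor_scale_left tensor_scale_right tensor_diff_left
        tensor_diff_right flip: scaleC_add_right)
  finally show ?thesis
    unfolding 2 by (simp add: Q_comult_gen_K2 del: Q_comult_gen.simps)
next
  case (3 i j)
  have "qK\<^sup>2 \<otimes> (qf Pos i * qf Neg j) + qK\<^sup>2 \<otimes> (qf Neg j * qf Pos i) = (0 :: 'n Q \<otimes> 'n Q)"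
    using 3 by (simp add: qf_Pos_Neg flip: tensor_add_right)
  then show ?thesis
    unfolding 3(1,2)
    by (simp only: alg_eval.simps Q_comult_gen_F qf_Pos_Neg q\<omega>_Pos_Neg) (simp add: 3 add.assoc)
qed

lift_definition Q_comult :: "'n Q \<Rightarrow> 'n Q \<otimes> 'n Q" is "alg_eval Q_comult_gen"
  by (erule alg_eval_cong) (rule Q_comult_rel)

primrec Q_counit_gen :: "'n gen \<Rightarrow> complex" where
  "Q_counit_gen GenK = 1"
| "Q_counit_gen (GenF s i) = 0"

lift_definition Q_counit :: "'n Q \<Rightarrow> complex" is "alg_eval Q_counit_gen"
  by (erule alg_eval_cong) (auto elim!: Q_rel.cases simp: scaleC_complex_def)

primrec Q_antipode_gen :: "'n gen \<Rightarrow> 'n Q" where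
  "Q_antipode_gen GenK = (qe0 + (- 1) ^ CARD('n) *\<^sub>C qe1) * qK"
| "Q_antipode_gen (GenF s i) =
    qf s i * (qe0 + (sgn_of s * (- 1) ^ CARD('n) * \<i>) *\<^sub>C qe1) * qK"

lemma Q_antipode_mult:
  "(qe0 + c *\<^sub>C qe1) * qK * ((qe0 + d *\<^sub>C qe1) * qK) = (qe0 + (c * d) *\<^sub>C qe1) * (qK * qK)"
proof -
  have "qe0 + c *\<^sub>C qe1 = 1 + (c - 1) *\<^sub>C qe1" for c
    by (simp add: qe0_eq complex_vector.scale_left_diff_distrib)
  note * = this
  show ?thesis
    unfolding *
    by (simp add: algebra_simps qe1_commute qe1_commute' qe1_idem scaleC_add_left
        complex_vector.scale_left_diff_distrib)
qed

lemma Q_antipode_rel: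
  assumes "Q_rel s t"
  shows "alg_eval_op Q_antipode_gen s = (alg_eval_op Q_antipode_gen t :: 'n Q)"
proof -
  define g :: "complex \<Rightarrow> 'n Q" where "g c = (qe0 + c *\<^sub>C qe1) * qK" for c
  have gg: "g c * g d = (qe0 + (c * d) *\<^sub>C qe1) * (qK * qK)" for c d
    unfolding g_def by (rule Q_antipode_mult)
  have g1: "g c * g d = qK * qK" if "c * d = 1" for c d
    by (simp add: gg that e_sum)
  have gf: "g c * qf s i = - (qf s i * g c)" for c s i
    by (simp add: g_def qe0_eq algebra_simps qe1_commute qe1_commute' qK_simps)
  have gf': "g c * (qf s i * x) = - (qf s i * (g c * x))" for c s i x
    using gf[of c s i] by (metis mult.assoc mult_minus_left)
  have gcomm: "g c * g d = g d * g c" for c d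
    by (simp add: gg mult.commute)
  have K: "Q_antipode_gen GenK = g ((- 1) ^ CARD('n))"
    and F: "Q_antipode_gen (GenF s i) = qf s i * g (sgn_of s * (- 1) ^ CARD('n) * \<i>)" for s and i :: 'n
    by (simp_all add: g_def mult.assoc)
  have FF: "(qf t j * g d) * (qf s i * g c) + (qf s i * g c) * (qf t j * g d) =
      - ((qf t j * qf s i + qf s i * qf t j) * (g c * g d))" for s t i j c d
    using gcomm[of d c] by (simp add: algebra_simps gf')
  have N2: "(- 1) ^ CARD('n) * (- 1) ^ CARD('n) = (1 :: complex)"
    by (simp flip: power_mult_distrib)
  have pn: "sgn_of Pos * (- 1) ^ CARD('n) * \<i> * (sgn_of Neg * (- 1) ^ CARD('n) * \<i>) = 1"
    using N2 by (simp add: algebra_simps)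
  from assms show ?thesis
  proof cases
    case (1 s i)
    then show ?thesis
      by (simp add: K F gf gf' mult.assoc gcomm del: Q_antipode_gen.simps)
  next
    case (2 i)
    have "- (qe1 * (qK * qK)) = (qe1 :: 'n Q)"
      by (simp add: qK2 qe0_eq algebra_simps qe1_idem)
    moreover have "(1/2) *\<^sub>C (1 - qK * qK) = (qe1 :: 'n Q)"
      by (simp add: qe1_def power2_eq_square)
    ultimately show ?thesis
      unfolding 2
      by (simp add: K F FF g1[OF N2] g1[OF pn] qf_Pos_Neg add.commute[of "qf Neg i * qf Pos i"]
          del: Q_antipode_gen.simps sgn_of.simps)
  next
    case (3 i j)
    then show ?thesis
      by (simp add: F FF qf_Pos_Neg add.commute[of "qf Neg j * qf Pos i"]
          del: Q_antipode_gen.simps)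
  next
    case (4 s i j)
    then show ?thesis
      by (simp add: F FF qf_same del: Q_antipode_gen.simps)
  next
    case 5
    have "alg_eval_op Q_antipode_gen s = qK * qK * (qK * (qK :: 'n Q))"
      unfolding 5 by (simp add: K g1[OF N2] del: Q_antipode_gen.simps flip: mult.assoc)
    then show ?thesis using 5 by (simp add: mult.assoc qK_simps)
  qed
qed

lift_definition Q_antipode :: "'n Q \<Rightarrow> 'n Q" is "alg_eval_op Q_antipode_gen"
  by (erule alg_eval_op_cong) (rule Q_antipode_rel)

lemma Q_comult_values:
  "Q_comult (qK :: 'n Q) =
    qK \<otimes> qK - (1 + (- 1) ^ CARD('n)) *\<^sub>C ((qe1 \<otimes> qe1) * (qK \<otimes> qK))"
  "Q_comult (qf s i) = qf s i \<otimes> 1 + q\<omega> s \<otimes> qf s i"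
  using Q_comult.abs_eq[of tK] Q_comult.abs_eq[of "tF s i"]
  by (simp_all flip: qK.abs_eq qf.abs_eq)

lemma Q_counit_values: "Q_counit qK = 1" "Q_counit (qf s i) = 0"
  using Q_counit.abs_eq[of tK] Q_counit.abs_eq[of "tF s i"]
  by (simp_all flip: qK.abs_eq qf.abs_eq)

lemma Q_antipode_values:
  "Q_antipode (qK :: 'n Q) = (qe0 + (- 1) ^ CARD('n) *\<^sub>C qe1) * qK"
  "Q_antipode (qf s i :: 'n Q) =
    qf s i * (qe0 + (sgn_of s * (- 1) ^ CARD('n) * \<i>) *\<^sub>C qe1) * qK"
  using Q_antipode.abs_eq[of tK] Q_antipode.abs_eq[of "tF s i"]
  by (simp_all flip: qK.abs_eq qf.abs_eq)

lemma algebra_hom_Q_comult: "algebra_hom Q_comult"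
  unfolding algebra_hom_def clinear_iff one_tensor_def[symmetric]
  by (intro conjI allI; transfer; simp)

lemma algebra_hom_Q_counit: "algebra_hom Q_counit"
  unfolding algebra_hom_def clinear_iff
  by (intro conjI allI; transfer; simp add: scaleC_complex_def)

lemma algebra_antihom_Q_antipode: "algebra_antihom Q_antipode"
  unfolding algebra_antihom_def clinear_iff
  by (intro conjI allI; transfer; simp)

text \<open>\<open>Q_assoc \<beta> Pos\<close> is \<open>\<Phi>\<close> and \<open>Q_assoc \<beta> Neg\<close> is its inverse.\<close>

definition Q_assoc :: "complex \<Rightarrow> sign \<Rightarrow> 'n Q \<otimes> 'n Q \<otimes> 'n Q" where
  "Q_assoc \<beta> s = 1 \<otimes> 1 \<otimes> 1 + qe1 \<otimes> qe1 \<otimes>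
    ((qK ^ CARD('n) - 1) * qe0 + (\<beta>\<^sup>2 *\<^sub>C ((sgn_of s * \<i>) *\<^sub>C qK) ^ CARD('n) - 1) * qe1)"

definition Q_alpha :: "'n Q" where
  "Q_alpha = 1"

definition Q_beta :: "complex \<Rightarrow> 'n Q" where
  "Q_beta \<beta> = qe0 + \<beta>\<^sup>2 *\<^sub>C (\<i> *\<^sub>C qK) ^ CARD('n) * qe1"

definition qe :: "nat \<Rightarrow> 'n Q" where
  "qe n = (if n = 0 then qe0 else qe1)"

definition q\<rho> :: "nat \<Rightarrow> nat \<Rightarrow> 'n Q \<otimes> 'n Q" where
  "q\<rho> n m = (1/2) *\<^sub>C (\<Sum>p\<in>{0,1}. \<Sum>q\<in>{0,1}.
    ((- 1) ^ (p * q) * \<i> powi (- int (p * n) + int (q * m))) *\<^sub>C (qK ^ p \<otimes> qK ^ q))"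

definition ordered_prod :: "('n::{finite,linorder} \<Rightarrow> 'a::monoid_mult) \<Rightarrow> 'a" where
  "ordered_prod f = prod_list (map f (sorted_list_of_set UNIV))"

definition Q_R :: "complex \<Rightarrow> 'n::{finite,linorder} Q \<otimes> 'n Q" where
  "Q_R \<beta> = (\<Sum>n\<in>{0,1}. \<Sum>m\<in>{0,1}. \<beta> ^ (n * m) *\<^sub>C (q\<rho> n m * (qe n \<otimes> qe m))) *
    ordered_prod (\<lambda>k. 1 \<otimes> 1 - 2 *\<^sub>C ((qf Neg k * q\<omega> Neg) \<otimes> qf Pos k))"

definition Q_R_inv :: "complex \<Rightarrow> 'n::{finite,linorder} Q \<otimes> 'n Q" where
  "Q_R_inv \<beta> = ordered_prod (\<lambda>k. 1 \<otimes> 1 + 2 *\<^sub>C ((qf Neg k * q\<omega> Neg) \<otimes> qf Pos k)) *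
    (\<Sum>n\<in>{0,1}. \<Sum>m\<in>{0,1}. \<beta> powi (- int (n * m)) *\<^sub>C (q\<rho> n m * (qe n \<otimes> qe m)))"

definition Q_ribbon :: "complex \<Rightarrow> 'n::{finite,linorder} Q" where
  "Q_ribbon \<beta> = (qe0 - (\<beta> * \<i>) *\<^sub>C (qK * qe1)) *
    ordered_prod (\<lambda>k. 1 - 2 *\<^sub>C (qf Pos k * qf Neg k))"

definition Q_ribbon_inv :: "complex \<Rightarrow> 'n::{finite,linorder} Q" where
  "Q_ribbon_inv \<beta> = (qe0 - (inverse \<beta> * \<i>) *\<^sub>C (qK * qe1)) *
    ordered_prod (\<lambda>k. 1 + 2 *\<^sub>C (qf Pos k * qf Neg k * qK\<^sup>2))"

end

(*
  The idempotents e_0, e_1 are central, and the subalgebra C[K] is the algebra of functions on its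
  four characters K = 1, -1, i, -i, so its tensor powers are algebras of functions on tuples of
  characters. The coproduct of K and the antipode become a multiplication and an inversion of
  characters. Phi, boldsymbol-beta and the Cartan factors of R and v become functions, and every
  identity between them is a pointwise identity of functions. A generator f_k moves past a function
  at the cost of replacing K by -K.

  Quasi-coassociativity, the flip property of R and the centrality of v only have to be verified on
  generators, because the elements satisfying them form a subalgebra; the antipode axioms behave in
  the same way. In the products over k, the factors for different k commute, so the flip property,
  the hexagons and the monodromy reduce to the factor of a single k once the Cartan factors have
  been moved to one side. The identities that make this work are r(-x, y) = omega_+(y) r(x, y) and
  r(x, -y) = omega_-(x) r(x, y) for the Cartan factor r of R.

  The braiding axioms on modules follow from identities in the second and third tensor powers of Q
  by letting these algebras act on tensor products of modules and permuting the tensor factors.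
*)

theory Submission
  imports Defs
begin

section \<open>Linear maps on tensor products\<close>

text \<open>What the associator repairs: on e_1 (x) e_1 the coproduct of omega_s is (-1)^N omega_s
  (x) omega_s, so the two ways of applying the coproduct twice to a generator f differ by the sign
  (-1)^N in the last summand. On e_1 (x) e_1 the third leg of Phi is K^N up to scalars on e_0 and
  e_1, and moving f past K^N produces exactly this sign. The scalars make that leg, as the function
  \<open>psi\<close> of a character, multiplicative. This is what the pentagon asks for, and it is
  where beta^4 = (-1)^N enters. The same sign returns later: in the hexagons it becomes an N-th
  power of a value of omega_s, which cancels against \<open>psi\<close>, and in S(v) = v it is the
  product of N signs, one from each factor of v. No basis of Q is used. The four idempotents of C[K]
  are only known to be orthogonal with sum 1 and might a priori vanish, so identities are carried
  from functions to Q and never back.\<close>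

lemma clinear_add: "clinear f \<Longrightarrow> f (x + y) = f x + f y"
  by (simp add: clinear_iff)

lemma clinear_scaleC: "clinear f \<Longrightarrow> f (c *\<^sub>C x) = c *\<^sub>C f x"
  by (simp add: clinear_iff)

lemma clinear_zero: "clinear f \<Longrightarrow> f 0 = 0"
  using clinear_scaleC[of f 0 0] by simp

lemma clinear_minus: "clinear f \<Longrightarrow> f (- x) = - f x"
  using clinear_scaleC[of f "-1" x] by simp

lemma clinear_diff: "clinear f \<Longrightarrow> f (x - y) = f x - f y"
  using clinear_add[of f x "-y"] by (simp add: clinear_minus)

lemma clinear_sum: "clinear f \<Longrightarrow> f (\<Sum>i\<in>I. g i) = (\<Sum>i\<in>I. f (g i))"
  by (induction I rule: infinite_finite_induct) (simp_all add: clinear_zero clinear_add)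

lemmas clinear_rules = clinear_add clinear_scaleC clinear_zero clinear_minus clinear_diff
    clinear_sum

lemma cbilinearI:
  assumes "\<And>u. clinear (f u)" "\<And>v. clinear (\<lambda>u. f u v)"
  shows "cbilinear f"
  using assms by (simp add: cbilinear_def)

lemma clinear_id: "clinear id" "clinear (\<lambda>x. x)"
  by (simp_all add: clinear_iff)

lemma clinear_compose: "clinear f \<Longrightarrow> clinear g \<Longrightarrow> clinear (\<lambda>x. f (g x))"
  by (simp add: clinear_iff)

lemma clinear_mult: "clinear (\<lambda>x. a * x)" "clinear (\<lambda>x. x * a)" for a :: "'a::complex_algebra_1"
  by (simp_all add: clinear_iff algebra_simps)

lemma clinear_tensor: "clinear (\<lambda>v. u \<otimes> v)" "clinear (\<lambda>u. u \<otimes> v)"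
  by (simp_all add: clinear_iff tensor_add_left tensor_add_right tensor_scale_left
      tensor_scale_right)

lemma tensor_sum_left: "(\<Sum>i\<in>I. f i) \<otimes> v = (\<Sum>i\<in>I. f i \<otimes> v)"
  by (rule clinear_sum[OF clinear_tensor(2)])

lemma tensor_sum_right: "u \<otimes> (\<Sum>i\<in>I. f i) = (\<Sum>i\<in>I. u \<otimes> f i)"
  by (rule clinear_sum[OF clinear_tensor(1)])

lemma tensor_ext:
  assumes "clinear f" "clinear g" "\<And>u v. f (u \<otimes> v) = g (u \<otimes> v)"
  shows "f t = g t"
  by (induction t rule: tensor_induct) (simp_all add: assms clinear_rules)

lemma tensor_ext3:
  assumes "clinear f" "clinear g" "\<And>u v w. f (u \<otimes> v \<otimes> w) = g (u \<otimes> v \<otimes> w)"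
  shows "f t = g t"
proof (rule tensor_ext[OF assms(1,2)])
  show "f (s \<otimes> w) = g (s \<otimes> w)" for s w
    by (rule tensor_ext[of "\<lambda>s. f (s \<otimes> w)" "\<lambda>s. g (s \<otimes> w)"])
      (use clinear_compose[OF assms(1) clinear_tensor(2)]
        clinear_compose[OF assms(2) clinear_tensor(2)]
        assms(3) in simp_all)
qed

lemma tensor_ext3':
  assumes "clinear f" "clinear g" "\<And>u v w. f (u \<otimes> (v \<otimes> w)) = g (u \<otimes> (v \<otimes> w))"
  shows "f t = g t"
proof (rule tensor_ext[OF assms(1,2)])
  show "f (u \<otimes> s) = g (u \<otimes> s)" for s u
    by (rule tensor_ext[of "\<lambda>s. f (u \<otimes> s)" "\<lambda>s. g (u \<otimes> s)"])
      (use clinear_compose[OF assms(1) clinear_tensor(1)]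
        clinear_compose[OF assms(2) clinear_tensor(1)]
        assms(3) in simp_all)
qed

lemma cbilinear_tensor_compose:
  "clinear f \<Longrightarrow> clinear g \<Longrightarrow> cbilinear (\<lambda>u v. f u \<otimes> g v)"
  by (intro cbilinearI clinear_compose[OF clinear_tensor(1)] clinear_compose[OF clinear_tensor(2)])

lemma
  assumes "clinear f" "clinear g"
  shows clinear_tensor_map: "clinear (tensor_map f g)"
    and tensor_map_pure: "tensor_map f g (u \<otimes> v) = f u \<otimes> g v"
  unfolding tensor_map_def
  using cbilinear_tensor_compose[OF assms] by (rule clinear_tensor_lift, rule tensor_lift_pure)

text \<open>The universal property gives linearity in the tensor only. Linearity in a parameter is
  checked on pure tensors and carried to all tensors by induction.\<close>

lemma clinear_tensor_param:
  assumes "\<And>x. clinear (h x)" "\<And>u v. clinear (\<lambda>x. h x (u \<otimes> v))"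
  shows "clinear (\<lambda>x. h x t)"
proof -
  have "h (x + y) t = h x t + h y t \<and> h (c *\<^sub>C x) t = c *\<^sub>C h x t" for c x y
  proof (induction t rule: tensor_induct)
    case zero
    then show ?case by (simp add: clinear_zero[OF assms(1)])
  next
    case (add u v t)
    then show ?case
      by (simp add: clinear_add[OF assms(1)] clinear_add[OF assms(2)] clinear_scaleC[OF assms(2)]
          scaleC_add_right)
  qed
  then show ?thesis by (simp add: clinear_iff)
qed

lemma clinear_tensor_map_left:
  assumes "\<And>x. clinear (f x)" "clinear g" "\<And>u. clinear (\<lambda>x. f x u)"
  shows "clinear (\<lambda>x. tensor_map (f x) g t)"
proof (rule clinear_tensor_param)
  show "clinear (tensor_map (f x) g)" for x by (intro clinear_tensor_map assms)
  show "clinear (\<lambda>x. tensor_map (f x) g (u \<otimes> v))" for u v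
    using clinear_compose[OF clinear_tensor(2) assms(3)] by (simp add: tensor_map_pure assms)
qed

lemma clinear_tensor_map_right:
  assumes "\<And>x. clinear (g x)" "clinear f" "\<And>u. clinear (\<lambda>x. g x u)"
  shows "clinear (\<lambda>x. tensor_map f (g x) t)"
proof (rule clinear_tensor_param)
  show "clinear (tensor_map f (g x))" for x by (intro clinear_tensor_map assms)
  show "clinear (\<lambda>x. tensor_map f (g x) (u \<otimes> v))" for u v
    using clinear_compose[OF clinear_tensor(1) assms(3)] by (simp add: tensor_map_pure assms)
qed

lemma
  shows clinear_tensor_swap: "clinear tensor_swap"
    and tensor_swap_pure: "tensor_swap (u \<otimes> v) = v \<otimes> u"
proof -
  have "cbilinear (\<lambda>u v. v \<otimes> u)" by (intro cbilinearI clinear_tensor)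
  then show "clinear tensor_swap" "tensor_swap (u \<otimes> v) = v \<otimes> u"
    unfolding tensor_swap_def by (rule clinear_tensor_lift, rule tensor_lift_pure)
qed

lemma clinear_tensor_lift_left:
  assumes "\<And>x. cbilinear (f x)" "\<And>u v. clinear (\<lambda>x. f x u v)"
  shows "clinear (\<lambda>x. tensor_lift (f x) t)"
  by (rule clinear_tensor_param[OF clinear_tensor_lift[OF assms(1)]])
    (simp add: tensor_lift_pure assms)

lemma cbilinearD: "cbilinear f \<Longrightarrow> clinear (f u)" "cbilinear f \<Longrightarrow> clinear (\<lambda>u. f u v)"
  by (simp_all add: cbilinear_def)

lemma
  assumes "\<And>v w. clinear (\<lambda>u. f u v w)" "\<And>u w. clinear (\<lambda>v. f u v w)" "\<And>u v. clinear (\<lambda>w. f u v w)"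
  shows clinear_tensor_lift3: "clinear (tensor_lift (\<lambda>t w. tensor_lift (\<lambda>u v. f u v w) t))"
    and tensor_lift3_pure:
      "tensor_lift (\<lambda>t w. tensor_lift (\<lambda>u v. f u v w) t) (u \<otimes> v \<otimes> w) = f u v w"
    and clinear_tensor_lift3': "clinear (tensor_lift (\<lambda>u. tensor_lift (\<lambda>v w. f u v w)))"
    and tensor_lift3'_pure:
      "tensor_lift (\<lambda>u. tensor_lift (\<lambda>v w. f u v w)) (u \<otimes> (v \<otimes> w)) = f u v w"
proof -
  have b: "cbilinear (\<lambda>u v. f u v w)" for w by (intro cbilinearI assms)
  have B: "cbilinear (\<lambda>t w. tensor_lift (\<lambda>u v. f u v w) t)"
    by (intro cbilinearI clinear_tensor_lift_left clinear_tensor_lift b assms)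
  then show "clinear (tensor_lift (\<lambda>t w. tensor_lift (\<lambda>u v. f u v w) t))"
    by (rule clinear_tensor_lift)
  show "tensor_lift (\<lambda>t w. tensor_lift (\<lambda>u v. f u v w) t) (u \<otimes> v \<otimes> w) = f u v w"
    by (simp add: tensor_lift_pure[OF B] tensor_lift_pure[OF b])
  have b': "cbilinear (\<lambda>v w. f u v w)" for u by (intro cbilinearI assms)
  have B': "cbilinear (\<lambda>u. tensor_lift (\<lambda>v w. f u v w))"
    by (intro cbilinearI clinear_tensor_lift_left clinear_tensor_lift b' assms)
  then show "clinear (tensor_lift (\<lambda>u. tensor_lift (\<lambda>v w. f u v w)))"
    by (rule clinear_tensor_lift)
  show "tensor_lift (\<lambda>u. tensor_lift (\<lambda>v w. f u v w)) (u \<otimes> (v \<otimes> w)) = f u v w"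
    by (simp add: tensor_lift_pure[OF B'] tensor_lift_pure[OF b'])
qed

lemma
  fixes u :: "'a::complex_vector" and v :: "'b::complex_vector" and w :: "'c::complex_vector"
  shows clinear_tensor_assoc: "clinear (tensor_assoc :: 'a \<otimes> ('b \<otimes> 'c) \<Rightarrow> _)"
    and tensor_assoc_pure: "tensor_assoc (u \<otimes> (v \<otimes> w)) = u \<otimes> v \<otimes> w"
proof -
  have "clinear (\<lambda>u. u \<otimes> v \<otimes> w)" "clinear (\<lambda>v. u \<otimes> v \<otimes> w)" "clinear (\<lambda>w. u \<otimes> v \<otimes> w)"
    for u :: 'a and v :: 'b and w :: 'c
    by (simp_all add: clinear_compose[OF clinear_tensor(2) clinear_tensor(1)]
        clinear_compose[OF clinear_tensor(2) clinear_tensor(2)] clinear_tensor)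
  then show "clinear (tensor_assoc :: 'a \<otimes> ('b \<otimes> 'c) \<Rightarrow> _)" "tensor_assoc (u \<otimes> (v \<otimes> w)) = u \<otimes> v \<otimes> w"
    unfolding tensor_assoc_def by (rule clinear_tensor_lift3' tensor_lift3'_pure; assumption)+
qed

lemma
  fixes u :: "'a::complex_vector" and v :: "'b::complex_vector" and w :: "'c::complex_vector"
  shows clinear_tensor_unassoc: "clinear (tensor_unassoc :: 'a \<otimes> 'b \<otimes> 'c \<Rightarrow> _)"
    and tensor_unassoc_pure: "tensor_unassoc (u \<otimes> v \<otimes> w) = u \<otimes> (v \<otimes> w)"
proof -
  have "clinear (\<lambda>u. u \<otimes> (v \<otimes> w))" "clinear (\<lambda>v. u \<otimes> (v \<otimes> w))" "clinear (\<lambda>w. u \<otimes> (v \<otimes> w))"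
    for u :: 'a and v :: 'b and w :: 'c
    by (simp_all add: clinear_compose[OF clinear_tensor(1) clinear_tensor(1)]
        clinear_compose[OF clinear_tensor(1) clinear_tensor(2)] clinear_tensor)
  then show "clinear (tensor_unassoc :: 'a \<otimes> 'b \<otimes> 'c \<Rightarrow> _)" "tensor_unassoc (u \<otimes> v \<otimes> w) =
      u \<otimes> (v \<otimes> w)"
    unfolding tensor_unassoc_def by (rule clinear_tensor_lift3 tensor_lift3_pure; assumption)+
qed

lemma tensor_assoc_unassoc: "tensor_assoc (tensor_unassoc t) = t"
  by (rule tensor_ext3[OF clinear_compose[OF clinear_tensor_assoc clinear_tensor_unassoc]
      clinear_id(2)])
    (simp add: tensor_assoc_pure tensor_unassoc_pure)

lemma tensor_unassoc_assoc: "tensor_unassoc (tensor_assoc t) = t"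
  by (rule tensor_ext3'[OF clinear_compose[OF clinear_tensor_unassoc clinear_tensor_assoc]
      clinear_id(2)])
    (simp add: tensor_assoc_pure tensor_unassoc_pure)

lemma tensor_swap_swap: "tensor_swap (tensor_swap t) = t"
  by (rule tensor_ext[OF clinear_compose[OF clinear_tensor_swap clinear_tensor_swap] clinear_id(2)])
    (simp add: tensor_swap_pure)

lemma tensor_map_compose:
  assumes "clinear f" "clinear g" "clinear f'" "clinear g'"
  shows "tensor_map (\<lambda>x. f (g x)) (\<lambda>x. f' (g' x)) t = tensor_map f f' (tensor_map g g' t)"
  by (rule tensor_ext[OF clinear_tensor_map clinear_compose[OF clinear_tensor_map
      clinear_tensor_map]])
    (simp_all add: assms clinear_compose tensor_map_pure)

section \<open>Algebra homomorphisms\<close>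

lemma algebra_homD:
  assumes "algebra_hom h"
  shows "clinear h" "h 1 = 1" "h (x * y) = h x * h y"
  using assms by (simp_all add: algebra_hom_def)

lemma algebra_hom_tensorI:
  assumes "clinear h" "h (1 \<otimes> 1) = 1"
    "\<And>a b c d. h ((a * c) \<otimes> (b * d)) = h (a \<otimes> b) * h (c \<otimes> d)"
  shows "algebra_hom h"
proof -
  have 1: "h ((a \<otimes> b) * t) = h (a \<otimes> b) * h t" for a b t
    by (rule tensor_ext[OF clinear_compose[OF assms(1) clinear_mult(1)]
          clinear_compose[OF clinear_mult(1) assms(1)]])
      (simp add: tensor_mult_pure assms(3))
  have "h (s * t) = h s * h t" for s t
    by (rule tensor_ext[OF clinear_compose[OF assms(1) clinear_mult(2)]
          clinear_compose[OF clinear_mult(2) assms(1)]])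
      (rule 1)
  with assms show ?thesis by (simp add: algebra_hom_def one_tensor_def)
qed

lemma algebra_hom_id: "algebra_hom id"
  by (simp add: algebra_hom_def clinear_id)

lemma algebra_hom_compose: "algebra_hom f \<Longrightarrow> algebra_hom g \<Longrightarrow> algebra_hom (\<lambda>x. f (g x))"
  by (simp add: algebra_hom_def clinear_iff)

lemma algebra_hom_power: "algebra_hom h \<Longrightarrow> h (x ^ n) = h x ^ n"
  by (induction n) (simp_all add: algebra_homD)

lemma algebra_antihomD:
  assumes "algebra_antihom h"
  shows "clinear h" "h 1 = 1" "h (x * y) = h y * h x"
  using assms by (simp_all add: algebra_antihom_def)

lemma algebra_antihom_power: "algebra_antihom h \<Longrightarrow> h (x ^ n) = h x ^ n"
  by (induction n) (simp_all add: algebra_antihomD power_commutes)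

lemma algebra_hom_tensor_map:
  assumes "algebra_hom f" "algebra_hom g"
  shows "algebra_hom (tensor_map f g)"
  using algebra_homD[OF assms(1)] algebra_homD[OF assms(2)]
  by (intro algebra_hom_tensorI clinear_tensor_map)
    (simp_all add: tensor_map_pure tensor_mult_pure one_tensor_def)

lemma algebra_hom_tensor_swap: "algebra_hom tensor_swap"
  by (intro algebra_hom_tensorI clinear_tensor_swap)
    (simp_all add: tensor_swap_pure tensor_mult_pure one_tensor_def)

lemma algebra_hom_tensor3I:
  assumes h: "clinear h" and "h (1 \<otimes> 1 \<otimes> 1) = 1"
    and pure: "\<And>a b c a' b' c'. h ((a * a') \<otimes> (b * b') \<otimes> (c * c')) =
        h (a \<otimes> b \<otimes> c) * h (a' \<otimes> b' \<otimes> c')"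
  shows "algebra_hom h"
proof -
  have 1: "h ((a \<otimes> b \<otimes> c) * t) = h (a \<otimes> b \<otimes> c) * h t" for a b c t
    by (rule tensor_ext3[OF clinear_compose[OF h clinear_mult(1)]
        clinear_compose[OF clinear_mult(1) h]])
      (simp add: tensor_mult_pure pure)
  have "h (s * t) = h s * h t" for s t
    by (rule tensor_ext3[OF clinear_compose[OF h clinear_mult(2)]
        clinear_compose[OF clinear_mult(2) h]])
      (rule 1)
  with assms show ?thesis by (simp add: algebra_hom_def one_tensor_def)
qed

lemma algebra_hom_tensor_unassoc: "algebra_hom tensor_unassoc"
  by (intro algebra_hom_tensor3I clinear_tensor_unassoc)
    (simp_all add: tensor_unassoc_pure tensor_mult_pure one_tensor_def)

lemma algebra_hom_tensor_assoc: "algebra_hom tensor_assoc"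
  (is "algebra_hom (?h :: 'a::complex_algebra_1 \<otimes> ('b::complex_algebra_1 \<otimes> 'c::complex_algebra_1)
    \<Rightarrow> _)")
proof -
  \<comment> \<open>Multiplicativity is inherited from the inverse map
    \<open>tensor_unassoc\<close>.\<close>
  have "?h (s * t) = ?h s * ?h t" for s t
    using algebra_homD(3)[OF algebra_hom_tensor_unassoc, of "tensor_assoc s" "tensor_assoc t"]
    by (metis tensor_assoc_unassoc tensor_unassoc_assoc)
  then show ?thesis
    by (simp add: algebra_hom_def clinear_tensor_assoc one_tensor_def tensor_assoc_pure)
qed

lemma algebra_hom_tensor_left: "algebra_hom (\<lambda>a. a \<otimes> 1)"
  by (simp add: algebra_hom_def clinear_tensor one_tensor_def tensor_mult_pure)

lemma algebra_hom_tensor_right: "algebra_hom (\<lambda>a. 1 \<otimes> a)"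
  by (simp add: algebra_hom_def clinear_tensor one_tensor_def tensor_mult_pure)

section \<open>Functional calculus for systems of orthogonal idempotents\<close>

text \<open>For a complete system of orthogonal idempotents this is the unital algebra homomorphism
  from the functions on \<open>I\<close> that sends the delta functions to the idempotents.\<close>

definition diag :: "'i set \<Rightarrow> ('i \<Rightarrow> 'a::complex_vector) \<Rightarrow> ('i \<Rightarrow> complex) \<Rightarrow> 'a" where
  "diag I P F = (\<Sum>i\<in>I. F i *\<^sub>C P i)"

lemma diag_cong: "(\<And>i. i \<in> I \<Longrightarrow> F i = G i) \<Longrightarrow> diag I P F = diag I P G"
  by (simp add: diag_def)

lemma diag_add: "diag I P F + diag I P G = diag I P (\<lambda>i. F i + G i)"
  by (simp add: diag_def scaleC_add_left sum.distrib)

lemma diag_scaleC: "c *\<^sub>C diag I P F = diag I P (\<lambda>i. c * F i)"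
  by (simp add: diag_def complex_vector.scale_sum_right)

lemma diag_minus: "- diag I P F = diag I P (\<lambda>i. - F i)"
  by (simp add: diag_def sum_negf)

lemma diag_diff: "diag I P F - diag I P G = diag I P (\<lambda>i. F i - G i)"
  by (simp add: diag_def complex_vector.scale_left_diff_distrib sum_subtractf)

lemma diag_zero: "diag I P (\<lambda>i. 0) = 0"
  by (simp add: diag_def)

lemma diag_sum: "(\<Sum>a\<in>A. diag I P (F a)) = diag I P (\<lambda>i. \<Sum>a\<in>A. F a i)"
  by (simp add: diag_def complex_vector.scale_sum_left sum.swap[of _ I A])

lemma diag_pointwise: "finite I \<Longrightarrow> i \<in> I \<Longrightarrow> P i = diag I P (\<lambda>j. if j = i then 1 else 0)"
  by (simp add: diag_def if_distrib[of "\<lambda>c. c *\<^sub>C _"] cong: if_cong)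

definition tensor_family :: "('i \<Rightarrow> 'a::complex_vector) \<Rightarrow> ('j \<Rightarrow> 'b::complex_vector) \<Rightarrow> 'i \<times> 'j \<Rightarrow> 'a
    \<otimes> 'b"
    (infixl "\<boxtimes>" 68) where
  "P \<boxtimes> Q = (\<lambda>(i, j). P i \<otimes> Q j)"

lemma diag_tensor: "diag I P F \<otimes> diag J Q G = diag (I \<times> J) (P \<boxtimes> Q) (\<lambda>(i, j). F i * G j)"
proof -
  have "diag I P F \<otimes> diag J Q G = (\<Sum>i\<in>I. \<Sum>j\<in>J. (F i * G j) *\<^sub>C (P i \<otimes> Q j))"
    by (simp only: diag_def tensor_sum_left)
      (simp add: tensor_sum_right tensor_scale_left tensor_scale_right
        complex_vector.scale_sum_right
        mult.commute)
  then show ?thesis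
    by (simp add: sum.cartesian_product diag_def tensor_family_def case_prod_beta)
qed

locale idempotent_system =
  fixes I :: "'i set" and P :: "'i \<Rightarrow> 'a::complex_algebra_1"
  assumes finite_index: "finite I"
    and complete: "(\<Sum>i\<in>I. P i) = 1"
    and orthogonal: "i \<in> I \<Longrightarrow> j \<in> I \<Longrightarrow> P i * P j = (if i = j then P i else 0)"
begin

lemma diag_one: "diag I P (\<lambda>i. 1) = 1"
  by (simp add: diag_def complete)

lemma diag_mult: "diag I P F * diag I P G = diag I P (\<lambda>i. F i * G i)"
proof -
  have "diag I P F * diag I P G = (\<Sum>i\<in>I. \<Sum>j\<in>I. (F i * G j) *\<^sub>C (P i * P j))"
    by (simp add: diag_def sum_product mult.commute)
  also have "\<dots> = (\<Sum>i\<in>I. \<Sum>j\<in>I. if i = j then (F i * G j) *\<^sub>C P i else 0)"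
    by (intro sum.cong) (simp_all add: orthogonal)
  also have "\<dots> = diag I P (\<lambda>i. F i * G i)"
    by (simp add: diag_def finite_index)
  finally show ?thesis .
qed

lemma diag_mult': "diag I P F * (diag I P G * x) = diag I P (\<lambda>i. F i * G i) * x"
  by (simp add: diag_mult flip: mult.assoc)

lemma diag_commute: "diag I P F * diag I P G = diag I P G * diag I P F"
  by (simp add: diag_mult mult.commute)

lemma diag_power: "diag I P F ^ n = diag I P (\<lambda>i. F i ^ n)"
  by (induction n) (simp_all add: diag_one diag_mult)

end

lemma idempotent_system_tensor:
  assumes "idempotent_system I P" "idempotent_system J Q"
  shows "idempotent_system (I \<times> J) (P \<boxtimes> Q)"
proof -
  interpret P: idempotent_system I P by fact
  interpret Q: idempotent_system J Q by fact
  have "(\<Sum>x\<in>I \<times> J. (P \<boxtimes> Q) x) = 1"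
    using diag_tensor[of I P "\<lambda>_. 1" J Q "\<lambda>_. 1"]
    unfolding P.diag_one Q.diag_one by (simp add: one_tensor_def diag_def case_prod_beta)
  then show ?thesis
    by unfold_locales
      (auto simp: P.finite_index Q.finite_index tensor_family_def tensor_mult_pure P.orthogonal
        Q.orthogonal split: if_splits)
qed

text \<open>Such an \<open>h\<close> acts on functions as the pullback along \<open>g\<close>, so
  the arrow is reversed. Of \<open>h\<close> only linearity is asked, which admits the antipode and
  contractions such as a (x) b \<mapsto> S(a) b next to algebra homomorphisms.\<close>

definition pulls :: "('a::complex_vector \<Rightarrow> 'b::complex_vector) \<Rightarrow> 'i set \<Rightarrow> ('i \<Rightarrow> 'a) \<Rightarrow>
    'j set \<Rightarrow> ('j \<Rightarrow> 'b) \<Rightarrow> ('j \<Rightarrow> 'i) \<Rightarrow> bool" where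
  "pulls h I P J Q g \<longleftrightarrow> clinear h \<and> finite I \<and> g ` J \<subseteq> I \<and>
    (\<forall>i\<in>I. h (P i) = diag J Q (\<lambda>j. if g j = i then 1 else 0))"

lemma pulls_diag:
  assumes "pulls h I P J Q g"
  shows "h (diag I P F) = diag J Q (\<lambda>j. F (g j))"
proof -
  have h: "clinear h" "finite I" "\<And>j. j \<in> J \<Longrightarrow> g j \<in> I"
    "\<And>i. i \<in> I \<Longrightarrow> h (P i) = diag J Q (\<lambda>j. if g j = i then 1 else 0)"
    using assms by (auto simp: pulls_def)
  have "h (diag I P F) = (\<Sum>i\<in>I. \<Sum>j\<in>J. (if g j = i then F i else 0) *\<^sub>C Q j)"
    by (simp add: diag_def clinear_rules[OF h(1)] h(4) complex_vector.scale_sum_right)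
      (intro sum.cong, simp_all)
  also have "\<dots> = (\<Sum>j\<in>J. (\<Sum>i\<in>I. if g j = i then F i else 0) *\<^sub>C Q j)"
    by (subst sum.swap) (simp add: complex_vector.scale_sum_left)
  also have "\<dots> = diag J Q (\<lambda>j. F (g j))"
    unfolding diag_def by (intro sum.cong) (simp_all add: h)
  finally show ?thesis .
qed

lemma pullsI:
  assumes "clinear h" "finite I" "g ` J \<subseteq> I" "\<And>F. h (diag I P F) = diag J Q (\<lambda>j. F (g j))"
  shows "pulls h I P J Q g"
proof -
  have "h (P i) = diag J Q (\<lambda>j. if g j = i then 1 else 0)" if "i \<in> I" for i
    unfolding diag_pointwise[OF assms(2) that] by (rule assms(4))
  with assms(1-3) show ?thesis by (simp add: pulls_def)
qed

text \<open>For the contractions that insert boldsymbol-beta: these are a fixed Cartan element times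
  a pullback.\<close>

lemma diag_weighted:
  fixes x :: "'b::complex_algebra_1"
  assumes "clinear h" "pulls h' I P J Q g" "\<And>i. i \<in> I \<Longrightarrow> h (P i) = x * h' (P i)"
  shows "h (diag I P F) = x * diag J Q (\<lambda>j. F (g j))"
proof -
  have "h (diag I P F) = x * h' (diag I P F)"
  proof -
    have "clinear h'" using assms(2) by (simp add: pulls_def)
    then show ?thesis
      by (simp add: diag_def clinear_rules[OF assms(1)] clinear_rules[of h']
          sum_distrib_left assms(3))
  qed
  then show ?thesis by (simp add: pulls_diag[OF assms(2)])
qed

lemma pulls_id: "finite I \<Longrightarrow> pulls id I P I P (\<lambda>i. i)"
  by (auto simp: pulls_def clinear_id diag_pointwise)

lemma pulls_tensor_map:
  assumes "pulls h I P I' P' g" "pulls k J Q J' Q' g'"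
  shows "pulls (tensor_map h k) (I \<times> J) (P \<boxtimes> Q) (I' \<times> J') (P' \<boxtimes> Q') (\<lambda>(i, j). (g i, g' j))"
proof -
  have lin: "clinear h" "clinear k" using assms by (simp_all add: pulls_def)
  have "tensor_map h k ((P \<boxtimes> Q) (i, j)) =
      diag (I' \<times> J') (P' \<boxtimes> Q') (\<lambda>x. if (case x of (a, b) \<Rightarrow> (g a, g' b)) = (i, j) then 1 else 0)"
    if "i \<in> I" "j \<in> J" for i j
    using that assms
    by (simp add: tensor_family_def[of P Q] tensor_map_pure lin pulls_def diag_tensor)
      (auto intro!: diag_cong)
  then show ?thesis
    using assms by (auto simp: pulls_def clinear_tensor_map)
qed

lemma diag_tensor_swap:
  "tensor_swap (diag (I \<times> J) (P \<boxtimes> Q) F) = diag (J \<times> I) (Q \<boxtimes> P) (\<lambda>(j, i). F (i, j))"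
  unfolding diag_def clinear_rules[OF clinear_tensor_swap]
  by (rule sum.reindex_bij_witness[of _ prod.swap prod.swap])
    (auto simp: tensor_family_def tensor_swap_pure)

lemma diag_tensor_assoc:
  "tensor_assoc (diag (I \<times> (J \<times> K)) (P \<boxtimes> (Q \<boxtimes> R)) F) =
    diag ((I \<times> J) \<times> K) ((P \<boxtimes> Q) \<boxtimes> R) (\<lambda>((i, j), k). F (i, (j, k)))"
  unfolding diag_def clinear_rules[OF clinear_tensor_assoc]
  by (rule sum.reindex_bij_witness[of _ "\<lambda>((i, j), k). (i, (j, k))" "\<lambda>(i, (j, k)). ((i, j), k)"])
    (auto simp: tensor_family_def tensor_assoc_pure)

lemma diag_tensor_unassoc:
  "tensor_unassoc (diag ((I \<times> J) \<times> K) ((P \<boxtimes> Q) \<boxtimes> R) F) =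
    diag (I \<times> (J \<times> K)) (P \<boxtimes> (Q \<boxtimes> R)) (\<lambda>(i, (j, k)). F ((i, j), k))"
  unfolding diag_def clinear_rules[OF clinear_tensor_unassoc]
  by (rule sum.reindex_bij_witness[of _ "\<lambda>(i, (j, k)). ((i, j), k)" "\<lambda>((i, j), k). (i, (j, k))"])
    (auto simp: tensor_family_def tensor_unassoc_pure)

lemma pulls_tensor_assoc:
  assumes "finite I" "finite J" "finite K"
  shows "pulls tensor_assoc (I \<times> (J \<times> K)) (P \<boxtimes> (Q \<boxtimes> R)) ((I \<times> J) \<times> K) (P \<boxtimes> Q \<boxtimes> R) (\<lambda>((i, j), k).
      (i, (j, k)))"
proof (rule pullsI)
  show "tensor_assoc (diag (I \<times> (J \<times> K)) (P \<boxtimes> (Q \<boxtimes> R)) F) =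
      diag ((I \<times> J) \<times> K) (P \<boxtimes> Q \<boxtimes> R) (\<lambda>x. F ((\<lambda>((i, j), k). (i, (j, k))) x))" for F
    unfolding diag_tensor_assoc by (rule diag_cong) auto
qed (use assms in \<open>auto simp: clinear_tensor_assoc\<close>)

text \<open>On functions this becomes m F = (F o g) m. Since \<open>g\<close> is an involution of
  \<open>I\<close>, the sum can be reindexed by \<open>g\<close> itself.\<close>

definition moves :: "'i set \<Rightarrow> ('i \<Rightarrow> 'a::complex_algebra_1) \<Rightarrow> 'a \<Rightarrow> ('i \<Rightarrow> 'i) \<Rightarrow> bool" where
  "moves I P m g \<longleftrightarrow> (\<forall>i\<in>I. g i \<in> I \<and> g (g i) = i \<and> m * P i = P (g i) * m)"

lemma moves_diag:
  assumes "moves I P m g"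
  shows "m * diag I P F = diag I P (\<lambda>i. F (g i)) * m"
proof -
  have g: "\<And>i. i \<in> I \<Longrightarrow> g i \<in> I" "\<And>i. i \<in> I \<Longrightarrow> g (g i) = i"
    and m: "\<And>i. i \<in> I \<Longrightarrow> m * P i = P (g i) * m"
    using assms by (simp_all add: moves_def)
  have "m * diag I P F = (\<Sum>i\<in>I. F i *\<^sub>C (P (g i) * m))"
    by (simp add: diag_def sum_distrib_left m)
  also have "\<dots> = (\<Sum>i\<in>I. F (g i) *\<^sub>C (P i * m))"
    by (rule sum.reindex_bij_witness[of _ g g]) (simp_all add: g)
  also have "\<dots> = diag I P (\<lambda>i. F (g i)) * m"
    by (simp add: diag_def sum_distrib_right)
  finally show ?thesis .
qed

lemma moves_one: "moves I P 1 (\<lambda>i. i)"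
  by (simp add: moves_def)

lemma moves_tensor:
  "moves I P m g \<Longrightarrow> moves J Q n h \<Longrightarrow> moves (I \<times> J) (P \<boxtimes> Q) (m \<otimes> n) (\<lambda>(i, j). (g i, h j))"
  by (auto simp: moves_def tensor_family_def tensor_mult_pure)

section \<open>Characters of the group algebra of \<open>K\<close>\<close>

text \<open>A character of C[K] is identified with its value at K, a fourth root of unity.\<close>

definition C4 :: "complex set" where
  "C4 = {1, - 1, \<i>, - \<i>}"

lemma C4_distinct:
  "\<i> \<noteq> 1" "\<i> \<noteq> - 1" "1 \<noteq> \<i>" "- 1 \<noteq> \<i>" "1 \<noteq> - \<i>" "- \<i> \<noteq> 1" "- \<i> \<noteq> - 1" "- 1 \<noteq> - \<i>"
  "\<i> \<noteq> - \<i>" "- \<i> \<noteq> \<i>"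
  by (simp_all add: complex_eq_iff)

lemma finite_C4: "finite C4"
  by (simp add: C4_def)

lemma sum_C4: "(\<Sum>z\<in>C4. f z) = f 1 + f (- 1) + f \<i> + f (- \<i>)"
    for f :: "complex \<Rightarrow> 'a::comm_monoid_add"
  by (simp add: C4_def C4_distinct add.assoc)

lemma C4_uminus: "z \<in> C4 \<Longrightarrow> - z \<in> C4"
  by (auto simp: C4_def)

lemma C4_power4: "z \<in> C4 \<Longrightarrow> z ^ 4 = 1"
  by (auto simp: C4_def)

text \<open>Orthogonality of the characters of the cyclic group of order 4, with z^3, z^2 and z in
  the place of the inverse powers of z.\<close>

lemma qp_coefficient:
  assumes "z \<in> C4" "t \<in> C4"
  shows "(1/4) * (1 + z ^ 3 * t + z\<^sup>2 * t ^ 2 + z * t ^ 3) = (if z = t then 1 else (0 :: complex))"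
  using assms by (auto simp: C4_def C4_distinct power3_eq_cube)

text \<open>The projection onto the eigenvalue z of K: the discrete Fourier sum of z^(-j) K^j over j
  < 4, divided by 4, with negative exponents reduced modulo 4.\<close>

definition qp :: "complex \<Rightarrow> 'n Q" where
  "qp z = (1/4) *\<^sub>C (1 + z ^ 3 *\<^sub>C qK + z\<^sup>2 *\<^sub>C qK ^ 2 + z *\<^sub>C qK ^ 3)"

lemma qK_idem: "z \<in> C4 \<Longrightarrow> qK * qp z = z *\<^sub>C qp z"
proof -
  assume z: "z \<in> C4"
  have "qK * qp z = (1/4) *\<^sub>C (qK + z ^ 3 *\<^sub>C qK ^ 2 + z\<^sup>2 *\<^sub>C qK ^ 3 + z *\<^sub>C qK ^ 4)"
    by (simp add: qp_def algebra_simps numeral_eq_Suc)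
  also have "\<dots> = z *\<^sub>C qp z"
    using C4_power4[OF z]
    by (simp add: qp_def qK_simps scaleC_add_right power4_eq_xxxx power3_eq_cube power2_eq_square
        mult.assoc)
  finally show ?thesis .
qed

lemma qK_power_idem: "z \<in> C4 \<Longrightarrow> qK ^ n * qp z = z ^ n *\<^sub>C qp z"
  by (induction n) (simp_all add: mult.assoc qK_idem power_commutes mult.commute)

lemma idempotent_system_qp: "idempotent_system C4 (qp :: complex \<Rightarrow> 'n Q)"
proof
  show "finite C4" by (rule finite_C4)
  show "(\<Sum>z\<in>C4. qp z) = (1 :: 'n Q)"
    by (simp add: sum_C4 qp_def power3_eq_cube algebra_simps flip: scaleC_add_left)
  show "qp x * qp y = (if x = y then qp x else 0 :: 'n Q)" if "x \<in> C4" "y \<in> C4" for x y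
  proof -
    \<comment> \<open>K acts on \<open>qp y\<close> as the scalar y, so the polynomial
      \<open>qp x\<close> in K acts as its value at y.\<close>
    have "qp x * (qp y :: 'n Q) = ((1/4) * (1 + x ^ 3 * y + x\<^sup>2 * y ^ 2 + x * y ^ 3)) *\<^sub>C qp y"
      unfolding qp_def[of x]
      by (simp add: ring_distribs qK_idem qK_power_idem that scaleC_add_left scaleC_add_right
          flip: add_divide_distrib)
        (simp add: add_divide_distrib scaleC_add_left)
    then show ?thesis unfolding qp_coefficient[OF that] by simp
  qed
qed

interpretation C1: idempotent_system C4 qp
  by (rule idempotent_system_qp)
interpretation C2: idempotent_system "C4 \<times> C4" "qp \<boxtimes> qp"
  by (intro idempotent_system_tensor idempotent_system_qp)
interpretation C3: idempotent_system "(C4 \<times> C4) \<times> C4" "qp \<boxtimes> qp \<boxtimes> qp"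
  by (intro idempotent_system_tensor idempotent_system_qp)
interpretation C4: idempotent_system "((C4 \<times> C4) \<times> C4) \<times> C4" "qp \<boxtimes> qp \<boxtimes> qp \<boxtimes> qp"
  by (intro idempotent_system_tensor idempotent_system_qp)

abbreviation D1 :: "(complex \<Rightarrow> complex) \<Rightarrow> 'n Q" where
  "D1 \<equiv> diag C4 qp"
abbreviation D2 :: "(complex \<times> complex \<Rightarrow> complex) \<Rightarrow> 'n Q \<otimes> 'n Q" where
  "D2 \<equiv> diag (C4 \<times> C4) (qp \<boxtimes> qp)"
abbreviation D3 :: "((complex \<times> complex) \<times> complex \<Rightarrow> complex) \<Rightarrow> 'n Q \<otimes> 'n Q \<otimes> 'n Q" where
  "D3 \<equiv> diag ((C4 \<times> C4) \<times> C4) (qp \<boxtimes> qp \<boxtimes> qp)"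
abbreviation D4 :: "(((complex \<times> complex) \<times> complex) \<times> complex \<Rightarrow> complex) \<Rightarrow>
    'n Q \<otimes> 'n Q \<otimes> 'n Q \<otimes> 'n Q" where
  "D4 \<equiv> diag (((C4 \<times> C4) \<times> C4) \<times> C4) (qp \<boxtimes> qp \<boxtimes> qp \<boxtimes> qp)"

text \<open>The idempotents are polynomials in K, so the image of K decides everything. Only powers
  of K have to be respected, hence homomorphisms and anti-homomorphisms are treated alike.\<close>

lemma pulls_qK:
  assumes "clinear h" "h 1 = 1" "\<And>n. h (qK ^ n) = h qK ^ n" "idempotent_system J Q"
    "h qK = diag J Q g" "g ` J \<subseteq> C4"
  shows "pulls h C4 qp J Q g"
proof -
  interpret idempotent_system J Q by fact
  have "h (qp z) = diag J Q (\<lambda>j. (1/4) * (1 + z ^ 3 * g j + z\<^sup>2 * g j ^ 2 + z * g j ^ 3))" for z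
    using assms(3)[of 2] assms(3)[of 3]
    by (simp only: qp_def clinear_rules[OF assms(1)] assms(2,5))
      (simp only: diag_one[symmetric] diag_power diag_scaleC diag_add)
  moreover have "diag J Q (\<lambda>j. (1/4) * (1 + z ^ 3 * g j + z\<^sup>2 * g j ^ 2 + z * g j ^ 3)) =
      diag J Q (\<lambda>j. if g j = z then 1 else 0)" if "z \<in> C4" for z
  proof (rule diag_cong)
    fix j assume "j \<in> J"
    then have "g j \<in> C4" using assms(6) by auto
    then show "(1/4) * (1 + z ^ 3 * g j + z\<^sup>2 * g j ^ 2 + z * g j ^ 3) = (if g j = z then 1 else 0)"
      unfolding qp_coefficient[OF that \<open>g j \<in> C4\<close>] by auto
  qed
  ultimately show ?thesis
    using assms(1,6) by (simp add: pulls_def finite_C4)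
qed

text \<open>These are the characters with K^2 = -1, that is, the support of e_1.\<close>

definition odd_char :: "complex \<Rightarrow> bool" where
  "odd_char z \<longleftrightarrow> z = \<i> \<or> z = - \<i>"

definition omega_char :: "sign \<Rightarrow> complex \<Rightarrow> complex" where
  "omega_char s z = (if odd_char z then sgn_of s * \<i> * z else z)"

lemma qK_D1: "qK = D1 (\<lambda>z. z)"
proof -
  have "qK * (\<Sum>z\<in>C4. qp z) = D1 (\<lambda>z. z)"
    unfolding diag_def sum_distrib_left by (intro sum.cong) (simp_all add: qK_idem)
  then show ?thesis by (simp add: C1.complete)
qed

lemma qe1_D1: "qe1 = D1 (\<lambda>z. if odd_char z then 1 else 0)"
  unfolding qe1_def qK_D1 C1.diag_power
  unfolding C1.diag_one[symmetric] diag_diff diag_scaleC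
  by (intro diag_cong) (auto simp: C4_def odd_char_def C4_distinct)

lemma qe0_D1: "qe0 = D1 (\<lambda>z. if odd_char z then 0 else 1)"
  unfolding qe0_def qK_D1 C1.diag_power
  unfolding C1.diag_one[symmetric] diag_add diag_scaleC
  by (intro diag_cong) (auto simp: C4_def odd_char_def C4_distinct)

lemma q\<omega>_D1: "q\<omega> s = D1 (omega_char s)"
  unfolding q\<omega>_def qe0_D1 qe1_D1 diag_scaleC diag_add unfolding qK_D1 C1.diag_mult
  by (intro diag_cong) (auto simp: omega_char_def)

lemma moves_qf: "moves C4 qp (qf s i) uminus"
proof -
  have "qf s i * qp z = qp (- z) * qf s i" for z
    by (simp add: qp_def algebra_simps numeral_eq_Suc qK_simps)
  then show ?thesis by (auto simp: moves_def C4_uminus)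
qed

lemma D1_tensor: "D1 F \<otimes> D1 G = D2 (\<lambda>(x, y). F x * G y)"
  by (rule diag_tensor)

lemma D2_tensor: "D2 F \<otimes> D1 G = D3 (\<lambda>(x, y). F x * G y)"
  by (rule diag_tensor)

section \<open>Ordered products\<close>

lemma prod_list_hom:
  assumes "h 1 = 1" "\<And>x y. h (x * y) = h x * h y"
  shows "h (prod_list xs) = prod_list (map h xs)"
  by (induction xs) (simp_all add: assms)

lemma ordered_prod_hom: "algebra_hom h \<Longrightarrow> h (ordered_prod f) = ordered_prod (\<lambda>k. h (f k))"
  by (simp add: ordered_prod_def prod_list_hom[of h] algebra_homD o_def)

lemma ordered_prod_cong: "(\<And>k. f k = g k) \<Longrightarrow> ordered_prod f = ordered_prod g"
  by (rule arg_cong[of f g], rule ext)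

lemma ordered_prod_const: "ordered_prod (\<lambda>k :: 'n::{finite,linorder}. x) = x ^ CARD('n)"
proof -
  have "prod_list (map (\<lambda>k. x) xs) = x ^ length xs" for xs :: "'n list" by (induction xs) simp_all
  then show ?thesis by (simp add: ordered_prod_def)
qed

lemma ordered_prod_one: "ordered_prod (\<lambda>k. 1) = 1"
  by (simp add: ordered_prod_const)

lemma ordered_prod_intertwine:
  assumes "\<And>k. y * f k = g k * y"
  shows "y * ordered_prod f = ordered_prod g * y"
proof -
  have "y * prod_list (map f xs) = prod_list (map g xs) * y" for xs
  proof (induction xs)
    case (Cons x xs)
    then show ?case by simp (metis assms mult.assoc)
  qed simp
  then show ?thesis by (simp add: ordered_prod_def)
qed

text \<open>Commutation is asked for distinct indices only, because in the monodromy it is available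
  only there.\<close>

lemma ordered_prod_mult:
  fixes f g :: "'n::{finite,linorder} \<Rightarrow> 'a::monoid_mult"
  assumes "\<And>k l. k \<noteq> l \<Longrightarrow> g k * f l = f l * g k"
  shows "ordered_prod (\<lambda>k. f k * g k) = ordered_prod f * ordered_prod g"
proof -
  have comm: "y * prod_list (map f xs) = prod_list (map f xs) * y"
    if "\<And>x. x \<in> set xs \<Longrightarrow> y * f x = f x * y" for y xs
    using that
  proof (induction xs)
    case (Cons x xs)
    then have "y * prod_list (map f xs) = prod_list (map f xs) * y" "y * f x = f x * y" by simp_all
    then show ?case by simp (metis mult.assoc)
  qed simp
  have "prod_list (map (\<lambda>k. f k * g k) xs) = prod_list (map f xs) * prod_list (map g xs)"
    if "distinct xs" for xs
    using that
  proof (induction xs)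
    case (Cons x xs)
    have "g x * prod_list (map f xs) = prod_list (map f xs) * g x"
      using Cons.prems by (intro comm assms) auto
    with Cons show ?case
      by (simp add: mult.assoc) (simp flip: mult.assoc)
  qed simp
  then show ?thesis by (simp add: ordered_prod_def)
qed

text \<open>While \<open>y\<close> travels from right to left, the factors after the j-th one meet
  \<open>y\<close>, the j-th factor turns it into \<open>y'\<close>, and the remaining factors meet
  \<open>y'\<close>.\<close>

lemma ordered_prod_intertwine_single:
  fixes f :: "'n::{finite,linorder} \<Rightarrow> 'a::monoid_mult"
  assumes "\<And>k. k \<noteq> j \<Longrightarrow> f k * y = y * f k" "\<And>k. k \<noteq> j \<Longrightarrow> f k * y' = y' * f k"
    "f j * y = y' * f j"
  shows "ordered_prod f * y = y' * ordered_prod f"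
proof -
  \<comment> \<open>For a sublist, what comes out on the left depends on whether the j-th factor has
    already been passed.\<close>
  have "prod_list (map f xs) * y = (if j \<in> set xs then y' else y) * prod_list (map f xs)"
    if "distinct xs" for xs
    using that
  proof (induction xs)
    case (Cons x xs)
    show ?case
    proof (cases "x = j")
      case True
      then have "prod_list (map f xs) * y = y * prod_list (map f xs)"
        using Cons by simp
      then show ?thesis using True assms(3) by (simp add: mult.assoc) (simp flip: mult.assoc)
    next
      case False
      then show ?thesis using Cons assms(1,2)[OF False]
        by (simp add: mult.assoc) (simp flip: mult.assoc)
    qed
  qed simp
  then show ?thesis by (simp add: ordered_prod_def)
qed

text \<open>The factors commute, so the reversal of their order by \<open>h\<close> can be
  undone.\<close>

lemma ordered_prod_antihom:
  fixes f :: "'n::{finite,linorder} \<Rightarrow> 'a::complex_algebra_1"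
  assumes "algebra_antihom h" "\<And>k l. f k * f l = f l * f k"
  shows "h (ordered_prod f) = ordered_prod (\<lambda>k. h (f k))"
proof -
  have h: "h 1 = 1" "\<And>x y. h (x * y) = h y * h x"
    using assms(1) by (simp_all add: algebra_antihom_def)
  have comm: "h (f k) * h (prod_list (map f xs)) = h (prod_list (map f xs)) * h (f k)" for k xs
  proof -
    have "f k * prod_list (map f xs) = prod_list (map f xs) * f k"
    proof (induction xs)
      case (Cons x xs)
      then show ?case by simp (metis assms(2) mult.assoc)
    qed simp
    then show ?thesis by (metis h(2))
  qed
  have "h (prod_list (map f xs)) = prod_list (map (\<lambda>k. h (f k)) xs)" for xs
  proof (induction xs)
    case (Cons x xs)
    then show ?case using comm[of x xs] by (simp add: h)
  qed (simp add: h)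
  then show ?thesis by (simp add: ordered_prod_def)
qed

section \<open>The structure maps on characters\<close>

text \<open>The group law on characters dual to the coproduct of K: cyclic of order 4 for odd N, the
  Klein four-group for even N. The map \<open>cinv\<close> is its inversion, dual to the
  antipode.\<close>

definition cmul :: "nat \<Rightarrow> complex \<Rightarrow> complex \<Rightarrow> complex" where
  "cmul N x y = (if odd_char x \<and> odd_char y then - ((- 1) ^ N) * (x * y) else x * y)"

definition cinv :: "nat \<Rightarrow> complex \<Rightarrow> complex" where
  "cinv N x = (if odd_char x then (- 1) ^ N * x else x)"

text \<open>
  \<open>psi\<close> is the third tensor factor of \<open>\<Phi>\<^sup>\<plusminus>\<^sup>1\<close> on \<open>e\<^sub>1 \<otimes> e\<^sub>1\<close>, with \<open>b = \<beta>\<^sup>2\<close>.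
\<close>

definition psi :: "nat \<Rightarrow> complex \<Rightarrow> sign \<Rightarrow> complex \<Rightarrow> complex" where
  "psi N b s z = (if odd_char z then b * (sgn_of s * \<i> * z) ^ N else z ^ N)"

text \<open>A normalised 3-cochain on the group of characters: \<open>psi\<close> of the last
  argument, raised to the product of the parities of the first two. The pentagon is its cocycle
  identity.\<close>

definition phi :: "nat \<Rightarrow> complex \<Rightarrow> sign \<Rightarrow> complex \<Rightarrow> complex \<Rightarrow> complex \<Rightarrow> complex" where
  "phi N b s x y z = (if odd_char x \<and> odd_char y then psi N b s z else 1)"

text \<open>On odd characters this is \<open>psi N b Pos\<close>, chosen to cancel the value of the
  associator in the antipode axioms.\<close>

definition beta :: "nat \<Rightarrow> complex \<Rightarrow> complex \<Rightarrow> complex" where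
  "beta N b z = (if odd_char z then b * (\<i> * z) ^ N else 1)"

lemma odd_char_uminus [simp]: "odd_char (- z) = odd_char z"
  unfolding odd_char_def by (metis minus_minus)

lemma odd_char_sign [simp]: "odd_char ((- 1) ^ n * z) = odd_char z"
  by (cases "even n") simp_all

lemma odd_char_simps [simp]: "\<not> odd_char 1" "odd_char \<i>"
  by (simp_all add: odd_char_def C4_distinct)

lemma C4E:
  assumes "z \<in> C4"
  obtains "z = 1" | "z = - 1" | "z = \<i>" | "z = - \<i>"
  using assms by (auto simp: C4_def)

lemma C4_mem [simp]: "1 \<in> C4" "- 1 \<in> C4" "\<i> \<in> C4" "- \<i> \<in> C4"
  by (simp_all add: C4_def)

lemmas char_defs = cmul_def cinv_def psi_def beta_def omega_char_def

lemma cmul_C4: "x \<in> C4 \<Longrightarrow> y \<in> C4 \<Longrightarrow> cmul N x y \<in> C4"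
  by (cases "even N"; elim C4E) (simp_all add: char_defs)

lemma cinv_C4: "x \<in> C4 \<Longrightarrow> cinv N x \<in> C4"
  by (cases "even N"; elim C4E) (simp_all add: char_defs)

lemma odd_char_cmul [simp]:
  "x \<in> C4 \<Longrightarrow> y \<in> C4 \<Longrightarrow> odd_char (cmul N x y) \<longleftrightarrow> odd_char x \<noteq> odd_char y"
  by (cases "even N"; elim C4E) (simp_all add: char_defs)

lemma odd_char_cinv [simp]: "odd_char (cinv N x) = odd_char x"
  by (cases "even N") (simp_all add: cinv_def)

lemma cmul_assoc:
  assumes "x \<in> C4" "y \<in> C4" "z \<in> C4"
  shows "cmul N (cmul N x y) z = cmul N x (cmul N y z)"
proof -
  have "odd_char (x * y) = (odd_char x \<noteq> odd_char y)" if "x \<in> C4" "y \<in> C4" for x y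
    using that by (elim C4E) simp_all
  with assms show ?thesis by (cases "even N") (auto simp: cmul_def)
qed

lemma cmul_uminus: "cmul N (- x) y = - cmul N x y" "cmul N x (- y) = - cmul N x y"
  by (simp_all add: cmul_def)

lemma cmul_commute: "cmul N x y = cmul N y x"
  by (simp add: cmul_def mult.commute)

text \<open>The base of the power, z for even and \<plusminus>iz for odd characters, is 1 or -1, so
  only the parity of N matters. This lemma and the next one record the two cases.\<close>

lemma psi_even: "even N \<Longrightarrow> z \<in> C4 \<Longrightarrow> psi N b s z = (if odd_char z then b else 1)"
  by (cases s; elim C4E) (simp_all add: psi_def)

lemma psi_odd:
  "odd N \<Longrightarrow> z \<in> C4 \<Longrightarrow> psi N b s z = (if odd_char z then b * (sgn_of s * \<i> * z) else z)"
  by (cases s; elim C4E) (simp_all add: psi_def)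

lemma odd_char_square: "odd_char z \<Longrightarrow> z * z = - 1" "z \<in> C4 \<Longrightarrow> \<not> odd_char z \<Longrightarrow> z * z = 1"
  by (auto simp: odd_char_def C4_def)

lemma psi_inverse:
  assumes "b * b = (- 1) ^ N" "z \<in> C4"
  shows "psi N b Pos z * psi N b Neg z = 1"
proof (cases "even N")
  case True
  then show ?thesis using assms by (simp add: psi_even)
next
  case False
  have "b * (\<i> * z) * (b * (\<i> * z)) = - (b * b * (z * z))"
    by (simp add: algebra_simps)
  also have "\<dots> = - 1" if "odd_char z"
    using False assms(1) odd_char_square(1)[OF that] by simp
  finally show ?thesis
    using False assms(2) odd_char_square(2)[of z] by (auto simp: psi_odd)
qed

lemma psi_uminus: "psi N b s (- z) = (- 1) ^ N * psi N b s z"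
  by (cases "even N") (simp_all add: psi_def)

text \<open>The delicate case is that of two odd arguments: there b^2 and the product of the two
  factors i^N are both (-1)^N and cancel.\<close>

lemma psi_cmul:
  assumes b: "b * b = (- 1) ^ N" and y: "y \<in> C4" and z: "z \<in> C4"
  shows "psi N b Pos (cmul N y z) = psi N b Pos y * psi N b Pos z"
proof (cases "even N")
  case True
  then show ?thesis using assms by (simp add: psi_even cmul_C4)
next
  case False
  have "b * (\<i> * y) * (b * (\<i> * z)) = - (b * b * (y * z))"
    by (simp add: algebra_simps)
  also have "\<dots> = y * z" using False b by simp
  finally show ?thesis
    using False y z odd_char_cmul[OF y z, of N] cmul_C4[OF y z, of N]
        by (auto simp: psi_odd cmul_def)
qed

lemma phi_inverse:
  "b * b = (- 1) ^ N \<Longrightarrow> z \<in> C4 \<Longrightarrow> phi N b Pos x y z * phi N b Neg x y z = 1"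
  by (simp add: phi_def psi_inverse)

lemma phi_minus: "phi N b s (- x) y z = phi N b s x y z" "phi N b s x (- y) z = phi N b s x y z"
  by (simp_all add: phi_def)

lemma phi_uminus3: "phi N b s x y (- z) = (if odd_char x \<and> odd_char y then (- 1) ^ N else 1) *
    phi N b s x y z"
  by (simp add: phi_def psi_uminus)

lemma omega_char_cmul:
  assumes "x \<in> C4" "y \<in> C4"
  shows "omega_char s (cmul N x y) = (if odd_char x \<and> odd_char y then (- 1) ^ N else 1) *
      (omega_char s x * omega_char s y)"
proof -
  have "odd_char (cmul N x y) \<longleftrightarrow> odd_char x \<noteq> odd_char y" using assms by simp
  moreover have "\<i> * x * (\<i> * y) = - (x * y)" by (simp add: algebra_simps)
  ultimately show ?thesis by (cases s) (auto simp: omega_char_def cmul_def)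
qed

text \<open>Quasi-coassociativity on a generator in the third leg: the sign by which omega_s fails
  to be grouplike is the sign that \<open>phi\<close> acquires when its third argument is
  negated.\<close>

lemma omega_char_cmul_phi:
  assumes "x \<in> C4" "y \<in> C4"
  shows "omega_char s (cmul N x y) * phi N b s' x y (- z) =
      phi N b s' x y z * (omega_char s x * omega_char s y)"
  using assms by (cases "even N") (simp_all add: omega_char_cmul phi_def psi_uminus)

text \<open>Once \<open>psi\<close> is multiplicative, both sides contain psi(y) with exponent
  [u][x], where [.] is the parity as 0 or 1. The exponents of psi(z) agree as integers: [ux][y] +
  [u][x] = [u][xy] + [x][y].\<close>

lemma phi_pentagon:
  assumes "b * b = (- 1) ^ N" "u \<in> C4" "x \<in> C4" "y \<in> C4" "z \<in> C4"
  shows "phi N b Pos (cmul N u x) y z * phi N b Pos u x (cmul N y z) =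
    phi N b Pos u x y * phi N b Pos u (cmul N x y) z * phi N b Pos x y z"
  using assms by (auto simp: phi_def psi_cmul)

text \<open>For odd z, inversion turns \<open>psi N b Pos\<close> into \<open>psi N b Neg\<close>.
  In both identities the associator therefore contributes \<open>psi N b Neg z\<close>, which is
  inverse to \<open>beta N b z\<close>.\<close>

lemma phi_beta:
  assumes "b * b = (- 1) ^ N" "z \<in> C4"
  shows "phi N b Pos (cinv N z) z (cinv N z) * beta N b z = 1"
    "phi N b Neg z (cinv N z) z * beta N b z = 1"
proof -
  have beta: "beta N b z = (if odd_char z then psi N b Pos z else 1)"
    by (simp add: beta_def psi_def)
  have "psi N b Pos (cinv N z) = psi N b Neg z" if "odd_char z"
    using that assms(2) by (cases "even N") (simp_all add: psi_even psi_odd cinv_def C4_uminus)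
  then show "phi N b Pos (cinv N z) z (cinv N z) * beta N b z = 1"
    "phi N b Neg z (cinv N z) z * beta N b z = 1"
    using psi_inverse[OF assms] by (simp_all add: phi_def beta mult.commute)
qed

section \<open>The structure maps on the functional calculus\<close>

lemma D1_one: "D1 (\<lambda>z. 1) = 1" by (rule C1.diag_one)

lemma cmul_image: "(\<lambda>(x, y). cmul N x y) ` (C4 \<times> C4) \<subseteq> C4"
  by (auto simp: cmul_C4)

lemma Q_comult_qK: "Q_comult (qK :: 'n Q) = D2 (\<lambda>(x, y). cmul CARD('n) x y)"
  unfolding Q_comult_values
  unfolding qK_D1 qe1_D1 D1_tensor C2.diag_mult diag_scaleC diag_diff
  by (rule diag_cong) (auto simp: cmul_def algebra_simps)

lemma pulls_comult:
  "pulls (Q_comult :: 'n Q \<Rightarrow> _) C4 qp (C4 \<times> C4) (qp \<boxtimes> qp) (\<lambda>(x, y). cmul CARD('n) x y)"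
  by (rule pulls_qK)
    (simp_all add: algebra_homD[OF algebra_hom_Q_comult] algebra_hom_power[OF algebra_hom_Q_comult]
      Q_comult_qK C2.idempotent_system_axioms cmul_image)

lemma Q_comult_D1: "Q_comult (D1 F :: 'n Q) = D2 (\<lambda>(x, y). F (cmul CARD('n) x y))"
  unfolding pulls_diag[OF pulls_comult] by (rule diag_cong) auto

lemma Q_antipode_qK: "Q_antipode (qK :: 'n Q) = D1 (cinv CARD('n))"
  unfolding Q_antipode_values
  unfolding qK_D1 qe1_D1 qe0_D1 diag_scaleC diag_add C1.diag_mult
  by (rule diag_cong) (auto simp: cinv_def)

lemma pulls_antipode: "pulls (Q_antipode :: 'n Q \<Rightarrow> _) C4 qp C4 qp (cinv CARD('n))"
  by (rule pulls_qK)
    (auto simp: algebra_antihomD[OF algebra_antihom_Q_antipode] cinv_C4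
      algebra_antihom_power[OF algebra_antihom_Q_antipode]
          Q_antipode_qK C1.idempotent_system_axioms)

lemma Q_antipode_D1: "Q_antipode (D1 F :: 'n Q) = D1 (\<lambda>z. F (cinv CARD('n) z))"
  by (rule pulls_diag[OF pulls_antipode])

text \<open>The complex numbers are the functions on one point, and the counit is the pullback along
  the inclusion of the trivial character.\<close>

lemma Q_counit_D1: "Q_counit (D1 F) = F 1"
proof -
  have "idempotent_system {()} (\<lambda>_. 1 :: complex)" by unfold_locales simp_all
  then have "pulls Q_counit C4 qp {()} (\<lambda>_. 1) (\<lambda>_. 1)"
    by (intro pulls_qK)
      (simp_all add: algebra_homD[OF algebra_hom_Q_counit]
        algebra_hom_power[OF algebra_hom_Q_counit]
        Q_counit_values diag_def)
  from pulls_diag[OF this, of F] show ?thesis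
    by (simp add: diag_def scaleC_complex_def)
qed

lemma tensor_map_comult_D2: "tensor_map Q_comult id (D2 F :: 'n Q \<otimes> 'n Q) =
    D3 (\<lambda>((x, y), z). F (cmul CARD('n) x y, z))"
  unfolding pulls_diag[OF pulls_tensor_map[OF pulls_comult pulls_id[OF finite_C4]]]
  by (rule diag_cong) auto

lemma tensor_map_comult_D2':
  "tensor_assoc (tensor_map id Q_comult (D2 F :: 'n Q \<otimes> 'n Q)) =
      D3 (\<lambda>((x, y), z). F (x, cmul CARD('n) y z))"
  unfolding pulls_diag[OF pulls_tensor_map[OF pulls_id[OF finite_C4] pulls_comult]]
      diag_tensor_assoc
  by (rule diag_cong) auto

section \<open>Reduction to generators, and the counit\<close>

lemma Q_induct [case_names K F scal add mult]:
  assumes "P qK" "\<And>s i. P (qf s i)" "\<And>c. P (c *\<^sub>C 1)" "\<And>x y. P x \<Longrightarrow> P y \<Longrightarrow> P (x + y)"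
    "\<And>x y. P x \<Longrightarrow> P y \<Longrightarrow> P (x * y)"
  shows "P (x :: 'n Q)"
proof (induction x rule: Q.abs_induct)
  fix t :: "'n gen alg_term"
  show "P (abs_Q t)"
  proof (induction t)
    case (Gen g)
    then show ?case using assms(1,2) by (cases g) (simp_all add: qK.abs_eq qf.abs_eq)
  next
    case (Scal c)
    \<comment> \<open>A scalar term is recognised as a multiple of the unit by writing c as c *
      1.\<close>
    have "alg_cong Q_rel (Scal c) (Scal c \<odot> Scal 1)"
      using alg_cong.scal_mult[of Q_rel c 1] by simp
    then have "abs_Q (Scal c :: 'n gen alg_term) = c *\<^sub>C 1"
      by (simp add: one_Q_def scaleC_Q.abs_eq Q.abs_eq_iff)
    then show ?case using assms(3) by simp
  qed (simp_all add: assms flip: plus_Q.abs_eq times_Q.abs_eq)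
qed

lemma algebra_hom_eqI:
  assumes "algebra_hom g" "algebra_hom h" "g qK = h qK" "\<And>s i. g (qf s i) = h (qf s i)"
  shows "g x = h (x :: 'n Q)"
  by (induction x rule: Q_induct)
    (simp_all add: assms(3,4) algebra_homD[OF assms(1)] algebra_homD[OF assms(2)]
      clinear_rules[OF algebra_homD(1)[OF assms(1)]] clinear_rules[OF algebra_homD(1)[OF assms(2)]])

lemma
  fixes e :: "'a::complex_algebra_1 \<Rightarrow> complex"
  assumes "algebra_hom e"
  shows algebra_hom_counit_left: "algebra_hom (tensor_lift (\<lambda>a b. e a *\<^sub>C
      (b :: 'b::complex_algebra_1)))"
    and counit_left_pure: "tensor_lift (\<lambda>a b. e a *\<^sub>C (b :: 'b)) (x \<otimes> y) = e x *\<^sub>C y"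
    and algebra_hom_counit_right: "algebra_hom (tensor_lift (\<lambda>(b :: 'b) a. e a *\<^sub>C b))"
    and counit_right_pure: "tensor_lift (\<lambda>(b :: 'b) a. e a *\<^sub>C b) (y \<otimes> x) = e x *\<^sub>C y"
proof -
  note e = algebra_homD[OF assms]
  have lin: "clinear (\<lambda>b. c *\<^sub>C (b :: 'b))" for c
    by (simp add: clinear_iff scaleC_add_right mult.commute)
  have "e (x + y) = e x + e y" "e (c *\<^sub>C x) = c * e x" for x y c
    by (simp_all add: clinear_add[OF e(1)] clinear_scaleC[OF e(1)] scaleC_complex_def)
  then have lin': "clinear (\<lambda>a. e a *\<^sub>C (b :: 'b))" for b
    by (simp add: clinear_iff scaleC_add_left)
  have bil: "cbilinear (\<lambda>a b. e a *\<^sub>C (b :: 'b))" "cbilinear (\<lambda>(b :: 'b) a. e a *\<^sub>C b)"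
    by (intro cbilinearI lin lin')+
  note p = tensor_lift_pure[OF bil(1)] tensor_lift_pure[OF bil(2)]
  show "tensor_lift (\<lambda>a b. e a *\<^sub>C (b :: 'b)) (x \<otimes> y) = e x *\<^sub>C y"
    "tensor_lift (\<lambda>(b :: 'b) a. e a *\<^sub>C b) (y \<otimes> x) = e x *\<^sub>C y" by (rule p)+
  show "algebra_hom (tensor_lift (\<lambda>a b. e a *\<^sub>C (b :: 'b)))"
      "algebra_hom (tensor_lift (\<lambda>(b :: 'b) a. e a *\<^sub>C b))"
    by (intro algebra_hom_tensorI clinear_tensor_lift bil; simp add: p e mult.commute)+
qed

lemma Q_counit_left: "tensor_lift (\<lambda>a b. Q_counit a *\<^sub>C b) (Q_comult x) = (x :: 'n Q)"
proof (rule algebra_hom_eqI[of _ "\<lambda>x. x"])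
  let ?h = "tensor_lift (\<lambda>a b. Q_counit a *\<^sub>C b) :: 'n Q \<otimes> 'n Q \<Rightarrow> _"
  note c = counit_left_pure[OF algebra_hom_Q_counit]
    clinear_rules[OF algebra_homD(1)[OF algebra_hom_counit_left[OF algebra_hom_Q_counit]]]
  show "algebra_hom (\<lambda>x. ?h (Q_comult x))"
    by (rule algebra_hom_compose[OF algebra_hom_counit_left[OF algebra_hom_Q_counit]
        algebra_hom_Q_comult])
  show "?h (Q_comult qK) = qK"
    by (simp add: Q_comult_values c tensor_mult_pure Q_counit_values algebra_homD[OF
        algebra_hom_Q_counit])
      (simp add: qe1_D1 Q_counit_D1)
  show "?h (Q_comult (qf s i)) = qf s i" for s i
    by (simp add: Q_comult_values c Q_counit_values) (simp add: q\<omega>_D1 Q_counit_D1 omega_char_def)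
qed (use algebra_hom_id in \<open>simp add: id_def\<close>)

lemma Q_counit_right: "tensor_lift (\<lambda>a b. Q_counit b *\<^sub>C a) (Q_comult x) = (x :: 'n Q)"
proof (rule algebra_hom_eqI[of _ "\<lambda>x. x"])
  let ?h = "tensor_lift (\<lambda>a b. Q_counit b *\<^sub>C a) :: 'n Q \<otimes> 'n Q \<Rightarrow> _"
  note c = counit_right_pure[OF algebra_hom_Q_counit]
    clinear_rules[OF algebra_homD(1)[OF algebra_hom_counit_right[OF algebra_hom_Q_counit]]]
  show "algebra_hom (\<lambda>x. ?h (Q_comult x))"
    by (rule algebra_hom_compose[OF algebra_hom_counit_right[OF algebra_hom_Q_counit]
        algebra_hom_Q_comult])
  show "?h (Q_comult qK) = qK"
    by (simp add: Q_comult_values c tensor_mult_pure Q_counit_values algebra_homD[OF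
        algebra_hom_Q_counit])
      (simp add: qe1_D1 Q_counit_D1)
  show "?h (Q_comult (qf s i)) = qf s i" for s i
    by (simp add: Q_comult_values c Q_counit_values algebra_homD[OF algebra_hom_Q_counit])
qed (use algebra_hom_id in \<open>simp add: id_def\<close>)

section \<open>The quasi-Hopf axioms\<close>

lemma one_D1: "(1 :: 'n Q) = D1 (\<lambda>z. 1)"
  by (simp add: C1.diag_one)

lemma Q_assoc_D3: "(Q_assoc \<beta> s :: 'n Q \<otimes> 'n Q \<otimes> 'n Q) =
    D3 (\<lambda>((x, y), z). phi CARD('n) (\<beta>\<^sup>2) s x y z)"
  unfolding Q_assoc_def
  unfolding qe0_D1 qe1_D1 qK_D1 one_D1 diag_scaleC C1.diag_power C1.diag_mult diag_diff diag_add
    D1_tensor D2_tensor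
  by (rule diag_cong) (auto simp: phi_def psi_def mult.assoc)

lemma Q_assoc_inverse:
  assumes "\<beta> ^ 4 = (- 1) ^ CARD('n)"
  shows "Q_assoc \<beta> Pos * Q_assoc \<beta> Neg = (1 :: 'n Q \<otimes> 'n Q \<otimes> 'n Q)"
    "Q_assoc \<beta> Neg * Q_assoc \<beta> Pos = (1 :: 'n Q \<otimes> 'n Q \<otimes> 'n Q)"
proof -
  have b: "\<beta>\<^sup>2 * \<beta>\<^sup>2 = (- 1) ^ CARD('n)" using assms by (simp flip: power_add)
  show "Q_assoc \<beta> Pos * Q_assoc \<beta> Neg = (1 :: 'n Q \<otimes> 'n Q \<otimes> 'n Q)"
    unfolding Q_assoc_D3 C3.diag_mult C3.diag_one[symmetric]
    by (rule diag_cong) (auto simp: phi_inverse[OF b])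
  then show "Q_assoc \<beta> Neg * Q_assoc \<beta> Pos = (1 :: 'n Q \<otimes> 'n Q \<otimes> 'n Q)"
    unfolding Q_assoc_D3 by (simp only: C3.diag_commute)
qed

lemma Q_pentagon:
  assumes "\<beta> ^ 4 = (- 1) ^ CARD('n)"
  defines "\<Phi> \<equiv> Q_assoc \<beta> Pos :: 'n Q \<otimes> 'n Q \<otimes> 'n Q"
  shows "tensor_map (tensor_map Q_comult id) id \<Phi> * tensor_assoc (tensor_map id Q_comult \<Phi>) =
    (\<Phi> \<otimes> 1) * tensor_map tensor_assoc id (tensor_map (tensor_map id Q_comult) id \<Phi>)
      * tensor_map tensor_assoc id (tensor_assoc (1 \<otimes> \<Phi>))"
proof -
  have b: "\<beta>\<^sup>2 * \<beta>\<^sup>2 = (- 1) ^ CARD('n)" using assms by (simp flip: power_add)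
  note id1 = pulls_id[OF finite_C4, where P = "qp :: complex \<Rightarrow> 'n Q"]
  note id2 = pulls_id[OF finite_cartesian_product[OF finite_C4 finite_C4],
      where P = "qp \<boxtimes> qp :: _ \<Rightarrow> 'n Q \<otimes> 'n Q"]
  note \<Delta> = pulls_comult[where 'n = 'n]
  note assoc = pulls_tensor_map[OF pulls_tensor_assoc[OF finite_C4 finite_C4 finite_C4] id1]
  \<comment> \<open>Each leg of the pentagon substitutes into the function of \<Phi>: a coproduct
    inserts \<open>cmul\<close>, a unit drops an argument. What remains is
    \<open>phi_pentagon\<close>.\<close>
  have 1: "tensor_map (tensor_map Q_comult id) id (D3 F :: 'n Q \<otimes> 'n Q \<otimes> 'n Q) =
      D4 (\<lambda>(((u, x), y), z). F ((cmul CARD('n) u x, y), z))" for F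
    unfolding pulls_diag[OF pulls_tensor_map[OF pulls_tensor_map[OF \<Delta> id1] id1]]
    by (rule diag_cong) auto
  have 2: "tensor_assoc (tensor_map id Q_comult (D3 F :: 'n Q \<otimes> 'n Q \<otimes> 'n Q)) =
      D4 (\<lambda>(((u, x), y), z). F ((u, x), cmul CARD('n) y z))" for F
    unfolding pulls_diag[OF pulls_tensor_map[OF id2 \<Delta>]] diag_tensor_assoc
    by (rule diag_cong) auto
  have 3: "tensor_map tensor_assoc id (tensor_map (tensor_map id Q_comult) id (D3 F :: 'n Q \<otimes> 'n Q
      \<otimes> 'n Q)) =
      D4 (\<lambda>(((u, x), y), z). F ((u, cmul CARD('n) x y), z))" for F
    unfolding pulls_diag[OF pulls_tensor_map[OF pulls_tensor_map[OF id1 \<Delta>] id1]]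
        pulls_diag[OF assoc]
    by (rule diag_cong) auto
  have 4: "tensor_map tensor_assoc id (tensor_assoc (1 \<otimes> (D3 F :: 'n Q \<otimes> 'n Q \<otimes> 'n Q))) =
      D4 (\<lambda>(((u, x), y), z). F ((x, y), z))" for F
    unfolding one_D1 diag_tensor diag_tensor_assoc pulls_diag[OF assoc]
    by (rule diag_cong) auto
  have 5: "(D3 F :: 'n Q \<otimes> 'n Q \<otimes> 'n Q) \<otimes> 1 = D4 (\<lambda>(((u, x), y), z). F ((u, x), y))" for F
    unfolding one_D1 diag_tensor by (rule diag_cong) auto
  show ?thesis
    unfolding \<Phi>_def Q_assoc_D3 1 2 3 4 5 C4.diag_mult
    by (rule diag_cong) (auto simp: phi_pentagon[OF b])
qed

lemma Q_counit_associator: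
  "tensor_map (tensor_lift (\<lambda>a b. Q_counit b *\<^sub>C a)) id (Q_assoc \<beta> Pos :: 'n Q \<otimes> 'n Q \<otimes> 'n Q) =
      1 \<otimes> 1"
proof -
  let ?h = "tensor_lift (\<lambda>a b. Q_counit b *\<^sub>C a) :: 'n Q \<otimes> 'n Q \<Rightarrow> _"
  note h = algebra_hom_tensor_map[OF algebra_hom_counit_right[OF algebra_hom_Q_counit, where ?'b =
      "'n Q"] algebra_hom_id]
  have "?h (qe1 \<otimes> qe1) = 0"
    unfolding counit_right_pure[OF algebra_hom_Q_counit] by (simp add: qe1_D1 Q_counit_D1)
  moreover have "?h (1 \<otimes> 1) = 1"
    unfolding counit_right_pure[OF algebra_hom_Q_counit]
        by (simp add: algebra_homD[OF algebra_hom_Q_counit])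
  ultimately show ?thesis
    unfolding Q_assoc_def
    by (simp add: clinear_rules[OF algebra_homD(1)[OF h]] tensor_map_pure
        algebra_homD(1)[OF algebra_hom_counit_right[OF algebra_hom_Q_counit]] clinear_id)
qed

section \<open>Generators against functions, and quasi-coassociativity\<close>

lemma qf_D1: "qf s i * D1 F = D1 (\<lambda>z. F (- z)) * qf s i"
  by (rule moves_diag[OF moves_qf])

lemma qf_D1': "qf s i * (D1 F * x) = D1 (\<lambda>z. F (- z)) * (qf s i * x)"
  by (simp add: qf_D1 flip: mult.assoc)

text \<open>Normal form for the computations below: the functions in all legs are collected into one
  function to the left of a pure tensor of generators.\<close>

lemma tensor_D2:
  fixes a b :: "'n Q"
  shows "(D1 F * a) \<otimes> b = D2 (\<lambda>(x, y). F x) * (a \<otimes> b)"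
    and "a \<otimes> (D1 G * b) = D2 (\<lambda>(x, y). G y) * (a \<otimes> b)"
    and "D1 F \<otimes> b = D2 (\<lambda>(x, y). F x) * (1 \<otimes> b)"
    and "a \<otimes> D1 G = D2 (\<lambda>(x, y). G y) * (a \<otimes> 1)"
proof -
  have l: "D1 F \<otimes> 1 = (D2 (\<lambda>(x, y). F x) :: 'n Q \<otimes> 'n Q)"
    and r: "1 \<otimes> D1 G = (D2 (\<lambda>(x, y). G y) :: 'n Q \<otimes> 'n Q)"
    unfolding one_D1 D1_tensor by simp_all
  show "(D1 F * a) \<otimes> b = D2 (\<lambda>(x, y). F x) * (a \<otimes> b)"
    "a \<otimes> (D1 G * b) = D2 (\<lambda>(x, y). G y) * (a \<otimes> b)"
    "D1 F \<otimes> b = D2 (\<lambda>(x, y). F x) * (1 \<otimes> b)"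
    "a \<otimes> D1 G = D2 (\<lambda>(x, y). G y) * (a \<otimes> 1)"
    unfolding l[symmetric] r[symmetric] by (simp_all add: tensor_mult_pure)
qed

lemma tensor_D3:
  fixes a :: "'n Q \<otimes> 'n Q" and b :: "'n Q"
  shows "(D2 F * a) \<otimes> b = D3 (\<lambda>((x, y), z). F (x, y)) * (a \<otimes> b)"
    and "a \<otimes> (D1 G * b) = D3 (\<lambda>((x, y), z). G z) * (a \<otimes> b)"
    and "D2 F \<otimes> b = D3 (\<lambda>((x, y), z). F (x, y)) * (1 \<otimes> b)"
    and "a \<otimes> D1 G = D3 (\<lambda>((x, y), z). G z) * (a \<otimes> 1)"
proof -
  have l: "D2 F \<otimes> 1 = (D3 (\<lambda>((x, y), z). F (x, y)) :: 'n Q \<otimes> 'n Q \<otimes> 'n Q)"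
    unfolding one_D1 D2_tensor by (rule diag_cong) auto
  have r: "1 \<otimes> D1 G = (D3 (\<lambda>((x, y), z). G z) :: 'n Q \<otimes> 'n Q \<otimes> 'n Q)"
    unfolding C2.diag_one[symmetric] D2_tensor by (rule diag_cong) auto
  show "(D2 F * a) \<otimes> b = D3 (\<lambda>((x, y), z). F (x, y)) * (a \<otimes> b)"
    "a \<otimes> (D1 G * b) = D3 (\<lambda>((x, y), z). G z) * (a \<otimes> b)"
    "D2 F \<otimes> b = D3 (\<lambda>((x, y), z). F (x, y)) * (1 \<otimes> b)"
    "a \<otimes> D1 G = D3 (\<lambda>((x, y), z). G z) * (a \<otimes> 1)"
    unfolding l[symmetric] r[symmetric] by (simp_all add: tensor_mult_pure)
qed

lemma Q_comult_qf: "Q_comult (qf s i :: 'n Q) = qf s i \<otimes> 1 + D2 (\<lambda>(x, y). omega_char s x) *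
    (1 \<otimes> qf s i)"
  by (simp add: Q_comult_values q\<omega>_D1 tensor_D2)

lemma Q_intertwine:
  assumes "algebra_hom g" "algebra_hom h" "g qK * y = y * h qK" "\<And>s i. g (qf s i) * y =
      y * h (qf s i)"
  shows "g (x :: 'n Q) * y = y * h x"
proof (induction x rule: Q_induct)
  case (mult a b)
  then show ?case
    by (simp add: algebra_homD[OF assms(1)] algebra_homD[OF assms(2)]) (metis mult.assoc)
qed (simp_all add: assms(3,4) algebra_homD[OF assms(1)] algebra_homD[OF assms(2)] ring_distribs
    clinear_rules[OF algebra_homD(1)[OF assms(1)]] clinear_rules[OF algebra_homD(1)[OF assms(2)]])

lemma Q_quasi_coassociative:
  "tensor_map Q_comult id (Q_comult x) * Q_assoc \<beta> Pos =
    Q_assoc \<beta> Pos * tensor_assoc (tensor_map id Q_comult (Q_comult (x :: 'n Q)))"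
proof (rule Q_intertwine[of "\<lambda>x. tensor_map Q_comult id (Q_comult x)"
    "\<lambda>x. tensor_assoc (tensor_map id Q_comult (Q_comult x))"])
  note \<Delta> = algebra_hom_Q_comult[where 'a = 'n]
  show "algebra_hom (\<lambda>x :: 'n Q. tensor_map Q_comult id (Q_comult x))"
    by (rule algebra_hom_compose[OF algebra_hom_tensor_map[OF \<Delta> algebra_hom_id] \<Delta>])
  show "algebra_hom (\<lambda>x :: 'n Q. tensor_assoc (tensor_map id Q_comult (Q_comult x)))"
    by (rule algebra_hom_compose[OF algebra_hom_tensor_assoc
          algebra_hom_compose[OF algebra_hom_tensor_map[OF algebra_hom_id \<Delta>] \<Delta>]])
  show "tensor_map Q_comult id (Q_comult qK) * Q_assoc \<beta> Pos =
      Q_assoc \<beta> Pos * tensor_assoc (tensor_map id Q_comult (Q_comult (qK :: 'n Q)))"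
    unfolding Q_comult_qK tensor_map_comult_D2 tensor_map_comult_D2' Q_assoc_D3 C3.diag_mult
    by (rule diag_cong) (auto simp: cmul_assoc)
next
  fix s and i :: 'n
  let ?f = "qf s i :: 'n Q"
  note lin = clinear_rules[OF clinear_tensor_map[OF algebra_homD(1)[OF algebra_hom_Q_comult]
      clinear_id(1)]]
    clinear_rules[OF clinear_tensor_map[OF clinear_id(1) algebra_homD(1)[OF algebra_hom_Q_comult]]]
    clinear_rules[OF clinear_tensor_assoc]
  note pure = tensor_map_pure algebra_homD(1,2)[OF algebra_hom_Q_comult] clinear_id(1)
    tensor_assoc_pure
  have 1: "tensor_map Q_comult id (Q_comult ?f) = ?f \<otimes> 1 \<otimes> 1
      + D3 (\<lambda>((x, y), z). omega_char s x) * (1 \<otimes> ?f \<otimes> 1)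
      + D3 (\<lambda>((x, y), z). omega_char s (cmul CARD('n) x y)) * (1 \<otimes> 1 \<otimes> ?f)"
    unfolding Q_comult_values(2)[of s i]
    by (simp add: lin pure) (simp add: Q_comult_values q\<omega>_D1 Q_comult_D1 tensor_add_left tensor_D2
        tensor_D3 one_tensor_def)
  have 2: "tensor_assoc (tensor_map id Q_comult (Q_comult ?f)) = ?f \<otimes> 1 \<otimes> 1
      + D3 (\<lambda>((x, y), z). omega_char s x) * (1 \<otimes> ?f \<otimes> 1)
      + D3 (\<lambda>((x, y), z). omega_char s x * omega_char s y) * (1 \<otimes> 1 \<otimes> ?f)"
  proof -
    have "q\<omega> s \<otimes> q\<omega> s \<otimes> ?f = D3 (\<lambda>((x, y), z). omega_char s x * omega_char s y) * (1 \<otimes> 1 \<otimes> ?f)"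
      unfolding q\<omega>_D1 D1_tensor tensor_D3
      unfolding one_tensor_def[symmetric]
      by (rule arg_cong[where f = "\<lambda>d. d * _"], rule diag_cong) auto
    then show ?thesis
      unfolding Q_comult_values(2)[of s i]
      by (simp add: lin pure one_tensor_def Q_comult_values(2)[of s i] tensor_add_right)
        (simp add: q\<omega>_D1 tensor_D2 tensor_D3)
  qed
  note one = moves_one[where I = C4 and P = "qp :: complex \<Rightarrow> 'n Q"]
  \<comment> \<open>In its first two arguments \<open>phi\<close> depends only on the parity, which
    K \<mapsto> -K preserves. Only a generator in the third leg changes the associator.\<close>
  have c: "(?f \<otimes> 1 \<otimes> 1) * Q_assoc \<beta> Pos = Q_assoc \<beta> Pos * (?f \<otimes> 1 \<otimes> 1)"
    "(1 \<otimes> ?f \<otimes> 1) * Q_assoc \<beta> Pos = Q_assoc \<beta> Pos * (1 \<otimes> ?f \<otimes> 1)"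
    "(1 \<otimes> 1 \<otimes> ?f) * Q_assoc \<beta> Pos =
      D3 (\<lambda>((x, y), z). phi CARD('n) (\<beta>\<^sup>2) Pos x y (- z)) * (1 \<otimes> 1 \<otimes> ?f)"
    unfolding Q_assoc_D3
      moves_diag[OF moves_tensor[OF moves_tensor[OF moves_qf one] one]]
      moves_diag[OF moves_tensor[OF moves_tensor[OF one moves_qf] one]]
      moves_diag[OF moves_tensor[OF moves_tensor[OF one one] moves_qf]]
    by (rule arg_cong[where f = "\<lambda>d. d * _"], rule diag_cong, auto simp: phi_minus)+
  have "D3 (\<lambda>((x, y), z). omega_char s (cmul CARD('n) x y)) * D3 (\<lambda>((x, y), z). phi CARD('n) (\<beta>\<^sup>2)
      Pos x y (- z)) =
      Q_assoc \<beta> Pos * (D3 (\<lambda>((x, y), z). omega_char s x * omega_char s y) :: 'n Q \<otimes> 'n Q \<otimes> 'n Q)"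
    unfolding Q_assoc_D3 C3.diag_mult by (rule diag_cong) (auto simp: omega_char_cmul_phi)
  moreover have "D3 (\<lambda>((x, y), z). omega_char s x) * Q_assoc \<beta> Pos =
      Q_assoc \<beta> Pos * (D3 (\<lambda>((x, y), z). omega_char s x) :: 'n Q \<otimes> 'n Q \<otimes> 'n Q)"
    unfolding Q_assoc_D3 by (rule C3.diag_commute)
  ultimately show "tensor_map Q_comult id (Q_comult ?f) * Q_assoc \<beta> Pos =
      Q_assoc \<beta> Pos * tensor_assoc (tensor_map id Q_comult (Q_comult ?f))"
    unfolding 1 2 by (simp add: ring_distribs mult.assoc c) (simp flip: mult.assoc)
qed

section \<open>The antipode axioms\<close>

lemma Q_antipode_simps:
  "Q_antipode (qf s i :: 'n Q) = qf s i * D1 (\<lambda>z. if odd_char z then sgn_of s * (- 1) ^ CARD('n) *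
      \<i> * z else z)"
  unfolding Q_antipode_values qe0_D1 qe1_D1 diag_scaleC diag_add mult.assoc
  unfolding qK_D1 C1.diag_mult
  by (rule arg_cong[where f = "\<lambda>d. _ * d"], rule diag_cong) auto

text \<open>As S reverses products, L(s (a (x) b)) = S(a) L(s) b. If L(s) is a multiple of \<alpha>,
  the scalar comes out and L(a (x) b) remains.\<close>

lemma antipode_left_mult:
  fixes S :: "'a::complex_algebra_1 \<Rightarrow> 'a" and \<alpha> :: 'a
  assumes "algebra_antihom S"
  defines "L \<equiv> tensor_lift (\<lambda>a b. S a * \<alpha> * b)"
  assumes "L s = c *\<^sub>C \<alpha>" "L t = d *\<^sub>C \<alpha>"
  shows "L (s * t) = (c * d) *\<^sub>C \<alpha>"
proof -
  note S = algebra_antihomD[OF assms(1)]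
  have bil: "cbilinear (\<lambda>a b. S a * \<alpha> * b)"
    by (intro cbilinearI clinear_mult clinear_compose[OF clinear_mult(2)] S(1))
  note L = clinear_tensor_lift[OF bil, folded L_def] tensor_lift_pure[OF bil, folded L_def]
  have 1: "L (s * (a \<otimes> b)) = S a * L s * b" for a b s
    by (rule tensor_ext[OF clinear_compose[OF L(1) clinear_mult(2)]
          clinear_compose[OF clinear_mult(2) clinear_compose[OF clinear_mult(1) L(1)]]])
      (simp add: L(2) tensor_mult_pure S mult.assoc)
  have "L (s * t) = c *\<^sub>C L t"
    by (rule tensor_ext[OF clinear_compose[OF L(1) clinear_mult(1)]
          clinear_compose[OF _ L(1)]])
      (simp_all add: 1 assms(3) L(2) clinear_iff scaleC_add_right mult.commute)
  then show ?thesis by (simp add: assms(4))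
qed

text \<open>The mirror image: L((a (x) b) t) = a L(t) S(b), so here the value at the second factor
  is the inner one.\<close>

lemma antipode_right_mult:
  fixes S :: "'a::complex_algebra_1 \<Rightarrow> 'a" and \<beta> :: 'a
  assumes "algebra_antihom S"
  defines "L \<equiv> tensor_lift (\<lambda>a b. a * \<beta> * S b)"
  assumes "L s = c *\<^sub>C \<beta>" "L t = d *\<^sub>C \<beta>"
  shows "L (s * t) = (c * d) *\<^sub>C \<beta>"
proof -
  note S = algebra_antihomD[OF assms(1)]
  have bil: "cbilinear (\<lambda>a b. a * \<beta> * S b)"
    by (intro cbilinearI clinear_compose[OF clinear_mult(1) S(1)]
        clinear_compose[OF clinear_mult(2) clinear_mult(2)])
  note L = clinear_tensor_lift[OF bil, folded L_def] tensor_lift_pure[OF bil, folded L_def]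
  have 1: "L ((a \<otimes> b) * t) = a * L t * S b" for a b t
    by (rule tensor_ext[OF clinear_compose[OF L(1) clinear_mult(1)]
          clinear_compose[OF clinear_mult(2) clinear_compose[OF clinear_mult(1) L(1)]]])
      (simp add: L(2) tensor_mult_pure S mult.assoc)
  have "L (s * t) = d *\<^sub>C L s"
    by (rule tensor_ext[OF clinear_compose[OF L(1) clinear_mult(2)]
          clinear_compose[OF _ L(1)]])
      (simp_all add: 1 assms(4) L(2) clinear_iff scaleC_add_right mult.commute)
  then show ?thesis by (simp add: assms(3) mult.commute)
qed

lemma
  fixes S :: "'a::complex_algebra_1 \<Rightarrow> 'a" and \<alpha> \<beta> :: 'a
  assumes "clinear S"
  shows cbilinear_antipode_left: "cbilinear (\<lambda>a b. S a * \<alpha> * b)"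
    and cbilinear_antipode_right: "cbilinear (\<lambda>a b. a * \<beta> * S b)"
  by (intro cbilinearI clinear_mult clinear_compose[OF clinear_mult(2)]
      clinear_compose[OF clinear_mult(1)] assms)+

lemma cmul_cinv:
  assumes "z \<in> C4"
  shows "cmul N (cinv N z) z = 1" "cmul N z (cinv N z) = 1"
  using odd_char_square[of z] assms by (cases "even N"; simp add: cmul_def cinv_def)+

lemma qp_D1: "x \<in> C4 \<Longrightarrow> qp x = D1 (\<lambda>z. if z = x then 1 else 0)"
  by (rule diag_pointwise[OF finite_C4])

lemma Q_antipode_qp: "x \<in> C4 \<Longrightarrow> Q_antipode (qp x :: 'n Q) = D1 (\<lambda>z. if cinv CARD('n) z =
    x then 1 else 0)"
  using pulls_antipode[where 'n = 'n] by (simp add: pulls_def)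

text \<open>Multiplication restricts a function of two characters to the diagonal and S inverts the
  first argument. On the coproduct of a function this leaves only the value at the trivial
  character, by \<open>cmul_cinv\<close>.\<close>

lemma pulls_antipode_left:
  "pulls (tensor_lift (\<lambda>a b. Q_antipode a * 1 * b)) (C4 \<times> C4) (qp \<boxtimes> qp) C4 (qp :: _ \<Rightarrow> 'n Q)
    (\<lambda>z. (cinv CARD('n) z, z))"
proof -
  note bil = cbilinear_antipode_left[OF algebra_antihomD(1)[OF algebra_antihom_Q_antipode[where 'a
      = 'n]], of 1]
  show ?thesis
    unfolding pulls_def
  proof (intro conjI clinear_tensor_lift bil ballI)
    show "tensor_lift (\<lambda>a b. Q_antipode a * 1 * b) ((qp \<boxtimes> qp) i) =
        (D1 (\<lambda>j. if (cinv CARD('n) j, j) = i then 1 else 0) :: 'n Q)" if mem: "i \<in> C4 \<times> C4" for i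
    proof -
      obtain x y where i: "i = (x, y)" "x \<in> C4" "y \<in> C4" using mem by auto
      have "tensor_lift (\<lambda>a b. Q_antipode a * 1 * b) ((qp \<boxtimes> qp) i) =
          Q_antipode (qp x) * 1 * (qp y :: 'n Q)"
        unfolding i(1) tensor_family_def case_prod_conv by (rule tensor_lift_pure[OF bil])
      also have "\<dots> = D1 (\<lambda>j. if (cinv CARD('n) j, j) = i then 1 else 0)"
        unfolding Q_antipode_qp[OF i(2)] qp_D1[OF i(3)] mult_1_right C1.diag_mult
        by (rule diag_cong) (auto simp: i)
      finally show ?thesis .
    qed
  qed (auto simp: finite_C4 cinv_C4)
qed

text \<open>The unqualified names \<open>distrib_left\<close> and \<open>distrib_right\<close> refer to rules of \<open>alg_cong\<close> here.\<close>

lemma Q_antipode_left: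
  "tensor_lift (\<lambda>a b. Q_antipode a * Q_alpha * b) (Q_comult x) = Q_counit x *\<^sub>C (Q_alpha :: 'n Q)"
  unfolding Q_alpha_def
proof (induction x rule: Q_induct)
  let ?L = "tensor_lift (\<lambda>a b. Q_antipode a * 1 * b) :: 'n Q \<otimes> 'n Q \<Rightarrow> 'n Q"
  note S = algebra_antihomD[OF algebra_antihom_Q_antipode[where 'a = 'n]]
  note bil = cbilinear_antipode_left[OF S(1), of 1]
  note L = clinear_rules[OF clinear_tensor_lift[OF bil]] tensor_lift_pure[OF bil]
  note \<Delta> = algebra_homD[OF algebra_hom_Q_comult[where 'a = 'n]]
  note \<epsilon> = algebra_homD[OF algebra_hom_Q_counit[where 'a = 'n]]
  {
    case K
    show ?case
      unfolding Q_comult_qK pulls_diag[OF pulls_antipode_left] Q_counit_values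
      by (simp add: one_D1) (rule diag_cong, simp add: cmul_cinv)
  next
    case (F s i)
    have "qf s i * D1 (\<lambda>z. if odd_char z then sgn_of s * (- 1) ^ CARD('n) * \<i> * z else z) +
        D1 (\<lambda>z. omega_char s (cinv CARD('n) z)) * qf s i = D1 (\<lambda>z. 0) * (qf s i :: 'n Q)"
      unfolding qf_D1 diag_add semiring_class.distrib_right[symmetric]
      by (rule arg_cong[where f = "\<lambda>d. d * _"], rule diag_cong) (auto simp: omega_char_def cinv_def)
    moreover have "?L (Q_comult (qf s i)) = Q_antipode (qf s i) * 1 * 1 + Q_antipode (q\<omega> s) * 1 *
        qf s i"
      unfolding Q_comult_values(2)[of s i] by (simp only: L)
    ultimately show ?case
      by (simp add: S Q_antipode_simps q\<omega>_D1 Q_antipode_D1 Q_counit_values diag_zero mult.assoc)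
  next
    case (scal c)
    have "?L (Q_comult (c *\<^sub>C 1)) = c *\<^sub>C (Q_antipode 1 * 1 * 1)"
      by (simp only: clinear_scaleC[OF \<Delta>(1)] \<Delta>(2) one_tensor_def L)
    then show ?case
      by (simp add: S clinear_scaleC[OF \<epsilon>(1)] \<epsilon>(2) scaleC_complex_def)
  next
    case (add x y)
    then show ?case
      by (simp only: clinear_add[OF \<Delta>(1)] clinear_add[OF \<epsilon>(1)] L scaleC_add_left)
  next
    case (mult x y)
    show ?case
      unfolding \<Delta>(3) \<epsilon>(3) by (rule antipode_left_mult[OF algebra_antihom_Q_antipode mult])
  }
qed

lemma Q_beta_D1: "(Q_beta \<beta> :: 'n Q) = D1 (beta CARD('n) (\<beta>\<^sup>2))"
  unfolding Q_beta_def
  unfolding qe0_D1 qe1_D1 qK_D1 diag_scaleC C1.diag_power C1.diag_mult diag_add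
  by (rule diag_cong) (auto simp: beta_def)

lemma pulls_antipode_right:
  "pulls (tensor_lift (\<lambda>a b. a * 1 * Q_antipode b)) (C4 \<times> C4) (qp \<boxtimes> qp) C4 (qp :: _ \<Rightarrow> 'n Q)
    (\<lambda>z. (z, cinv CARD('n) z))"
proof -
  note bil = cbilinear_antipode_right[OF algebra_antihomD(1)[OF algebra_antihom_Q_antipode[where
      'a = 'n]], of 1]
  show ?thesis
    unfolding pulls_def
  proof (intro conjI clinear_tensor_lift bil ballI)
    show "tensor_lift (\<lambda>a b. a * 1 * Q_antipode b) ((qp \<boxtimes> qp) i) =
        (D1 (\<lambda>j. if (j, cinv CARD('n) j) = i then 1 else 0) :: 'n Q)" if mem: "i \<in> C4 \<times> C4" for i
    proof -
      obtain x y where i: "i = (x, y)" "x \<in> C4" "y \<in> C4" using mem by auto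
      have "tensor_lift (\<lambda>a b. a * 1 * Q_antipode b) ((qp \<boxtimes> qp) i) =
          qp x * 1 * (Q_antipode (qp y) :: 'n Q)"
        unfolding i(1) tensor_family_def case_prod_conv by (rule tensor_lift_pure[OF bil])
      also have "\<dots> = D1 (\<lambda>j. if (j, cinv CARD('n) j) = i then 1 else 0)"
        unfolding Q_antipode_qp[OF i(3)] qp_D1[OF i(2)] mult_1_right C1.diag_mult
        by (rule diag_cong) (auto simp: i)
      finally show ?thesis .
    qed
  qed (auto simp: finite_C4 cinv_C4)
qed

lemma Q_antipode_right:
  "tensor_lift (\<lambda>a b. a * Q_beta \<beta> * Q_antipode b) (Q_comult x) = Q_counit x *\<^sub>C (Q_beta \<beta> :: 'n Q)"
proof (induction x rule: Q_induct)
  let ?B = "Q_beta \<beta> :: 'n Q"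
  let ?L = "tensor_lift (\<lambda>a b. a * ?B * Q_antipode b) :: 'n Q \<otimes> 'n Q \<Rightarrow> 'n Q"
  note S = algebra_antihomD[OF algebra_antihom_Q_antipode[where 'a = 'n]]
  note bil = cbilinear_antipode_right[OF S(1), of ?B]
  note bil1 = cbilinear_antipode_right[OF S(1), of 1]
  note L = clinear_rules[OF clinear_tensor_lift[OF bil]] tensor_lift_pure[OF bil]
  note \<Delta> = algebra_homD[OF algebra_hom_Q_comult[where 'a = 'n]]
  note \<epsilon> = algebra_homD[OF algebra_hom_Q_counit[where 'a = 'n]]
  {
    case K
    \<comment> \<open>Functions commute, so boldsymbol-beta can be taken out and the contraction
      without it is a plain pullback.\<close>
    have "?L (D2 F) = ?B * D1 (\<lambda>z. F (z, cinv CARD('n) z))" for F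
    proof (rule diag_weighted[OF clinear_tensor_lift[OF bil] pulls_antipode_right])
      fix i :: "complex \<times> complex" assume "i \<in> C4 \<times> C4"
      then obtain x y where i: "i = (x, y)" "x \<in> C4" "y \<in> C4" by auto
      have "qp x * ?B = ?B * qp x"
        unfolding qp_D1[OF i(2)] Q_beta_D1 by (rule C1.diag_commute)
      then have "qp x * ?B * Q_antipode (qp y) = ?B * (qp x * 1 * Q_antipode (qp y))"
        by (simp add: mult.assoc)
      then show "?L ((qp \<boxtimes> qp) i) = ?B * tensor_lift (\<lambda>a b. a * 1 * Q_antipode b) ((qp \<boxtimes> qp) i)"
        unfolding i(1) tensor_family_def case_prod_conv tensor_lift_pure[OF bil]
            tensor_lift_pure[OF bil1] .
    qed
    moreover have "D1 (\<lambda>z. cmul CARD('n) z (cinv CARD('n) z)) = (1 :: 'n Q)"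
      unfolding one_D1 by (rule diag_cong) (simp add: cmul_cinv)
    ultimately show ?case
      by (simp add: Q_comult_qK Q_counit_values)
  next
    case (F s i)
    have "qf s i * ?B + D1 (omega_char s) * ?B * (qf s i * D1 (\<lambda>z. if odd_char z then sgn_of s *
        (- 1) ^ CARD('n) * \<i> * z else z)) =
        D1 (\<lambda>z. 0) * (qf s i :: 'n Q)"
      unfolding Q_beta_D1 qf_D1 C1.diag_mult mult.assoc[symmetric]
      unfolding diag_add semiring_class.distrib_right[symmetric]
    proof (rule arg_cong[where f = "\<lambda>d. d * _"], rule diag_cong)
      fix z assume z: "z \<in> C4"
      \<comment> \<open>For odd z the two summands are opposite because \<open>beta\<close> acquires
        (-1)^N under z \<mapsto> -z, and the product of omega_s(z) with the Cartan factor of S(f) at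
        -z is -(-1)^N.\<close>
      show "beta CARD('n) (\<beta>\<^sup>2) (- z) + omega_char s z * beta CARD('n) (\<beta>\<^sup>2) z *
          (if odd_char (- z) then sgn_of s * (- 1) ^ CARD('n) * \<i> * - z else - z) = 0"
      proof (cases "odd_char z")
        case True
        then have sq: "z * (z * c) = - c" for c
          by (simp add: odd_char_square flip: mult.assoc)
        from True show ?thesis
          by (cases "even CARD('n)"; cases s) (simp_all add: beta_def omega_char_def algebra_simps
              sq)
      next
        case False
        with z show ?thesis by (simp add: beta_def omega_char_def odd_char_square)
      qed
    qed
    moreover have "?L (Q_comult (qf s i)) = qf s i * ?B * Q_antipode 1 + q\<omega> s * ?B *
        Q_antipode (qf s i)"
      unfolding Q_comult_values(2)[of s i] by (simp only: L)
    ultimately show ?case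
      by (simp add: S Q_antipode_simps q\<omega>_D1 Q_antipode_D1 Q_counit_values diag_zero mult.assoc)
  next
    case (scal c)
    have "?L (Q_comult (c *\<^sub>C 1)) = c *\<^sub>C (1 * ?B * Q_antipode 1)"
      by (simp only: clinear_scaleC[OF \<Delta>(1)] \<Delta>(2) one_tensor_def L)
    then show ?case
      by (simp add: S clinear_scaleC[OF \<epsilon>(1)] \<epsilon>(2) scaleC_complex_def)
  next
    case (add x y)
    then show ?case
      by (simp only: clinear_add[OF \<Delta>(1)] clinear_add[OF \<epsilon>(1)] L scaleC_add_left)
  next
    case (mult x y)
    show ?case
      unfolding \<Delta>(3) \<epsilon>(3) by (rule antipode_right_mult[OF algebra_antihom_Q_antipode mult])
  }
qed

lemma
  fixes S :: "'a::complex_algebra_1 \<Rightarrow> 'a" and \<alpha> \<beta> :: 'a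
  assumes S: "clinear S"
  shows clinear_antipode3: "clinear (tensor_lift (\<lambda>t c. tensor_lift (\<lambda>a b. S a * \<alpha> * b * \<beta> * S c)
      t))"
    and antipode3_pure: "tensor_lift (\<lambda>t c. tensor_lift (\<lambda>a b. S a * \<alpha> * b * \<beta> * S c) t)
        (x \<otimes> y \<otimes> z) =
      S x * \<alpha> * y * \<beta> * S z"
    and clinear_antipode3': "clinear (tensor_lift (\<lambda>t c. tensor_lift (\<lambda>a b. a * \<beta> * S b * \<alpha> *
        c) t))"
    and antipode3'_pure: "tensor_lift (\<lambda>t c. tensor_lift (\<lambda>a b. a * \<beta> * S b * \<alpha> * c) t)
        (x \<otimes> y \<otimes> z) =
      x * \<beta> * S y * \<alpha> * z"
proof -
  have r: "clinear f \<Longrightarrow> clinear (\<lambda>x. f x * d)" for f :: "'a \<Rightarrow> 'a" and d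
    by (rule clinear_compose[OF clinear_mult(2)])
  have l: "clinear f \<Longrightarrow> clinear (\<lambda>x. d * f x)" for f :: "'a \<Rightarrow> 'a" and d
    by (rule clinear_compose[OF clinear_mult(1)])
  show "clinear (tensor_lift (\<lambda>t c. tensor_lift (\<lambda>a b. S a * \<alpha> * b * \<beta> * S c) t))"
    "tensor_lift (\<lambda>t c. tensor_lift (\<lambda>a b. S a * \<alpha> * b * \<beta> * S c) t) (x \<otimes> y \<otimes> z) =
        S x * \<alpha> * y * \<beta> * S z"
    by (rule clinear_tensor_lift3 tensor_lift3_pure; intro r S clinear_mult(1) l[OF S])+
  show "clinear (tensor_lift (\<lambda>t c. tensor_lift (\<lambda>a b. a * \<beta> * S b * \<alpha> * c) t))"
    "tensor_lift (\<lambda>t c. tensor_lift (\<lambda>a b. a * \<beta> * S b * \<alpha> * c) t) (x \<otimes> y \<otimes> z) =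
        x * \<beta> * S y * \<alpha> * z"
    by (rule clinear_tensor_lift3 tensor_lift3_pure; intro r clinear_mult(1) clinear_id(2) l[OF S])+
qed

lemma
  fixes \<beta> :: complex
  assumes "\<beta> ^ 4 = (- 1) ^ CARD('n)"
  defines "B \<equiv> Q_beta \<beta> :: 'n Q"
  shows Q_antipode_associator: "tensor_lift (\<lambda>t c. tensor_lift (\<lambda>a b. Q_antipode a * Q_alpha * b *
      B * Q_antipode c) t)
      (Q_assoc \<beta> Pos) = 1"
    and Q_antipode_associator_inverse: "tensor_lift (\<lambda>t c. tensor_lift (\<lambda>a b. a * B *
        Q_antipode b * Q_alpha * c) t)
      (Q_assoc \<beta> Neg) = 1"
proof -
  have b: "\<beta>\<^sup>2 * \<beta>\<^sup>2 = (- 1) ^ CARD('n)" using assms(1) by (simp flip: power_add)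
  let ?N = "CARD('n)"
  note S = algebra_antihomD(1)[OF algebra_antihom_Q_antipode[where 'a = 'n]]
  have B: "B = D1 (beta ?N (\<beta>\<^sup>2))" by (simp add: B_def Q_beta_D1)
  let ?h = "\<lambda>\<beta> :: 'n Q. tensor_lift (\<lambda>t c. tensor_lift (\<lambda>a b. Q_antipode a * 1 * b * \<beta> *
      Q_antipode c) t)"
  let ?k = "\<lambda>\<beta> :: 'n Q. tensor_lift (\<lambda>t c. tensor_lift (\<lambda>a b. a * \<beta> * Q_antipode b * 1 * c) t)"
  define P where "P = (qp \<boxtimes> qp \<boxtimes> qp :: _ \<Rightarrow> 'n Q \<otimes> 'n Q \<otimes> 'n Q)"
  have P: "P ((x, y), z) = qp x \<otimes> qp y \<otimes> qp z" for x y z by (simp add: P_def tensor_family_def)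
  have h: "?h (D1 G) (P ((x, y), z)) = D1 (\<lambda>t. G t * (if ((cinv ?N t, t), cinv ?N t) =
      ((x, y), z) then 1 else 0))"
    and k: "?k (D1 G) (P ((x, y), z)) = D1 (\<lambda>t. G t * (if ((t, cinv ?N t), t) =
        ((x, y), z) then 1 else 0))"
    if "x \<in> C4" "y \<in> C4" "z \<in> C4" for x y z G
    unfolding P antipode3_pure[OF S] antipode3'_pure[OF S]
    unfolding qp_D1[OF that(1)] qp_D1[OF that(2)] qp_D1[OF that(3)] Q_antipode_D1 mult_1_right
        C1.diag_mult
    by (rule diag_cong, simp)+
  have h1: "?h 1 (P i) = D1 (\<lambda>t. if ((cinv ?N t, t), cinv ?N t) = i then 1 else 0)"
    and k1: "?k 1 (P i) = D1 (\<lambda>t. if ((t, cinv ?N t), t) = i then 1 else 0)"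
    and hB: "?h B (P i) = B * ?h 1 (P i)" and kB: "?k B (P i) = B * ?k 1 (P i)"
    if mem: "i \<in> (C4 \<times> C4) \<times> C4" for i
  proof -
    obtain x y z where i: "i = ((x, y), z)" "x \<in> C4" "y \<in> C4" "z \<in> C4" using mem by auto
    show 1: "?h 1 (P i) = D1 (\<lambda>t. if ((cinv ?N t, t), cinv ?N t) = i then 1 else 0)"
      "?k 1 (P i) = D1 (\<lambda>t. if ((t, cinv ?N t), t) = i then 1 else 0)"
      using h[OF i(2-4), of "\<lambda>_. 1"] k[OF i(2-4), of "\<lambda>_. 1"] unfolding i(1) D1_one by simp_all
    show "?h B (P i) = B * ?h 1 (P i)" "?k B (P i) = B * ?k 1 (P i)"
      unfolding 1 unfolding B C1.diag_mult unfolding i(1) by (rule h[OF i(2-4)], rule k[OF i(2-4)])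
  qed
  \<comment> \<open>With 1 in place of \<open>B\<close> the contractions are pullbacks along z
    \<mapsto> (z^-1, z, z^-1) and z \<mapsto> (z, z^-1, z). The element \<open>B\<close> is then a
    weight in front.\<close>
  have "pulls (?h 1) ((C4 \<times> C4) \<times> C4) P C4 qp (\<lambda>t. ((cinv ?N t, t), cinv ?N t))"
    "pulls (?k 1) ((C4 \<times> C4) \<times> C4) P C4 qp (\<lambda>t. ((t, cinv ?N t), t))"
    unfolding pulls_def
    by (intro conjI ballI clinear_antipode3[OF S] clinear_antipode3'[OF S] h1 k1;
        auto simp: finite_C4 cinv_C4)+
  note pulls = this
  have hF: "?h B (D3 F) = B * D1 (\<lambda>t. F ((cinv ?N t, t), cinv ?N t))" for F
    by (rule diag_weighted[OF clinear_antipode3[OF S] pulls(1)[unfolded P_def] hB[unfolded P_def]])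
  have kF: "?k B (D3 F) = B * D1 (\<lambda>t. F ((t, cinv ?N t), t))" for F
    by (rule diag_weighted[OF clinear_antipode3'[OF S] pulls(2)[unfolded P_def] kB[unfolded P_def]])
  show "tensor_lift (\<lambda>t c. tensor_lift (\<lambda>a b. Q_antipode a * Q_alpha * b * B * Q_antipode c) t)
      (Q_assoc \<beta> Pos) = 1"
    unfolding Q_assoc_D3 Q_alpha_def hF unfolding B C1.diag_mult unfolding one_D1
    by (rule diag_cong) (simp add: mult.commute[of "beta _ _ _"] phi_beta[OF b])
  show "tensor_lift (\<lambda>t c. tensor_lift (\<lambda>a b. a * B * Q_antipode b * Q_alpha * c) t)
      (Q_assoc \<beta> Neg) = 1"
    unfolding Q_assoc_D3 Q_alpha_def kF unfolding B C1.diag_mult unfolding one_D1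
    by (rule diag_cong) (simp add: mult.commute[of "beta _ _ _"] phi_beta[OF b])
qed

section \<open>Braidings of modules\<close>

lemma cbilinear_compose:
  assumes "cbilinear f" "clinear h"
  shows "cbilinear (\<lambda>s t. h (f s t))"
  by (intro cbilinearI clinear_compose[OF assms(2)] cbilinearD[OF assms(1)])

lemma cbilinear_compose2:
  assumes "cbilinear f" "clinear g" "clinear h"
  shows "cbilinear (\<lambda>s t. f (g s) (h t))"
  by (intro cbilinearI clinear_compose[OF cbilinearD(1)[OF assms(1)] assms(3)]
      clinear_compose[OF cbilinearD(2)[OF assms(1)] assms(2)])

lemma cbilinear_ext:
  assumes "cbilinear f" "cbilinear g" "\<And>a b u v. f (a \<otimes> b) (u \<otimes> v) = g (a \<otimes> b) (u \<otimes> v)"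
  shows "f s t = g s t"
proof (rule tensor_ext[OF cbilinearD(1)[OF assms(1)] cbilinearD(1)[OF assms(2)]])
  show "f s (u \<otimes> v) = g s (u \<otimes> v)" for u v
    by (rule tensor_ext[OF cbilinearD(2)[OF assms(1)] cbilinearD(2)[OF assms(2)]]) (rule assms(3))
qed

lemma cbilinear_ext3:
  assumes "cbilinear f" "cbilinear g"
    "\<And>a b c u v w. f (a \<otimes> (b \<otimes> c)) (u \<otimes> (v \<otimes> w)) = g (a \<otimes> (b \<otimes> c)) (u \<otimes> (v \<otimes> w))"
  shows "f s t = g s t"
proof (rule tensor_ext3'[OF cbilinearD(1)[OF assms(1)] cbilinearD(1)[OF assms(2)]])
  show "f s (u \<otimes> (v \<otimes> w)) = g s (u \<otimes> (v \<otimes> w))" for u v w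
    by (rule tensor_ext3'[OF cbilinearD(2)[OF assms(1)] cbilinearD(2)[OF assms(2)]]) (rule assms(3))
qed

lemma
  assumes \<rho>: "cbilinear \<rho>" and \<sigma>: "cbilinear \<sigma>"
  shows cbilinear_tensor_action: "cbilinear (tensor_action \<rho> \<sigma>)"
    and tensor_action_pure: "tensor_action \<rho> \<sigma> (a \<otimes> b) (u \<otimes> v) = \<rho> a u \<otimes> \<sigma> b v"
    and tensor_action_pure_left: "tensor_action \<rho> \<sigma> (a \<otimes> b) t = tensor_map (\<rho> a) (\<sigma> b) t"
proof -
  have bil: "cbilinear (\<lambda>a b. tensor_map (\<rho> a) (\<sigma> b) t)" for t
    by (intro cbilinearI clinear_tensor_map_left clinear_tensor_map_right cbilinearD[OF \<rho>]
        cbilinearD[OF \<sigma>])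
  show left: "tensor_action \<rho> \<sigma> (a \<otimes> b) t = tensor_map (\<rho> a) (\<sigma> b) t" for a b t
    unfolding tensor_action_def by (rule tensor_lift_pure[OF bil])
  then show "tensor_action \<rho> \<sigma> (a \<otimes> b) (u \<otimes> v) = \<rho> a u \<otimes> \<sigma> b v"
    by (simp add: tensor_map_pure cbilinearD[OF \<rho>] cbilinearD[OF \<sigma>])
  have "clinear (\<lambda>s. tensor_action \<rho> \<sigma> s t)" for t
    unfolding tensor_action_def by (rule clinear_tensor_lift[OF bil])
  \<comment> \<open>Here the module element is the parameter, and the induction runs over the
    algebra element \<open>s\<close>.\<close>
  moreover from this have "clinear (tensor_action \<rho> \<sigma> s)" for s
    by (rule clinear_tensor_param[where h = "\<lambda>t s. tensor_action \<rho> \<sigma> s t"])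
      (simp add: left clinear_tensor_map cbilinearD[OF \<rho>] cbilinearD[OF \<sigma>])
  ultimately show "cbilinear (tensor_action \<rho> \<sigma>)" by (intro cbilinearI)
qed

lemma module_actionD:
  assumes "module_action \<rho>"
  shows "cbilinear \<rho>" "\<rho> 1 x = x" "\<rho> (a * b) x = \<rho> a (\<rho> b x)"
  using assms by (simp_all add: module_action_def)

lemma module_action_tensor_action:
  assumes \<rho>: "module_action \<rho>" and \<sigma>: "module_action \<sigma>"
  shows "module_action (tensor_action \<rho> \<sigma>)"
proof -
  note bil = module_actionD(1)[OF \<rho>] module_actionD(1)[OF \<sigma>]
  note A = cbilinear_tensor_action[OF bil] tensor_action_pure[OF bil]
  have "tensor_action \<rho> \<sigma> 1 t = t" for t
    unfolding one_tensor_def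
    by (rule tensor_ext[OF cbilinearD(1)[OF A(1)] clinear_id(2)])
      (simp add: A(2) module_actionD[OF \<rho>] module_actionD[OF \<sigma>])
  moreover have "tensor_action \<rho> \<sigma> (r * s) t = tensor_action \<rho> \<sigma> r (tensor_action \<rho> \<sigma> s t)"
      for r s t
  proof -
    have "tensor_action \<rho> \<sigma> ((a \<otimes> b) * s) t = tensor_action \<rho> \<sigma> (a \<otimes> b) (tensor_action \<rho> \<sigma> s t)"
        for a b
      by (rule cbilinear_ext[OF cbilinear_compose2[OF A(1) clinear_mult(1) clinear_id(2)]
            cbilinear_compose[OF A(1) cbilinearD(1)[OF A(1)]]])
        (simp add: A(2) tensor_mult_pure module_actionD[OF \<rho>] module_actionD[OF \<sigma>])
    then show ?thesis
      by (rule tensor_ext[OF clinear_compose[OF cbilinearD(2)[OF A(1)] clinear_mult(2)]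
          cbilinearD(2)[OF A(1)]])
  qed
  ultimately show ?thesis using A(1) by (simp add: module_action_def)
qed

lemma tensor_swap_action:
  assumes "cbilinear \<rho>" "cbilinear \<sigma>"
  shows "tensor_swap (tensor_action \<rho> \<sigma> s t) = tensor_action \<sigma> \<rho> (tensor_swap s) (tensor_swap t)"
  by (rule cbilinear_ext[OF cbilinear_compose[OF cbilinear_tensor_action[OF assms]
      clinear_tensor_swap]
        cbilinear_compose2[OF cbilinear_tensor_action[OF assms(2,1)]
            clinear_tensor_swap clinear_tensor_swap]])
    (simp add: tensor_swap_pure tensor_action_pure assms)

lemma tensor_assoc_action:
  assumes "cbilinear \<rho>" "cbilinear \<sigma>" "cbilinear \<tau>"
  shows "tensor_assoc (tensor_action \<rho> (tensor_action \<sigma> \<tau>) s t) =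
    tensor_action (tensor_action \<rho> \<sigma>) \<tau> (tensor_assoc s) (tensor_assoc t)"
  by (rule cbilinear_ext3[OF cbilinear_compose[OF _ clinear_tensor_assoc]
        cbilinear_compose2[OF _ clinear_tensor_assoc clinear_tensor_assoc]])
    (simp_all add: tensor_assoc_pure tensor_action_pure cbilinear_tensor_action assms)

lemma tensor_unassoc_action:
  assumes "cbilinear \<rho>" "cbilinear \<sigma>" "cbilinear \<tau>"
  shows "tensor_unassoc (tensor_action (tensor_action \<rho> \<sigma>) \<tau> s t) =
    tensor_action \<rho> (tensor_action \<sigma> \<tau>) (tensor_unassoc s) (tensor_unassoc t)"
  using tensor_assoc_action[OF assms, of "tensor_unassoc s" "tensor_unassoc t"]
  by (metis tensor_assoc_unassoc tensor_unassoc_assoc)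

lemma tensor_action_map:
  assumes "cbilinear \<rho>" "cbilinear \<sigma>" "clinear f" "clinear g"
  shows "tensor_action (\<lambda>a. \<rho> (f a)) (\<lambda>b. \<sigma> (g b)) s t = tensor_action \<rho> \<sigma> (tensor_map f g s) t"
  by (rule cbilinear_ext[OF cbilinear_tensor_action
        cbilinear_compose2[OF cbilinear_tensor_action clinear_tensor_map clinear_id(2)]])
    (simp_all add: tensor_action_pure tensor_map_pure assms
      cbilinear_compose2[OF assms(1,3) clinear_id(2)] cbilinear_compose2[OF assms(2,4)
          clinear_id(2)])

lemma tensor_map_action:
  assumes "cbilinear \<rho>" "cbilinear \<sigma>" "\<And>u. \<rho> 1 u = u" "\<And>u. \<sigma> 1 u = u"
  shows "tensor_map (\<rho> a) id t = tensor_action \<rho> \<sigma> (a \<otimes> 1) t"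
    and "tensor_map id (\<sigma> b) t = tensor_action \<rho> \<sigma> (1 \<otimes> b) t"
proof -
  have "\<rho> 1 = id" "\<sigma> 1 = id" by (simp_all add: fun_eq_iff assms(3,4))
  then show "tensor_map (\<rho> a) id t = tensor_action \<rho> \<sigma> (a \<otimes> 1) t"
    "tensor_map id (\<sigma> b) t = tensor_action \<rho> \<sigma> (1 \<otimes> b) t"
    by (simp_all add: tensor_action_pure_left assms(1,2))
qed

lemma tensor_map_equivariant:
  assumes "cbilinear \<rho>" "cbilinear \<sigma>" "cbilinear \<rho>'" "cbilinear \<sigma>'"
    "clinear g" "clinear h" "clinear g'" "clinear h'"
    "\<And>a u. h (\<rho> a u) = \<rho>' (g a) (h u)" "\<And>b v. h' (\<sigma> b v) = \<sigma>' (g' b) (h' v)"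
  shows "tensor_map h h' (tensor_action \<rho> \<sigma> s t) =
      tensor_action \<rho>' \<sigma>' (tensor_map g g' s) (tensor_map h h' t)"
  by (rule cbilinear_ext[OF cbilinear_compose[OF cbilinear_tensor_action clinear_tensor_map]
        cbilinear_compose2[OF cbilinear_tensor_action clinear_tensor_map clinear_tensor_map]])
    (simp_all add: tensor_action_pure tensor_map_pure assms)

section \<open>Permutations of three tensor factors\<close>

definition tensor_swap12 :: "'u::complex_vector \<otimes> 'v::complex_vector \<otimes> 'w::complex_vector \<Rightarrow> 'v \<otimes>
    'u \<otimes> 'w" where
  "tensor_swap12 t = tensor_map tensor_swap id t"

definition tensor_swap23 :: "'u::complex_vector \<otimes> 'v::complex_vector \<otimes> 'w::complex_vector \<Rightarrow> 'u \<otimes>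
    'w \<otimes> 'v" where
  "tensor_swap23 t = tensor_assoc (tensor_map id tensor_swap (tensor_unassoc t))"

text \<open>The permutation under the braiding of U with V (x) W. In the same way
  \<open>tensor_unrot\<close> lies under the braiding of U (x) V with W.\<close>

definition tensor_rot :: "'u::complex_vector \<otimes> 'v::complex_vector \<otimes> 'w::complex_vector \<Rightarrow> 'v \<otimes> 'w \<otimes>
    'u" where
  "tensor_rot t = tensor_swap (tensor_unassoc t)"

definition tensor_unrot :: "'u::complex_vector \<otimes> 'v::complex_vector \<otimes> 'w::complex_vector \<Rightarrow> 'w \<otimes> 'u
    \<otimes> 'v" where
  "tensor_unrot t = tensor_assoc (tensor_swap t)"

lemma clinear_permutations:
  "clinear tensor_swap12" "clinear tensor_swap23" "clinear tensor_rot" "clinear tensor_unrot"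
  unfolding tensor_swap12_def[abs_def] tensor_swap23_def[abs_def] tensor_rot_def[abs_def]
      tensor_unrot_def[abs_def]
  by (rule clinear_tensor_map clinear_tensor_swap clinear_id(1) clinear_compose[OF
      clinear_tensor_assoc]
      clinear_compose[OF clinear_tensor_map[OF clinear_id(1) clinear_tensor_swap]]
      clinear_tensor_unassoc clinear_compose[OF clinear_tensor_swap])+

lemma permutations_pure:
  "tensor_swap12 (u \<otimes> v \<otimes> w) = v \<otimes> u \<otimes> w" "tensor_swap23 (u \<otimes> v \<otimes> w) = u \<otimes> w \<otimes> v"
  "tensor_rot (u \<otimes> v \<otimes> w) = v \<otimes> w \<otimes> u" "tensor_unrot (u \<otimes> v \<otimes> w) = w \<otimes> u \<otimes> v"
  by (simp_all add: tensor_swap12_def tensor_swap23_def tensor_rot_def tensor_unrot_def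
      tensor_map_pure
      clinear_tensor_swap clinear_id tensor_swap_pure tensor_assoc_pure tensor_unassoc_pure)

lemma algebra_hom_permutations:
  "algebra_hom tensor_swap12" "algebra_hom tensor_swap23" "algebra_hom tensor_rot"
      "algebra_hom tensor_unrot"
  by (intro algebra_hom_tensor3I clinear_permutations;
      simp add: permutations_pure tensor_mult_pure one_tensor_def)+

lemma permutations_compose:
  "tensor_swap12 (tensor_swap12 t) = t" "tensor_swap23 (tensor_swap23 t) = t"
  "tensor_rot (tensor_unrot t) = t" "tensor_unrot (tensor_rot t) = t"
  "tensor_swap23 (tensor_swap12 t) = tensor_rot t" "tensor_swap12 (tensor_swap23 t) =
      tensor_unrot t"
  "tensor_rot (tensor_swap12 t) = tensor_swap23 t" "tensor_unrot (tensor_swap23 t) =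
      tensor_swap12 t"
  by (rule tensor_ext3[OF clinear_compose[OF clinear_permutations(1) clinear_permutations(1)]
      clinear_id(2)]
      tensor_ext3[OF clinear_compose[OF clinear_permutations(2) clinear_permutations(2)]
          clinear_id(2)]
      tensor_ext3[OF clinear_compose[OF clinear_permutations(3) clinear_permutations(4)]
          clinear_id(2)]
      tensor_ext3[OF clinear_compose[OF clinear_permutations(4) clinear_permutations(3)]
          clinear_id(2)]
      tensor_ext3[OF clinear_compose[OF clinear_permutations(2) clinear_permutations(1)]
          clinear_permutations(3)]
      tensor_ext3[OF clinear_compose[OF clinear_permutations(1) clinear_permutations(2)]
          clinear_permutations(4)]
      tensor_ext3[OF clinear_compose[OF clinear_permutations(3) clinear_permutations(1)]
          clinear_permutations(2)]
      tensor_ext3[OF clinear_compose[OF clinear_permutations(4) clinear_permutations(2)]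
          clinear_permutations(1)];
      simp add: permutations_pure)+

text \<open>Permuting algebra and module factors together moves all permutations in a composite of
  braidings to the outside, where both sides of a hexagon carry the same one. An equation in the
  third tensor power of the algebra is left.\<close>

lemma permutations_action:
  assumes "cbilinear \<rho>" "cbilinear \<sigma>" "cbilinear \<tau>"
  shows "tensor_rot (tensor_action (tensor_action \<rho> \<sigma>) \<tau> s t) =
      tensor_action (tensor_action \<sigma> \<tau>) \<rho> (tensor_rot s) (tensor_rot t)"
    and "tensor_unrot (tensor_action (tensor_action \<rho> \<sigma>) \<tau> s t) =
      tensor_action (tensor_action \<tau> \<rho>) \<sigma> (tensor_unrot s) (tensor_unrot t)"
    and "tensor_swap12 (tensor_action (tensor_action \<rho> \<sigma>) \<tau> s t) =
      tensor_action (tensor_action \<sigma> \<rho>) \<tau> (tensor_swap12 s) (tensor_swap12 t)"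
    and "tensor_swap23 (tensor_action (tensor_action \<rho> \<sigma>) \<tau> s t) =
      tensor_action (tensor_action \<rho> \<tau>) \<sigma> (tensor_swap23 s) (tensor_swap23 t)"
proof -
  note bil = cbilinear_tensor_action assms
  show "tensor_rot (tensor_action (tensor_action \<rho> \<sigma>) \<tau> s t) =
      tensor_action (tensor_action \<sigma> \<tau>) \<rho> (tensor_rot s) (tensor_rot t)"
    by (simp add: tensor_rot_def tensor_unassoc_action tensor_swap_action bil)
  show "tensor_unrot (tensor_action (tensor_action \<rho> \<sigma>) \<tau> s t) =
      tensor_action (tensor_action \<tau> \<rho>) \<sigma> (tensor_unrot s) (tensor_unrot t)"
    by (simp add: tensor_unrot_def tensor_assoc_action tensor_swap_action bil)
  show "tensor_swap12 (tensor_action (tensor_action \<rho> \<sigma>) \<tau> s t) =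
      tensor_action (tensor_action \<sigma> \<rho>) \<tau> (tensor_swap12 s) (tensor_swap12 t)"
    unfolding tensor_swap12_def
    by (rule tensor_map_equivariant) (simp_all add: bil clinear_tensor_swap clinear_id
        tensor_swap_action)
  have "tensor_map id tensor_swap (tensor_action \<rho> (tensor_action \<sigma> \<tau>) s t) =
      tensor_action \<rho> (tensor_action \<tau> \<sigma>) (tensor_map id tensor_swap s) (tensor_map id tensor_swap
          t)" for s t
    by (rule tensor_map_equivariant) (simp_all add: bil clinear_tensor_swap clinear_id
        tensor_swap_action)
  then show "tensor_swap23 (tensor_action (tensor_action \<rho> \<sigma>) \<tau> s t) =
      tensor_action (tensor_action \<rho> \<tau>) \<sigma> (tensor_swap23 s) (tensor_swap23 t)"
    by (simp add: tensor_swap23_def tensor_unassoc_action tensor_assoc_action bil)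
qed

lemma
  fixes \<rho> :: "'a::complex_algebra_1 \<Rightarrow> 'u::complex_vector \<Rightarrow> 'u"
      and \<sigma> :: "'a \<Rightarrow> 'v::complex_vector \<Rightarrow> 'v"
    and \<tau> :: "'a \<Rightarrow> 'w::complex_vector \<Rightarrow> 'w"
  assumes \<rho>: "module_action \<rho>" and \<sigma>: "module_action \<sigma>" and \<tau>: "module_action \<tau>"
  shows braiding_tensor_left: "tensor_map (braiding R \<rho> \<sigma>) id t =
      tensor_swap12 (tensor_action (tensor_action \<rho> \<sigma>) \<tau> (R \<otimes> 1) t)"
    and braiding_tensor_right: "tensor_map id (braiding R \<sigma> \<tau>) (tensor_unassoc t) =
      tensor_unassoc (tensor_swap23 (tensor_action (tensor_action \<rho> \<sigma>) \<tau> (tensor_assoc (1 \<otimes> R)) t))"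
proof -
  note bil = \<rho>[THEN module_actionD(1)] \<sigma>[THEN module_actionD(1)] \<tau>[THEN module_actionD(1)]
  have "tensor_map (braiding R \<rho> \<sigma>) id t =
      tensor_map tensor_swap id (tensor_map (tensor_action \<rho> \<sigma> R) id t)"
    unfolding braiding_def[abs_def]
    using tensor_map_compose[OF clinear_tensor_swap cbilinearD(1)[OF cbilinear_tensor_action[OF
        bil(1,2)]]
        clinear_id(1) clinear_id(1)] by (simp add: id_def)
  then show "tensor_map (braiding R \<rho> \<sigma>) id t =
      tensor_swap12 (tensor_action (tensor_action \<rho> \<sigma>) \<tau> (R \<otimes> 1) t)"
    by (simp only: tensor_swap12_def tensor_map_action(1)[OF cbilinear_tensor_action[OF bil(1,2)]
        bil(3)
          module_actionD(2)[OF module_action_tensor_action[OF \<rho> \<sigma>]] module_actionD(2)[OF \<tau>]])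
  have "tensor_map id (braiding R \<sigma> \<tau>) s =
      tensor_map id tensor_swap (tensor_map id (tensor_action \<sigma> \<tau> R) s)"
    for s :: "'u \<otimes> ('v \<otimes> 'w)"
    unfolding braiding_def[abs_def]
    using tensor_map_compose[OF clinear_id(1) clinear_id(1) clinear_tensor_swap
        cbilinearD(1)[OF cbilinear_tensor_action[OF bil(2,3)]]] by (simp add: id_def)
  then show "tensor_map id (braiding R \<sigma> \<tau>) (tensor_unassoc t) =
      tensor_unassoc (tensor_swap23 (tensor_action (tensor_action \<rho> \<sigma>) \<tau> (tensor_assoc (1 \<otimes> R)) t))"
    by (simp only: tensor_swap23_def tensor_unassoc_assoc tensor_unassoc_action[OF bil]
        tensor_map_action(2)[OF bil(1) cbilinear_tensor_action[OF bil(2,3)] module_actionD(2)[OF \<rho>]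
          module_actionD(2)[OF module_action_tensor_action[OF \<sigma> \<tau>]]])
qed

section \<open>From identities for R to braidings of modules\<close>

context quasi_hopf_algebra
begin

lemma tensor_module_eq: "tensor_module \<rho> \<sigma> = (\<lambda>a. tensor_action \<rho> \<sigma> (\<Delta> a))"
  by (simp add: tensor_module_def[abs_def] fun_eq_iff)

text \<open>The two hexagon hypotheses are the module hexagons with all permutations removed: every
  factor is rewritten so that its legs act in the original order of the three modules.\<close>

lemma braids_modulesI:
  assumes flip: "\<And>x. R * \<Delta> x = tensor_swap (\<Delta> x) * R"
    and hexagon1: "tensor_unrot \<Phi>' * tensor_assoc (tensor_map id \<Delta> R) * \<Phi>' =
      tensor_swap12 (tensor_assoc (1 \<otimes> R)) * tensor_swap12 \<Phi>' * (R \<otimes> 1)"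
    and hexagon2: "tensor_rot \<Phi> * tensor_map \<Delta> id R * \<Phi> =
      tensor_swap23 (R \<otimes> 1) * tensor_swap23 \<Phi> * tensor_assoc (1 \<otimes> R)"
  shows "braids_modules R U V W"
  unfolding braids_modules_def
proof (intro allI impI conjI)
  fix \<rho> :: "'a \<Rightarrow> 'u::complex_vector \<Rightarrow> 'u" and \<sigma> :: "'a \<Rightarrow> 'v::complex_vector \<Rightarrow> 'v"
    and \<tau> :: "'a \<Rightarrow> 'w::complex_vector \<Rightarrow> 'w"
  assume \<rho>: "module_action \<rho>" and \<sigma>: "module_action \<sigma>" and \<tau>: "module_action \<tau>"
  note mods = \<rho> \<sigma> \<tau> module_action_tensor_action
  note bil = \<rho>[THEN module_actionD(1)] \<sigma>[THEN module_actionD(1)] \<tau>[THEN module_actionD(1)]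
      cbilinear_tensor_action
  note act = module_actionD(3)[OF module_action_tensor_action, symmetric]
  note \<Delta> = algebra_homD(1)[OF comult_hom]
  note perm_mult = algebra_hom_permutations[THEN algebra_homD(3)]
  show "module_map (tensor_module \<rho> \<sigma>) (tensor_module \<sigma> \<rho>) (braiding R \<rho> \<sigma>)"
    unfolding module_map_def
  proof (intro conjI allI)
    show "clinear (braiding R \<rho> \<sigma>)"
      unfolding braiding_def[abs_def]
      by (rule clinear_compose[OF clinear_tensor_swap cbilinearD(1)[OF cbilinear_tensor_action[OF
          bil(1,2)]]])
    show "braiding R \<rho> \<sigma> (tensor_module \<rho> \<sigma> a t) = tensor_module \<sigma> \<rho> a (braiding R \<rho> \<sigma> t)" for a t
    proof -
      have "tensor_swap (R * \<Delta> a) = \<Delta> a * tensor_swap R"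
        by (simp only: flip algebra_homD(3)[OF algebra_hom_tensor_swap] tensor_swap_swap)
      then show ?thesis
        by (simp add: braiding_def tensor_module_def tensor_swap_action bil act mods)
    qed
  qed
  show "associator_inv \<sigma> \<tau> \<rho> \<circ> braiding R \<rho> (tensor_module \<sigma> \<tau>) \<circ> associator_inv \<rho> \<sigma> \<tau> =
      tensor_map id (braiding R \<rho> \<tau>) \<circ> associator_inv \<sigma> \<rho> \<tau> \<circ> tensor_map (braiding R \<rho> \<sigma>) id"
  proof
    fix t
    let ?A = "tensor_assoc (1 \<otimes> R)" and ?X = "tensor_assoc (tensor_map id \<Delta> R)"
    have 1: "tensor_swap (tensor_action \<rho> (tensor_module \<sigma> \<tau>) R (tensor_unassoc s)) =
        tensor_rot (tensor_action (tensor_action \<rho> \<sigma>) \<tau> ?X s)" for s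
    proof -
      have "tensor_action \<rho> (tensor_module \<sigma> \<tau>) R (tensor_unassoc s) =
          tensor_action \<rho> (tensor_action \<sigma> \<tau>) (tensor_map id \<Delta> R) (tensor_unassoc s)"
        unfolding tensor_module_eq
        using tensor_action_map[of \<rho> "tensor_action \<sigma> \<tau>" "id" \<Delta>] by (simp add: bil clinear_id \<Delta>)
      then show ?thesis
        by (simp add: tensor_rot_def tensor_unassoc_action bil tensor_unassoc_assoc)
    qed
    \<comment> \<open>The composites end in the order V, W, U, so the hypothesis is rotated into
      that order before it acts.\<close>
    have "\<Phi>' * tensor_rot (?X * \<Phi>') = tensor_swap23 (?A * \<Phi>' * tensor_swap12 (R \<otimes> 1))"
      using arg_cong[OF hexagon1, of tensor_rot]
      by (simp add: perm_mult permutations_compose mult.assoc)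
    then show "(associator_inv \<sigma> \<tau> \<rho> \<circ> braiding R \<rho> (tensor_module \<sigma> \<tau>) \<circ> associator_inv \<rho> \<sigma> \<tau>) t =
      (tensor_map id (braiding R \<rho> \<tau>) \<circ> associator_inv \<sigma> \<rho> \<tau> \<circ> tensor_map (braiding R \<rho> \<sigma>) id) t"
      by (simp add: associator_inv_def braiding_def[of _ _ "tensor_module \<sigma> \<tau>"] 1
          braiding_tensor_left[OF \<rho> \<sigma> \<tau>] braiding_tensor_right[OF \<sigma> \<rho> \<tau>] permutations_action
          bil act mods permutations_compose mult.assoc)
  qed
  show "associator \<tau> \<rho> \<sigma> \<circ> braiding R (tensor_module \<rho> \<sigma>) \<tau> \<circ> associator \<rho> \<sigma> \<tau> =
      tensor_map (braiding R \<rho> \<tau>) id \<circ> associator \<rho> \<tau> \<sigma> \<circ> tensor_map id (braiding R \<sigma> \<tau>)"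
  proof
    fix t
    let ?A = "tensor_assoc (1 \<otimes> R)" and ?Y = "tensor_map \<Delta> id R"
    have 1: "tensor_assoc (tensor_swap (tensor_action (tensor_module \<rho> \<sigma>) \<tau> R s)) =
        tensor_unrot (tensor_action (tensor_action \<rho> \<sigma>) \<tau> ?Y s)" for s
    proof -
      have "tensor_action (tensor_module \<rho> \<sigma>) \<tau> R s = tensor_action (tensor_action \<rho> \<sigma>) \<tau> ?Y s"
        unfolding tensor_module_eq
        using tensor_action_map[of "tensor_action \<rho> \<sigma>" \<tau> \<Delta> id] by (simp add: bil clinear_id \<Delta>)
      then show ?thesis by (simp add: tensor_unrot_def)
    qed
    have 2: "tensor_assoc (tensor_map id (braiding R \<sigma> \<tau>) t) =
        tensor_swap23 (tensor_action (tensor_action \<rho> \<sigma>) \<tau> ?A (tensor_assoc t))"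
      using arg_cong[OF braiding_tensor_right[OF \<rho> \<sigma> \<tau>, of R "tensor_assoc t"], of tensor_assoc]
      by (simp add: tensor_assoc_unassoc tensor_unassoc_assoc)
    have "\<Phi> * tensor_unrot (?Y * \<Phi>) = tensor_swap12 ((R \<otimes> 1) * \<Phi> * tensor_swap23 ?A)"
      using arg_cong[OF hexagon2, of tensor_unrot]
      by (simp add: perm_mult permutations_compose mult.assoc)
    then show "(associator \<tau> \<rho> \<sigma> \<circ> braiding R (tensor_module \<rho> \<sigma>) \<tau> \<circ> associator \<rho> \<sigma> \<tau>) t =
      (tensor_map (braiding R \<rho> \<tau>) id \<circ> associator \<rho> \<tau> \<sigma> \<circ> tensor_map id (braiding R \<sigma> \<tau>)) t"
      by (simp add: associator_def braiding_def[of _ "tensor_module \<rho> \<sigma>"] 1 2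
          braiding_tensor_left[OF \<rho> \<tau> \<sigma>] permutations_action bil act mods permutations_compose
              mult.assoc)
  qed
qed

end

section \<open>The R-matrix\<close>

text \<open>
  On \<open>e\<^sub>n \<otimes> e\<^sub>m\<close> the element \<open>\<rho>\<^sub>n\<^sub>m\<close> takes the value \<open>(1 + s + t - s t) / 2\<close>, where \<open>s\<close>
  and \<open>t\<close> are the signs of \<open>\<omega>\<^sub>-\<close> on the first and of \<open>\<omega>\<^sub>+\<close> on the second factor.
\<close>

definition rsign :: "complex \<Rightarrow> complex \<Rightarrow> complex" where
  "rsign s t = (if s = - 1 \<and> t = - 1 then - 1 else 1)"

definition rchar :: "complex \<Rightarrow> complex \<Rightarrow> complex \<Rightarrow> complex" where
  "rchar c x y = (if odd_char x \<and> odd_char y then c else 1) * rsign (omega_char Neg x)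
      (omega_char Pos y)"

lemma omega_char_values:
  "omega_char s 1 = 1" "omega_char s (- 1) = - 1" "omega_char Pos \<i> = - 1" "omega_char Neg \<i> = 1"
  by (simp_all add: omega_char_def)

lemma omega_char_uminus: "omega_char s (- x) = - omega_char s x"
  by (simp add: omega_char_def)

lemma omega_char_pm: "x \<in> C4 \<Longrightarrow> omega_char s x = 1 \<or> omega_char s x = - 1"
  by (cases s; elim C4E) (simp_all add: omega_char_values omega_char_uminus)

lemma omega_char_square: "x \<in> C4 \<Longrightarrow> omega_char s x * omega_char s x = 1"
  using omega_char_pm[of x s] by auto

lemma omega_char_Pos_Neg:
  "x \<in> C4 \<Longrightarrow> omega_char Neg x = (if odd_char x then - omega_char Pos x else omega_char Pos x)"
  by (simp add: omega_char_def)

text \<open>On signs, \<open>rsign\<close> is the nontrivial bicharacter: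
  \<open>rsign (- s) t = t * rsign s t\<close>, and likewise in the other argument. Negating x or y
  negates the corresponding value of omega.\<close>

lemma rchar_uminus:
  assumes "x \<in> C4" "y \<in> C4"
  shows "rchar c (- x) y = omega_char Pos y * rchar c x y"
    and "rchar c x (- y) = omega_char Neg x * rchar c x y"
  using omega_char_pm[OF assms(1), of Neg] omega_char_pm[OF assms(2), of Pos]
  by (auto simp: rchar_def rsign_def omega_char_uminus)

lemma rchar_inverse: "c * d = 1 \<Longrightarrow> rchar c x y * rchar d x y = 1"
  by (simp add: rchar_def rsign_def)

text \<open>Up to the factor b on odd characters, \<open>psi\<close> is the N-th power of a value of
  omega_s, and that value is 1 or -1.\<close>

lemma psi_omega:
  assumes "x \<in> C4"
  shows "psi N b s x * omega_char s x ^ N = (if odd_char x then b else 1)"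
proof -
  have "psi N b s x = (if odd_char x then b else 1) * omega_char s x ^ N"
    by (simp add: psi_def omega_char_def)
  then show ?thesis
    by (simp add: mult.assoc omega_char_square[OF assms] flip: power_mult_distrib)
qed

lemma omega_power: "x \<in> C4 \<Longrightarrow> omega_char s x ^ N = (if even N then 1 else omega_char s x)"
  using omega_char_pm[of x s] by auto

text \<open>As \<open>rsign\<close> is multiplicative in its second argument, y and z behave
  independently, except that for odd y and z \<open>omega_char_cmul\<close> adds (-1)^N. This turns
  into omega_-(x)^N and cancels against psi(x), leaving \<beta>^2 for odd x. The two factors r on
  the right give the same \<beta>^2. Otherwise at most one of y and z is odd, and \<beta> occurs
  equally often on both sides.\<close>

lemma rchar_hexagon1:
  assumes "x \<in> C4" "y \<in> C4" "z \<in> C4"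
  shows "phi N (\<beta>\<^sup>2) Neg y z x * rchar \<beta> x (cmul N y z) * phi N (\<beta>\<^sup>2) Neg x y z =
    rchar \<beta> x z * phi N (\<beta>\<^sup>2) Neg y x z * rchar \<beta> x y"
proof (cases "odd_char y \<and> odd_char z")
  case True
  have 1: "omega_char Pos (cmul N y z) = (- 1) ^ N * (omega_char Pos y * omega_char Pos z)"
    using True assms by (simp add: omega_char_cmul)
  have "rsign (omega_char Neg x) (omega_char Pos (cmul N y z)) =
      omega_char Neg x ^ N * (rsign (omega_char Neg x) (omega_char Pos y) *
          rsign (omega_char Neg x) (omega_char Pos z))"
    unfolding 1 omega_power[OF assms(1)]
    using omega_char_pm[OF assms(1), of Neg] omega_char_pm[OF assms(2), of Pos]
        omega_char_pm[OF assms(3), of Pos]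
    by (cases "even N") (auto simp: rsign_def)
  then have "psi N (\<beta>\<^sup>2) Neg x * rsign (omega_char Neg x) (omega_char Pos (cmul N y z)) =
     (if odd_char x then \<beta>\<^sup>2 else 1) * (rsign (omega_char Neg x) (omega_char Pos y) *
       rsign (omega_char Neg x) (omega_char Pos z))"
    using psi_omega[OF assms(1), of N "\<beta>\<^sup>2" Neg] by (simp add: mult.assoc[symmetric])
  with True assms show ?thesis
    by (simp add: phi_def rchar_def power2_eq_square mult.commute mult.left_commute)
next
  case False
  then have 1: "omega_char Pos (cmul N y z) = omega_char Pos y * omega_char Pos z"
    using assms by (auto simp: omega_char_cmul)
  have "rsign (omega_char Neg x) (omega_char Pos (cmul N y z)) =
      rsign (omega_char Neg x) (omega_char Pos y) * rsign (omega_char Neg x) (omega_char Pos z)"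
    unfolding 1
    using omega_char_pm[OF assms(1), of Neg] omega_char_pm[OF assms(2), of Pos]
        omega_char_pm[OF assms(3), of Pos]
    by (auto simp: rsign_def)
  with False assms show ?thesis
    by (auto simp: phi_def rchar_def)
qed

text \<open>The mirror image of \<open>rchar_hexagon1\<close>: for odd x and y the extra sign
  becomes omega_+(z)^N and cancels against psi(z).\<close>

lemma rchar_hexagon2:
  assumes "x \<in> C4" "y \<in> C4" "z \<in> C4"
  shows "phi N (\<beta>\<^sup>2) Pos z x y * rchar \<beta> (cmul N x y) z * phi N (\<beta>\<^sup>2) Pos x y z =
    rchar \<beta> x z * phi N (\<beta>\<^sup>2) Pos x z y * rchar \<beta> y z"
proof (cases "odd_char x \<and> odd_char y")
  case True
  have 1: "omega_char Neg (cmul N x y) = (- 1) ^ N * (omega_char Neg x * omega_char Neg y)"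
    using True assms by (simp add: omega_char_cmul)
  have "rsign (omega_char Neg (cmul N x y)) (omega_char Pos z) =
      omega_char Pos z ^ N * (rsign (omega_char Neg x) (omega_char Pos z) *
          rsign (omega_char Neg y) (omega_char Pos z))"
    unfolding 1 omega_power[OF assms(3)]
    using omega_char_pm[OF assms(1), of Neg] omega_char_pm[OF assms(2), of Neg]
        omega_char_pm[OF assms(3), of Pos]
    by (cases "even N") (auto simp: rsign_def)
  then have "psi N (\<beta>\<^sup>2) Pos z * rsign (omega_char Neg (cmul N x y)) (omega_char Pos z) =
     (if odd_char z then \<beta>\<^sup>2 else 1) * (rsign (omega_char Neg x) (omega_char Pos z) *
       rsign (omega_char Neg y) (omega_char Pos z))"
    using psi_omega[OF assms(3), of N "\<beta>\<^sup>2" Pos] by (simp add: mult.assoc[symmetric])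
  with True assms show ?thesis
    by (simp add: phi_def rchar_def power2_eq_square mult.commute mult.left_commute)
next
  case False
  then have 1: "omega_char Neg (cmul N x y) = omega_char Neg x * omega_char Neg y"
    using assms by (auto simp: omega_char_cmul)
  have "rsign (omega_char Neg (cmul N x y)) (omega_char Pos z) =
      rsign (omega_char Neg x) (omega_char Pos z) * rsign (omega_char Neg y) (omega_char Pos z)"
    unfolding 1
    using omega_char_pm[OF assms(1), of Neg] omega_char_pm[OF assms(2), of Neg]
        omega_char_pm[OF assms(3), of Pos]
    by (auto simp: rsign_def)
  with False assms show ?thesis
    by (cases "odd_char x"; cases "odd_char y"; cases "odd_char z")
      (simp_all add: phi_def rchar_def mult.commute mult.left_commute)
qed

text \<open>The function \<open>c\<close> stands for the powers of \<beta> in R and for those of its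
  inverse in R^-1, so one evaluation on the sixteen pairs of characters serves both.\<close>

lemma Q_R_cartan:
  assumes "c 0 = 1"
  shows "(\<Sum>n\<in>{0,1}. \<Sum>m\<in>{0,1}. c (n * m) *\<^sub>C (q\<rho> n m * (qe n \<otimes> qe m))) =
    (D2 (\<lambda>(x, y). rchar (c 1) x y) :: 'n Q \<otimes> 'n Q)"
proof -
  have e: "qe n = (D1 (\<lambda>z. if odd_char z = (n \<noteq> 0) then 1 else 0) :: 'n Q)" for n
    unfolding qe_def qe0_D1 qe1_D1 by (cases "n = 0") (auto intro!: diag_cong)
  have k: "qK ^ p \<otimes> qK ^ q = (D2 (\<lambda>(x, y). x ^ p * y ^ q) :: 'n Q \<otimes> 'n Q)" for p q
    unfolding qK_D1 C1.diag_power by (rule D1_tensor)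
  show ?thesis
    unfolding q\<rho>_def k e D1_tensor diag_scaleC diag_sum C2.diag_mult
    by (rule diag_cong, clarify, elim C4E)
      (simp_all add: assms rchar_def rsign_def omega_char_values omega_char_uminus power_int_minus)
qed

definition Rmode :: "'n \<Rightarrow> 'n Q \<otimes> 'n Q" where
  "Rmode k = (qf Neg k * q\<omega> Neg) \<otimes> qf Pos k"

lemma Q_R_eq:
  "(Q_R \<beta> :: 'n::{finite,linorder} Q \<otimes> 'n Q) =
      D2 (\<lambda>(x, y). rchar \<beta> x y) * ordered_prod (\<lambda>k. 1 - 2 *\<^sub>C Rmode k)"
  unfolding Q_R_def Rmode_def one_tensor_def by (subst Q_R_cartan[of "\<lambda>n. \<beta> ^ n"]) simp_all

lemma Q_R_inv_eq:
  "(Q_R_inv \<beta> :: 'n::{finite,linorder} Q \<otimes> 'n Q) =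
    ordered_prod (\<lambda>k. 1 + 2 *\<^sub>C Rmode k) * D2 (\<lambda>(x, y). rchar (inverse \<beta>) x y)"
  unfolding Q_R_inv_def Rmode_def one_tensor_def
  by (subst Q_R_cartan[of "\<lambda>n. \<beta> powi (- int n)"]) (simp_all add: power_int_minus)

lemma qf_square: "qf s i * qf s i = 0"
proof -
  have "2 *\<^sub>C (qf s i * qf s i) = 0"
    using qf_same[of s i i] scaleC_add_left[of 1 1 "qf s i * qf s i"] by simp
  then show ?thesis by simp
qed

lemma qf_anticommute: "qf s i * qf s j = - (qf s j * qf s i)"
  using qf_same[of s i j] by (simp add: eq_neg_iff_add_eq_0)

lemma q\<omega>_qf': "q\<omega> t * (qf s i * x) = - (qf s i * (q\<omega> t * x))"
  by (simp add: q\<omega>_qf flip: mult.assoc)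

lemma q\<omega>_commute: "q\<omega> s * q\<omega> t = q\<omega> t * q\<omega> s"
  unfolding q\<omega>_D1 by (rule C1.diag_commute)

text \<open>Exchanging k and l costs a sign in each of the two legs, and these signs cancel.\<close>

lemma Rmode_commute: "Rmode k * Rmode l = Rmode l * Rmode k"
proof -
  have "Rmode k * Rmode l = - ((qf Neg k * qf Neg l * (q\<omega> Neg * q\<omega> Neg)) \<otimes> (qf Pos k * qf Pos l))"
      for k l
    by (simp add: Rmode_def tensor_mult_pure mult.assoc q\<omega>_qf' tensor_minus_left)
  note * = this
  show ?thesis
    unfolding *[of k l] *[of l k] qf_anticommute[of Neg k l] qf_anticommute[of Pos k l]
    by (simp add: tensor_minus_left tensor_minus_right)
qed

lemma Rmode_square: "Rmode k * Rmode k = 0"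
  by (simp add: Rmode_def tensor_mult_pure qf_square)

lemma one_minus_mult_one_plus:
  fixes x :: "'a::complex_algebra_1"
  assumes "x * x = 0"
  shows "(1 - 2 *\<^sub>C x) * (1 + 2 *\<^sub>C x) = 1" "(1 + 2 *\<^sub>C x) * (1 - 2 *\<^sub>C x) = 1"
  by (simp_all add: ring_distribs assms)

lemma Q_R_inverse:
  assumes "\<beta> \<noteq> 0"
  shows "Q_R \<beta> * Q_R_inv \<beta> = (1 :: 'n::{finite,linorder} Q \<otimes> 'n Q)"
    "Q_R_inv \<beta> * Q_R \<beta> = (1 :: 'n::{finite,linorder} Q \<otimes> 'n Q)"
proof -
  let ?D = "D2 (\<lambda>(x, y). rchar \<beta> x y) :: 'n Q \<otimes> 'n Q"
      and ?D' = "D2 (\<lambda>(x, y). rchar (inverse \<beta>) x y) :: 'n Q \<otimes> 'n Q"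
  let ?E = "ordered_prod (\<lambda>k. 1 - 2 *\<^sub>C Rmode k) :: 'n Q \<otimes> 'n Q"
      and ?E' = "ordered_prod (\<lambda>k. 1 + 2 *\<^sub>C Rmode k) :: 'n Q \<otimes> 'n Q"
  have c: "(1 - 2 *\<^sub>C Rmode k) * (1 + 2 *\<^sub>C Rmode l) = (1 + 2 *\<^sub>C Rmode l) * (1 - 2 *\<^sub>C Rmode k)"
      for k l :: 'n
    by (simp add: ring_distribs Rmode_commute[of k l]
        scaleC_add_right complex_vector.scale_right_diff_distrib)
  have E: "?E * ?E' = 1" "?E' * ?E = 1"
    by (simp_all add: ordered_prod_mult[symmetric] c one_minus_mult_one_plus Rmode_square
        ordered_prod_one)
  have D: "?D * ?D' = 1" "?D' * ?D = 1"
    unfolding C2.diag_mult C2.diag_one[symmetric]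
    by (rule diag_cong; use assms in \<open>auto simp: rchar_inverse\<close>)+
  have "?D * ?E * (?E' * ?D') = ?D * (?E * ?E') * ?D'" "?E' * ?D' * (?D * ?E) =
      ?E' * (?D' * ?D) * ?E"
    by (simp_all only: mult.assoc)
  then show "Q_R \<beta> * Q_R_inv \<beta> = (1 :: 'n Q \<otimes> 'n Q)" "Q_R_inv \<beta> * Q_R \<beta> = (1 :: 'n Q \<otimes> 'n Q)"
    unfolding Q_R_eq Q_R_inv_eq E D by (simp_all add: E D)
qed

text \<open>Conjugation of \<open>y\<close> by 1 - 2x, with the commutator \<open>z\<close> of x and
  y as its only correction because z x = 0.\<close>

lemma one_minus_intertwine:
  fixes x y z :: "'a::complex_algebra_1"
  assumes "x * y - y * x = z" "z * x = 0"
  shows "(1 - 2 *\<^sub>C x) * y = (y - 2 *\<^sub>C z) * (1 - 2 *\<^sub>C x)"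
proof -
  have "x * y = y * x + z" using assms(1) by (simp add: algebra_simps)
  then show ?thesis by (simp add: ring_distribs assms(2) scaleC_add_right)
qed

text \<open>Moving \<open>a\<close> past omega_- changes the sign, so the commutator becomes an
  anticommutator in the first leg, where the defining relations apply.\<close>

lemma Rmode_commutator_left:
  assumes "q\<omega> Neg * a = - (a * q\<omega> Neg)"
  shows "Rmode k * (a \<otimes> 1) - (a \<otimes> 1) * Rmode k =
      - (((qf Neg k * a + a * qf Neg k) * q\<omega> Neg) \<otimes> qf Pos k)"
  by (simp add: Rmode_def tensor_mult_pure mult.assoc assms ring_distribs tensor_add_left
      tensor_minus_left)

text \<open>Now the sign comes from the first leg, and the anticommutator appears in the
  second.\<close>

lemma Rmode_commutator_right:
  assumes "c * qf Neg k = - (qf Neg k * c)" "c * q\<omega> Neg = q\<omega> Neg * c"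
  shows "Rmode k * (c \<otimes> a) - (c \<otimes> a) * Rmode k = (qf Neg k * (q\<omega> Neg * c)) \<otimes> (qf Pos k * a +
      a * qf Pos k)"
proof -
  have "c * (qf Neg k * q\<omega> Neg) = - (qf Neg k * (q\<omega> Neg * c))"
    using assms by (simp flip: mult.assoc) (simp add: mult.assoc)
  then show ?thesis
    by (simp add: Rmode_def tensor_mult_pure mult.assoc tensor_add_right tensor_minus_left)
qed

lemma q\<omega>_square: "q\<omega> s * q\<omega> s = 1"
  unfolding q\<omega>_D1 C1.diag_mult one_D1 by (rule diag_cong) (simp add: omega_char_square)

lemma qe1_qf: "qe1 * qf s i = qf s i * qe1"
  by (rule qe1_commute)

text \<open>
  Moving \<open>\<Delta>(f\<^sub>j\<^sup>\<plusminus>)\<close> past the product adds \<open>-2\<close> times its commutator with the \<open>j\<close>-th mode, and this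
  replaces \<open>\<omega>\<^sub>+\<close> by \<open>\<omega>\<^sub>-\<close> and \<open>1\<close> by \<open>K\<^sup>2\<close>, respectively.
\<close>

lemma Rmode_intertwine_Pos:
  fixes k j :: "'n"
  defines "Y \<equiv> qf Pos j \<otimes> 1 + q\<omega> Pos \<otimes> qf Pos j" and "Y' \<equiv> qf Pos j \<otimes> 1 + q\<omega> Neg \<otimes> qf Pos j"
  shows "k \<noteq> j \<Longrightarrow> (1 - 2 *\<^sub>C Rmode k) * Y = Y * (1 - 2 *\<^sub>C Rmode k)"
    and "k \<noteq> j \<Longrightarrow> (1 - 2 *\<^sub>C Rmode k) * Y' = Y' * (1 - 2 *\<^sub>C Rmode k)"
    and "(1 - 2 *\<^sub>C Rmode j) * Y = Y' * (1 - 2 *\<^sub>C Rmode j)"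
proof -
  have comm: "Rmode k * (qf Pos j \<otimes> 1 + q\<omega> s \<otimes> qf Pos j) - (qf Pos j \<otimes> 1 + q\<omega> s \<otimes> qf Pos j) *
      Rmode k =
      (if k = j then - ((qe1 * q\<omega> Neg) \<otimes> qf Pos j) else 0)" for k s
    using Rmode_commutator_left[OF q\<omega>_qf[of Neg Pos j], of k]
      Rmode_commutator_right[OF q\<omega>_qf[of s Neg k] q\<omega>_commute, of "qf Pos j"]
    by (simp add: ring_distribs qf_Pos_Neg qf_same add.commute[of "qf Neg k * qf Pos j"])
  \<comment> \<open>On e_1 the values of omega_+ and omega_- are opposite, on e_0 they agree. Adding
    2 e_1 omega_- thus turns omega_+ into omega_-.\<close>
  have "Y - 2 *\<^sub>C (- ((qe1 * q\<omega> Neg) \<otimes> qf Pos j)) = Y'"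
  proof -
    have "q\<omega> Pos + 2 *\<^sub>C (qe1 * q\<omega> Neg) = (q\<omega> Neg :: 'n Q)"
      unfolding q\<omega>_D1 qe1_D1 C1.diag_mult diag_scaleC diag_add
          by (rule diag_cong) (auto simp: omega_char_def)
    then show ?thesis
      by (simp add: Y_def Y'_def add.assoc flip: tensor_scale_left tensor_add_left)
  qed
  moreover have "- ((qe1 * q\<omega> Neg) \<otimes> qf Pos j) * Rmode j = 0"
    by (simp add: Rmode_def tensor_mult_pure qf_square)
  ultimately show "(1 - 2 *\<^sub>C Rmode j) * Y = Y' * (1 - 2 *\<^sub>C Rmode j)"
    using one_minus_intertwine[of "Rmode j" Y "- ((qe1 * q\<omega> Neg) \<otimes> qf Pos j)"] comm[of j Pos]
    by (simp add: Y_def)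
  show "(1 - 2 *\<^sub>C Rmode k) * Y = Y * (1 - 2 *\<^sub>C Rmode k)" "(1 - 2 *\<^sub>C Rmode k) * Y' =
      Y' * (1 - 2 *\<^sub>C Rmode k)"
    if "k \<noteq> j"
    using one_minus_intertwine[of "Rmode k" Y 0] one_minus_intertwine[of "Rmode k" Y' 0]
        comm[of k Pos] comm[of k Neg] that
    by (simp_all add: Y_def Y'_def)
qed

lemma Rmode_intertwine_Neg:
  fixes k j :: "'n"
  defines "Y \<equiv> qf Neg j \<otimes> 1 + q\<omega> Neg \<otimes> qf Neg j" and "Y' \<equiv> qf Neg j \<otimes> (1 - 2 *\<^sub>C qe1) +
      q\<omega> Neg \<otimes> qf Neg j"
  shows "k \<noteq> j \<Longrightarrow> (1 - 2 *\<^sub>C Rmode k) * Y = Y * (1 - 2 *\<^sub>C Rmode k)"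
    and "k \<noteq> j \<Longrightarrow> (1 - 2 *\<^sub>C Rmode k) * Y' = Y' * (1 - 2 *\<^sub>C Rmode k)"
    and "(1 - 2 *\<^sub>C Rmode j) * Y = Y' * (1 - 2 *\<^sub>C Rmode j)"
proof -
  have comm: "Rmode k * Y - Y * Rmode k = (if k = j then qf Neg j \<otimes> qe1 else 0)" for k
    using Rmode_commutator_left[OF q\<omega>_qf[of Neg Neg j], of k]
      Rmode_commutator_right[OF q\<omega>_qf[of Neg Neg k] q\<omega>_commute, of "qf Neg j"]
    by (simp add: Y_def ring_distribs qf_Pos_Neg qf_same q\<omega>_square)
  have Y': "Y - 2 *\<^sub>C (qf Neg j \<otimes> qe1) = Y'"
    by (simp add: Y_def Y'_def tensor_diff_right tensor_scale_right)
  have Z: "Rmode k * (qf Neg j \<otimes> qe1) = (qf Neg j \<otimes> qe1) * Rmode k" for k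
  proof -
    have "qf Neg k * (q\<omega> Neg * qf Neg j) = qf Neg j * (qf Neg k * q\<omega> Neg)"
      unfolding q\<omega>_qf mult.assoc[symmetric] qf_anticommute[of Neg j k] by (simp add: mult.assoc)
    then show ?thesis
      by (simp add: Rmode_def tensor_mult_pure mult.assoc qe1_qf)
  qed
  have Z0: "(qf Neg j \<otimes> qe1) * Rmode j = 0"
    by (simp add: Rmode_def tensor_mult_pure qf_square flip: mult.assoc)
  show "(1 - 2 *\<^sub>C Rmode j) * Y = Y' * (1 - 2 *\<^sub>C Rmode j)"
    using one_minus_intertwine[OF _ Z0, of Y] comm[of j] by (simp add: Y')
  assume "k \<noteq> j"
  then have "Rmode k * Y = Y * Rmode k" using comm[of k] by simp
  then show "(1 - 2 *\<^sub>C Rmode k) * Y = Y * (1 - 2 *\<^sub>C Rmode k)" "(1 - 2 *\<^sub>C Rmode k) * Y' =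
      Y' * (1 - 2 *\<^sub>C Rmode k)"
    unfolding Y'[symmetric]
    by (simp_all add: ring_distribs Z scaleC_add_right complex_vector.scale_right_diff_distrib)
qed

lemma tensor_qf_D2:
  "(qf s i \<otimes> 1) * D2 F = D2 (\<lambda>(x, y). F (- x, y)) * (qf s i \<otimes> 1)"
  "(1 \<otimes> qf s i) * D2 F = D2 (\<lambda>(x, y). F (x, - y)) * (1 \<otimes> qf s i)"
  "(qf s i \<otimes> qf t j) * D2 F = D2 (\<lambda>(x, y). F (- x, - y)) * (qf s i \<otimes> qf t j)"
  unfolding moves_diag[OF moves_tensor[OF moves_qf moves_one]]
      moves_diag[OF moves_tensor[OF moves_one moves_qf]]
    moves_diag[OF moves_tensor[OF moves_qf moves_qf]]
  by (rule arg_cong[where f = "\<lambda>d. d * _"], rule diag_cong, auto)+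

lemma Rmode_D2: "Rmode k = D2 (\<lambda>(x, y). - omega_char Neg x) * (qf Neg k \<otimes> qf Pos k)"
  by (simp add: Rmode_def q\<omega>_D1 qf_D1 tensor_D2 omega_char_uminus)

lemma ordered_prod_Rmode_intertwine:
  "ordered_prod (\<lambda>k. 1 - 2 *\<^sub>C Rmode k) * (qf Pos j \<otimes> 1 + q\<omega> Pos \<otimes> qf Pos j) =
    (qf Pos j \<otimes> 1 + q\<omega> Neg \<otimes> qf Pos j) * ordered_prod (\<lambda>k :: 'n::{finite,linorder}. 1 - 2 *\<^sub>C
      Rmode k)"
  "ordered_prod (\<lambda>k. 1 - 2 *\<^sub>C Rmode k) * (qf Neg j \<otimes> 1 + q\<omega> Neg \<otimes> qf Neg j) =
    (qf Neg j \<otimes> (1 - 2 *\<^sub>C qe1) + q\<omega> Neg \<otimes> qf Neg j) * ordered_prod (\<lambda>k :: 'n. 1 - 2 *\<^sub>C Rmode k)"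
  by (rule ordered_prod_intertwine_single[of j]; intro Rmode_intertwine_Pos Rmode_intertwine_Neg;
      assumption)+

lemma Q_R_flip: "Q_R \<beta> * Q_comult x = tensor_swap (Q_comult x) * Q_R \<beta>"
    for x :: "'n::{finite,linorder} Q"
proof -
  let ?r = "D2 (\<lambda>(x, y). rchar \<beta> x y) :: 'n Q \<otimes> 'n Q"
  let ?E = "ordered_prod (\<lambda>k. 1 - 2 *\<^sub>C Rmode k) :: 'n Q \<otimes> 'n Q"
  have "tensor_swap (Q_comult x) * Q_R \<beta> = Q_R \<beta> * Q_comult x"
  proof (rule Q_intertwine[of "\<lambda>x. tensor_swap (Q_comult x)" Q_comult])
    show "algebra_hom (\<lambda>x :: 'n Q. tensor_swap (Q_comult x))"
      by (rule algebra_hom_compose[OF algebra_hom_tensor_swap algebra_hom_Q_comult])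
    let ?c = "D2 (\<lambda>(x, y). cmul CARD('n) x y) :: 'n Q \<otimes> 'n Q"
    \<comment> \<open>A mode negates both arguments, and the product of the two characters does not
      change.\<close>
    have "Rmode k * ?c = ?c * Rmode k" for k
    proof -
      have "D2 (\<lambda>(x, y). - omega_char Neg x) * D2 (\<lambda>(x, y). cmul CARD('n) (- x) (- y)) =
          ?c * D2 (\<lambda>(x, y). - omega_char Neg x)"
        unfolding C2.diag_mult by (rule diag_cong) (auto simp: cmul_uminus)
      then show ?thesis
        by (simp add: Rmode_D2 mult.assoc tensor_qf_D2) (simp flip: mult.assoc)
    qed
    then have "?c * ?E = ?E * ?c"
      by (intro ordered_prod_intertwine) (simp add: ring_distribs)
    moreover have "tensor_swap ?c = ?c"
      unfolding diag_tensor_swap by (rule diag_cong) (auto simp: cmul_commute)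
    moreover have "?c * (?r * ?E) = ?r * (?c * ?E)"
      by (simp add: C2.diag_mult mult.commute case_prod_beta flip: mult.assoc)
    ultimately show "tensor_swap (Q_comult qK) * Q_R \<beta> = Q_R \<beta> * Q_comult (qK :: 'n Q)"
      unfolding Q_comult_qK Q_R_eq by (simp add: mult.assoc)
  next
    fix s and j :: 'n
    \<comment> \<open>\<open>Y'\<close> is the intermediate element: the modes turn \<open>Y\<close>
      into \<open>Y'\<close>, and the Cartan factor turns \<open>Y'\<close> into the flip of
      \<open>Y\<close>.\<close>
    have *: "tensor_swap Y * Q_R \<beta> = Q_R \<beta> * Y" if "?E * Y = Y' * ?E" "tensor_swap Y * ?r =
        ?r * Y'" for Y Y'
      unfolding Q_R_eq by (simp add: mult.assoc that(1)) (simp add: that(2) flip: mult.assoc)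
    have swap: "tensor_swap (qf s j \<otimes> 1 + q\<omega> s \<otimes> qf s j) =
        1 \<otimes> qf s j + D2 (\<lambda>(x, y). omega_char s y) * (qf s j \<otimes> 1)" for s
      by (simp only: clinear_rules[OF clinear_tensor_swap] tensor_swap_pure) (simp add: q\<omega>_D1
          tensor_D2)
    have \<omega>: "q\<omega> s \<otimes> qf t j = D2 (\<lambda>(x, y). omega_char s x) * (1 \<otimes> qf t j)" for s t
      by (simp add: q\<omega>_D1 tensor_D2)
    show "tensor_swap (Q_comult (qf s j)) * Q_R \<beta> = Q_R \<beta> * Q_comult (qf s j :: 'n Q)"
    proof (cases s)
      case Pos
      have "D2 (\<lambda>(x, y). omega_char Pos y) * D2 (\<lambda>(x, y). rchar \<beta> (- x) y) = ?r"
        unfolding C2.diag_mult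
        by (rule diag_cong) (auto simp: rchar_uminus omega_char_square simp flip: mult.assoc)
      moreover have "D2 (\<lambda>(x, y). rchar \<beta> x (- y)) = ?r * D2 (\<lambda>(x, y). omega_char Neg x)"
        unfolding C2.diag_mult by (rule diag_cong) (auto simp: rchar_uminus)
      ultimately have "tensor_swap (qf Pos j \<otimes> 1 + q\<omega> Pos \<otimes> qf Pos j) * ?r =
          ?r * (qf Pos j \<otimes> 1 + q\<omega> Neg \<otimes> qf Pos j)"
        unfolding swap unfolding \<omega>
        by (simp add: ring_distribs mult.assoc tensor_qf_D2) (simp add: add.commute flip:
            mult.assoc)
      from *[OF ordered_prod_Rmode_intertwine(1) this] show ?thesis
          by (simp add: Pos Q_comult_values)
    next
      case Neg
      have e: "1 - 2 *\<^sub>C qe1 = (D1 (\<lambda>z. if odd_char z then - 1 else 1) :: 'n Q)"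
        unfolding qe1_D1 one_D1 diag_scaleC diag_diff by (rule diag_cong) auto
      \<comment> \<open>Moving f through the first leg of the Cartan factor produces omega_+(y). Its
        product with omega_-(y) is the value of K^2, which is the factor
        \<open>1 - 2 *\<^sub>C qe1\<close> in the second leg.\<close>
      have "D2 (\<lambda>(x, y). omega_char Neg y) * D2 (\<lambda>(x, y). rchar \<beta> (- x) y) =
          ?r * D2 (\<lambda>(x, y). if odd_char y then - 1 else 1)"
        unfolding C2.diag_mult
        by (rule diag_cong) (auto simp: rchar_uminus omega_char_Pos_Neg omega_char_square simp
            flip: mult.assoc)
      moreover have "D2 (\<lambda>(x, y). rchar \<beta> x (- y)) = ?r * D2 (\<lambda>(x, y). omega_char Neg x)"
        unfolding C2.diag_mult by (rule diag_cong) (auto simp: rchar_uminus)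
      ultimately have "tensor_swap (qf Neg j \<otimes> 1 + q\<omega> Neg \<otimes> qf Neg j) * ?r =
          ?r * (qf Neg j \<otimes> (1 - 2 *\<^sub>C qe1) + q\<omega> Neg \<otimes> qf Neg j)"
        unfolding swap unfolding e \<omega> tensor_D2
        by (simp add: ring_distribs mult.assoc tensor_qf_D2) (simp add: add.commute flip:
            mult.assoc)
      from *[OF ordered_prod_Rmode_intertwine(2) this] show ?thesis
          by (simp add: Neg Q_comult_values)
    qed
  qed (rule algebra_hom_Q_comult)
  then show ?thesis by simp
qed

section \<open>The hexagon identities\<close>

lemma tensor_qf_D3:
  "(qf s i \<otimes> qf t j \<otimes> 1) * D3 F = D3 (\<lambda>((x, y), z). F ((- x, - y), z)) * (qf s i \<otimes> qf t j \<otimes> 1)"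
  "(qf s i \<otimes> 1 \<otimes> qf t j) * D3 F = D3 (\<lambda>((x, y), z). F ((- x, y), - z)) * (qf s i \<otimes> 1 \<otimes> qf t j)"
  "(1 \<otimes> qf s i \<otimes> qf t j) * D3 F = D3 (\<lambda>((x, y), z). F ((x, - y), - z)) * (1 \<otimes> qf s i \<otimes> qf t j)"
  unfolding moves_diag[OF moves_tensor[OF moves_tensor[OF moves_qf moves_qf] moves_one]]
    moves_diag[OF moves_tensor[OF moves_tensor[OF moves_qf moves_one] moves_qf]]
    moves_diag[OF moves_tensor[OF moves_tensor[OF moves_one moves_qf] moves_qf]]
  by (rule arg_cong[where f = "\<lambda>d. d * _"], rule diag_cong, auto)+

abbreviation mode12 :: "'n \<Rightarrow> 'n Q \<otimes> 'n Q \<otimes> 'n Q" where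
  "mode12 k \<equiv> qf Neg k \<otimes> qf Pos k \<otimes> 1"
abbreviation mode13 :: "'n \<Rightarrow> 'n Q \<otimes> 'n Q \<otimes> 'n Q" where
  "mode13 k \<equiv> qf Neg k \<otimes> 1 \<otimes> qf Pos k"
abbreviation mode23 :: "'n \<Rightarrow> 'n Q \<otimes> 'n Q \<otimes> 'n Q" where
  "mode23 k \<equiv> 1 \<otimes> qf Neg k \<otimes> qf Pos k"

text \<open>Two such modes overlap in a single tensor factor, where both carry generators of the
  same sign, so exactly one minus sign arises.\<close>

lemma modes_anticommute: "mode12 k * mode13 l = - (mode13 l * mode12 k)" "mode13 k * mode23 l =
    - (mode23 l * mode13 k)"
  by (simp_all add: tensor_mult_pure qf_anticommute[of Neg k l] qf_anticommute[of Pos k l]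
      tensor_minus_left tensor_minus_right)

lemma modes_zero: "mode13 k * mode12 k = 0" "mode13 k * mode23 k = 0"
  by (simp_all add: tensor_mult_pure qf_square)

lemma mode_intertwine:
  fixes d u u' :: "'a::complex_algebra_1"
  assumes "d * u' = u * d"
  shows "d * (1 - 2 *\<^sub>C u') = (1 - 2 *\<^sub>C u) * d"
  by (simp add: ring_distribs assms)

lemma one_minus_mult:
  fixes x y :: "'a::complex_algebra_1"
  assumes "x * y = 0"
  shows "(1 - 2 *\<^sub>C x) * (1 - 2 *\<^sub>C y) = 1 - 2 *\<^sub>C (y + x)"
  by (simp add: ring_distribs assms scaleC_add_right)

lemma one_minus_commute:
  fixes x y :: "'a::complex_algebra_1"
  assumes "x * y = y * x"
  shows "(1 - 2 *\<^sub>C x) * (1 - 2 *\<^sub>C y) = (1 - 2 *\<^sub>C y) * (1 - 2 *\<^sub>C x)"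
  by (simp add: ring_distribs assms scaleC_add_right complex_vector.scale_right_diff_distrib)

lemma hom_Q_R:
  assumes "algebra_hom h"
  shows "h (Q_R \<beta> :: 'n::{finite,linorder} Q \<otimes> 'n Q) =
    h (D2 (\<lambda>(x, y). rchar \<beta> x y)) * ordered_prod (\<lambda>k. 1 - 2 *\<^sub>C h (Rmode k))"
  by (simp add: Q_R_eq ordered_prod_hom[OF assms] clinear_rules[OF algebra_homD(1)[OF assms]]
      algebra_homD[OF assms])

lemma permutations_D3:
  "tensor_swap12 (D3 F) = D3 (\<lambda>((x, y), z). F ((y, x), z))"
  "tensor_swap23 (D3 F) = D3 (\<lambda>((x, y), z). F ((x, z), y))"
  "tensor_rot (D3 F) = D3 (\<lambda>((x, y), z). F ((z, x), y))"
  "tensor_unrot (D3 F) = D3 (\<lambda>((x, y), z). F ((y, z), x))"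
proof -
  have swap: "pulls tensor_swap (C4 \<times> C4) (qp \<boxtimes> qp) (C4 \<times> C4) (qp \<boxtimes> qp :: _ \<Rightarrow> 'n Q \<otimes> 'n Q)
      (\<lambda>(x, y). (y, x))"
    by (rule pullsI) (auto simp: clinear_tensor_swap finite_C4 diag_tensor_swap intro!: diag_cong)
  note id = pulls_id[OF finite_C4, where P = "qp :: _ \<Rightarrow> 'n Q"]
  show "tensor_swap12 (D3 F :: 'n Q \<otimes> 'n Q \<otimes> 'n Q) = D3 (\<lambda>((x, y), z). F ((y, x), z))"
    unfolding tensor_swap12_def pulls_diag[OF pulls_tensor_map[OF swap id]] by (rule diag_cong) auto
  show "tensor_swap23 (D3 F :: 'n Q \<otimes> 'n Q \<otimes> 'n Q) = D3 (\<lambda>((x, y), z). F ((x, z), y))"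
    unfolding tensor_swap23_def diag_tensor_unassoc pulls_diag[OF pulls_tensor_map[OF id swap]]
        diag_tensor_assoc
    by (rule diag_cong) auto
  show "tensor_rot (D3 F :: 'n Q \<otimes> 'n Q \<otimes> 'n Q) = D3 (\<lambda>((x, y), z). F ((z, x), y))"
    unfolding tensor_rot_def diag_tensor_unassoc diag_tensor_swap by (rule diag_cong) auto
  show "tensor_unrot (D3 F :: 'n Q \<otimes> 'n Q \<otimes> 'n Q) = D3 (\<lambda>((x, y), z). F ((y, z), x))"
    unfolding tensor_unrot_def diag_tensor_swap diag_tensor_assoc by (rule diag_cong) auto
qed

lemma
  shows Q_R_12: "(Q_R \<beta> :: 'n::{finite,linorder} Q \<otimes> 'n Q) \<otimes> 1 = D3 (\<lambda>((x, y), z). rchar \<beta> x y) *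
      ordered_prod (\<lambda>k. 1 - 2 *\<^sub>C (D3 (\<lambda>((x, y), z). - omega_char Neg x) * mode12 k))"
    and Q_R_23: "tensor_assoc (1 \<otimes> (Q_R \<beta> :: 'n Q \<otimes> 'n Q)) = D3 (\<lambda>((x, y), z). rchar \<beta> y z) *
      ordered_prod (\<lambda>k. 1 - 2 *\<^sub>C (D3 (\<lambda>((x, y), z). - omega_char Neg y) * mode23 k))"
proof -
  have 12: "D2 F \<otimes> 1 = (D3 (\<lambda>((x, y), z). F (x, y)) :: 'n Q \<otimes> 'n Q \<otimes> 'n Q)" for F
    unfolding tensor_D3 by (simp flip: one_tensor_def)
  have 23: "tensor_assoc (1 \<otimes> D2 F) = (D3 (\<lambda>((x, y), z). F (y, z)) :: 'n Q \<otimes> 'n Q \<otimes> 'n Q)" for F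
    unfolding one_D1 diag_tensor diag_tensor_assoc by (rule diag_cong) auto
  have hom: "algebra_hom (\<lambda>s. tensor_assoc (1 \<otimes> s) :: 'n Q \<otimes> 'n Q \<otimes> 'n Q)"
    by (rule algebra_hom_compose[OF algebra_hom_tensor_assoc algebra_hom_tensor_right])
  have m12: "Rmode k \<otimes> 1 = D3 (\<lambda>((x, y), z). - omega_char Neg x) * mode12 k" for k :: 'n
    unfolding Rmode_D2 tensor_D3 by simp
  have m23: "tensor_assoc (1 \<otimes> Rmode k) = D3 (\<lambda>((x, y), z). - omega_char Neg y) * mode23 k"
      for k :: 'n
    unfolding Rmode_D2 algebra_homD(3)[OF hom] 23 tensor_assoc_pure by simp
  show "(Q_R \<beta> :: 'n Q \<otimes> 'n Q) \<otimes> 1 = D3 (\<lambda>((x, y), z). rchar \<beta> x y) *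
      ordered_prod (\<lambda>k. 1 - 2 *\<^sub>C (D3 (\<lambda>((x, y), z). - omega_char Neg x) * mode12 k))"
    unfolding hom_Q_R[OF algebra_hom_tensor_left] 12 m12 by simp
  show "tensor_assoc (1 \<otimes> (Q_R \<beta> :: 'n Q \<otimes> 'n Q)) = D3 (\<lambda>((x, y), z). rchar \<beta> y z) *
      ordered_prod (\<lambda>k. 1 - 2 *\<^sub>C (D3 (\<lambda>((x, y), z). - omega_char Neg y) * mode23 k))"
    unfolding hom_Q_R[OF hom] 23 m23 by simp
qed

lemma
  shows Q_R_13: "tensor_swap12 (tensor_assoc (1 \<otimes> (Q_R \<beta> :: 'n::{finite,linorder} Q \<otimes> 'n Q))) =
      D3 (\<lambda>((x, y), z). rchar \<beta> x z) *
      ordered_prod (\<lambda>k. 1 - 2 *\<^sub>C (D3 (\<lambda>((x, y), z). - omega_char Neg x) * mode13 k))"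
    and Q_R_13': "tensor_swap23 ((Q_R \<beta> :: 'n Q \<otimes> 'n Q) \<otimes> 1) = D3 (\<lambda>((x, y), z). rchar \<beta> x z) *
      ordered_prod (\<lambda>k. 1 - 2 *\<^sub>C (D3 (\<lambda>((x, y), z). - omega_char Neg x) * mode13 k))"
proof -
  note h = algebra_hom_permutations(1,2)
  note h3 = h[THEN algebra_homD(3)] h[THEN algebra_homD(2)]
      h[THEN algebra_homD(1), THEN clinear_diff]
    h[THEN algebra_homD(1), THEN clinear_scaleC] h[THEN ordered_prod_hom]
        permutations_D3 permutations_pure
  show "tensor_swap12 (tensor_assoc (1 \<otimes> (Q_R \<beta> :: 'n::{finite,linorder} Q \<otimes> 'n Q))) =
      D3 (\<lambda>((x, y), z). rchar \<beta> x z) *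
      ordered_prod (\<lambda>k. 1 - 2 *\<^sub>C (D3 (\<lambda>((x, y), z). - omega_char Neg x) * mode13 k))"
    unfolding Q_R_23 h3 by simp
  show "tensor_swap23 ((Q_R \<beta> :: 'n Q \<otimes> 'n Q) \<otimes> 1) = D3 (\<lambda>((x, y), z). rchar \<beta> x z) *
      ordered_prod (\<lambda>k. 1 - 2 *\<^sub>C (D3 (\<lambda>((x, y), z). - omega_char Neg x) * mode13 k))"
    unfolding Q_R_12 h3 by simp
qed

lemma modes_D3:
  "D3 F * mode12 k * D3 G = D3 (\<lambda>((x, y), z). F ((x, y), z) * G ((- x, - y), z)) * mode12 k"
  "D3 F * mode13 k * D3 G = D3 (\<lambda>((x, y), z). F ((x, y), z) * G ((- x, y), - z)) * mode13 k"
  "D3 F * mode23 k * D3 G = D3 (\<lambda>((x, y), z). F ((x, y), z) * G ((x, - y), - z)) * mode23 k"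
  unfolding mult.assoc tensor_qf_D3 C3.diag_mult'
  by (rule arg_cong[where f = "\<lambda>d. d * _"], rule diag_cong, auto)+

lemma sign_square: "(- 1) ^ n * ((- 1) ^ n * c) = (c :: complex)"
  by (cases "even n") simp_all

text \<open>
  The coproduct splits each mode into two parts whose product in one order vanishes, so its factor
  \<open>1 - 2 (A + B)\<close> is the product of a factor of \<open>R\<^sub>1\<^sub>3\<close> and one of \<open>R\<^sub>1\<^sub>2\<close>, up to
  conjugation by Cartan elements.
\<close>

lemma Q_hexagon1:
  fixes \<beta> :: complex
  defines "\<Phi>' \<equiv> Q_assoc \<beta> Neg :: 'n::{finite,linorder} Q \<otimes> 'n Q \<otimes> 'n Q"
  shows "tensor_unrot \<Phi>' * tensor_assoc (tensor_map id Q_comult (Q_R \<beta>)) * \<Phi>' =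
    tensor_swap12 (tensor_assoc (1 \<otimes> Q_R \<beta>)) * tensor_swap12 \<Phi>' * (Q_R \<beta> \<otimes> 1)"
proof -
  define sg where "sg x y = (if odd_char x \<and> odd_char y then (- 1) ^ CARD('n) else 1 :: complex)"
      for x y
  define f where "f = (\<lambda>((x, y), z). phi CARD('n) (\<beta>\<^sup>2) Neg x y z)"
  define A where "A k = (D3 (\<lambda>((x, y), z). - omega_char Neg x) * mode12 k :: 'n Q \<otimes> 'n Q \<otimes> 'n Q)"
      for k
  define B where "B k = (D3 (\<lambda>((x, y), z). - omega_char Neg x * omega_char Pos y) *
      mode13 k :: 'n Q \<otimes> 'n Q \<otimes> 'n Q)" for k
  \<comment> \<open>\<open>B'\<close> is \<open>B\<close> conjugated by \<Phi>', which adds the sign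
    \<open>sg\<close>. Conjugation by \<open>u\<close> then turns \<open>B'\<close> into
    \<open>C\<close>, the mode of R in legs 1 and 3.\<close>
  define B' where "B' k = (D3 (\<lambda>((x, y), z). - omega_char Neg x * omega_char Pos y * sg x y) *
      mode13 k :: 'n Q \<otimes> 'n Q \<otimes> 'n Q)" for k
  define C where "C k = (D3 (\<lambda>((x, y), z). - omega_char Neg x) * mode13 k :: 'n Q \<otimes> 'n Q \<otimes> 'n Q)"
      for k
  \<comment> \<open>The Cartan elements that stand between the modes of R_13 and those of R_12 on
    the right-hand side: \<Phi>' with its first two legs exchanged, times the Cartan factor of
    R_12.\<close>
  define u where "u = (\<lambda>((x, y), z). phi CARD('n) (\<beta>\<^sup>2) Neg y x z * rchar \<beta> x y)"
  have \<Phi>': "\<Phi>' = D3 f" by (simp add: \<Phi>'_def Q_assoc_D3 f_def)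
  have hom: "algebra_hom (\<lambda>s :: 'n Q \<otimes> 'n Q. tensor_assoc (tensor_map id Q_comult s))"
    by (rule algebra_hom_compose[OF algebra_hom_tensor_assoc algebra_hom_tensor_map[OF
        algebra_hom_id algebra_hom_Q_comult]])
  have mode: "tensor_assoc (tensor_map id Q_comult (Rmode k)) = A k + B k" for k :: 'n
  proof -
    have "tensor_assoc (tensor_map id Q_comult (Rmode k)) =
        (qf Neg k * q\<omega> Neg) \<otimes> qf Pos k \<otimes> 1 + (qf Neg k * q\<omega> Neg) \<otimes> q\<omega> Pos \<otimes> qf Pos k"
      by (simp only: Rmode_def tensor_map_pure clinear_id algebra_homD(1)[OF algebra_hom_Q_comult]
          Q_comult_values
          tensor_add_right clinear_rules[OF clinear_tensor_assoc] tensor_assoc_pure id_apply)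
    also have "(qf Neg k * q\<omega> Neg) \<otimes> qf Pos k \<otimes> 1 = A k"
      unfolding A_def q\<omega>_D1 qf_D1 tensor_D2 tensor_D3 by (simp add: omega_char_uminus)
    also have "(qf Neg k * q\<omega> Neg) \<otimes> q\<omega> Pos \<otimes> qf Pos k = B k"
      unfolding B_def q\<omega>_D1 qf_D1 tensor_D2(1) unfolding tensor_D2(4) C2.diag_mult'
          unfolding tensor_D3
      by (rule arg_cong[where f = "\<lambda>d. d * _"], rule diag_cong, auto simp: omega_char_uminus)
    finally show ?thesis .
  qed
  have AB: "D3 f * (A k + B' k) = (A k + B k) * D3 f" for k
  proof -
    have "D3 f * A k = A k * D3 f"
      unfolding A_def modes_D3 mult.assoc[symmetric] C3.diag_mult
      by (rule arg_cong[where f = "\<lambda>d. d * _"], rule diag_cong) (auto simp: f_def phi_minus)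
    moreover have "D3 f * B' k = B k * D3 f"
      unfolding B_def B'_def modes_D3 mult.assoc[symmetric] C3.diag_mult
      by (rule arg_cong[where f = "\<lambda>d. d * _"], rule diag_cong) (auto simp: f_def phi_minus
          phi_uminus3 sg_def)
    ultimately show ?thesis by (simp add: ring_distribs)
  qed
  have C: "D3 u * B' k = C k * D3 u" for k
    unfolding C_def B'_def modes_D3 mult.assoc[symmetric] C3.diag_mult
    by (rule arg_cong[where f = "\<lambda>d. d * _"], rule diag_cong)
      (auto simp: u_def phi_minus phi_uminus3 sg_def rchar_uminus)
  have zero: "B' k * A k = 0" for k
    unfolding A_def B'_def mult.assoc[symmetric] modes_D3 unfolding mult.assoc modes_zero by simp
  \<comment> \<open>The minus sign of the anticommuting modes cancels against a minus sign from
    their Cartan coefficients, whose arguments the modes negate.\<close>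
  have commute: "A k * B' l = B' l * A k" for k l
    unfolding A_def B'_def mult.assoc[symmetric] modes_D3
    unfolding mult.assoc modes_anticommute(1)[of k l] mult_minus_right
    unfolding mult_minus_left[symmetric] diag_minus
    by (rule arg_cong[where f = "\<lambda>d. d * _"], rule diag_cong) (auto simp: omega_char_uminus sg_def)
  let ?D = "\<lambda>F. D3 F :: 'n Q \<otimes> 'n Q \<otimes> 'n Q"
  let ?E = "ordered_prod (\<lambda>k. 1 - 2 *\<^sub>C (A k + B' k))"
  have "tensor_unrot \<Phi>' * tensor_assoc (tensor_map id Q_comult (Q_R \<beta>)) * \<Phi>' =
      D3 (\<lambda>((x, y), z). phi CARD('n) (\<beta>\<^sup>2) Neg y z x) * D3 (\<lambda>((x, y), z). rchar \<beta> x (cmul CARD('n)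
          y z)) *
        (ordered_prod (\<lambda>k. 1 - 2 *\<^sub>C (A k + B k)) * D3 f)"
    unfolding hom_Q_R[OF hom] mode tensor_map_comult_D2' \<Phi>' permutations_D3
        by (simp add: f_def mult.assoc)
  also have "ordered_prod (\<lambda>k. 1 - 2 *\<^sub>C (A k + B k)) * D3 f = D3 f * ?E"
    by (rule ordered_prod_intertwine[symmetric]) (rule mode_intertwine, rule AB)
  also have "D3 (\<lambda>((x, y), z). phi CARD('n) (\<beta>\<^sup>2) Neg y z x) * D3 (\<lambda>((x, y), z). rchar \<beta> x
      (cmul CARD('n) y z)) * (D3 f * ?E) =
      D3 (\<lambda>((x, y), z). rchar \<beta> x z) * D3 u * ?E"
    unfolding mult.assoc[symmetric] C3.diag_mult
    by (rule arg_cong[where f = "\<lambda>d. d * _"], rule diag_cong)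
      (auto simp: f_def u_def rchar_hexagon1 simp flip: mult.assoc)
  also have "?E = ordered_prod (\<lambda>k. 1 - 2 *\<^sub>C B' k) * ordered_prod (\<lambda>k. 1 - 2 *\<^sub>C A k)"
    unfolding one_minus_mult[OF zero, symmetric]
    by (rule ordered_prod_mult) (rule one_minus_commute, rule commute)
  also have "D3 (\<lambda>((x, y), z). rchar \<beta> x z) * D3 u * (ordered_prod (\<lambda>k. 1 - 2 *\<^sub>C B' k) *
      ordered_prod (\<lambda>k. 1 - 2 *\<^sub>C A k)) =
      D3 (\<lambda>((x, y), z). rchar \<beta> x z) * (D3 u * ordered_prod (\<lambda>k. 1 - 2 *\<^sub>C B' k)) *
          ordered_prod (\<lambda>k. 1 - 2 *\<^sub>C A k)"
    by (simp only: mult.assoc)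
  also have "D3 u * ordered_prod (\<lambda>k. 1 - 2 *\<^sub>C B' k) = ordered_prod (\<lambda>k. 1 - 2 *\<^sub>C C k) * D3 u"
    by (rule ordered_prod_intertwine) (rule mode_intertwine, rule C)
  also have "?D u = D3 (\<lambda>((x, y), z). f ((y, x), z)) * D3 (\<lambda>((x, y), z). rchar \<beta> x y)"
    unfolding C3.diag_mult by (rule diag_cong) (auto simp: u_def f_def)
  finally show ?thesis
    unfolding Q_R_13 Q_R_12 \<Phi>' permutations_D3 A_def C_def by (simp only: mult.assoc)
qed

text \<open>The mirror image of \<open>Q_hexagon1\<close>. Here the sign \<open>sg\<close> is
  already present in the coproduct of f^- omega_-, since omega_- is not grouplike, and conjugation
  by \<Phi> removes it: \<open>A'\<close> and \<open>B'\<close> are free of it.\<close>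

lemma Q_hexagon2:
  fixes \<beta> :: complex
  defines "\<Phi> \<equiv> Q_assoc \<beta> Pos :: 'n::{finite,linorder} Q \<otimes> 'n Q \<otimes> 'n Q"
  shows "tensor_rot \<Phi> * tensor_map Q_comult id (Q_R \<beta>) * \<Phi> =
    tensor_swap23 (Q_R \<beta> \<otimes> 1) * tensor_swap23 \<Phi> * tensor_assoc (1 \<otimes> Q_R \<beta>)"
proof -
  define sg where "sg x y = (if odd_char x \<and> odd_char y then (- 1) ^ CARD('n) else 1 :: complex)"
      for x y
  define f where "f = (\<lambda>((x, y), z). phi CARD('n) (\<beta>\<^sup>2) Pos x y z)"
  define A where "A k = (D3 (\<lambda>((x, y), z). - omega_char Neg y * sg x y) * mode23 k :: 'n Q \<otimes> 'n Q
      \<otimes> 'n Q)" for k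
  define B where "B k = (D3 (\<lambda>((x, y), z). - omega_char Neg x * omega_char Neg y * sg x y) *
      mode13 k :: 'n Q \<otimes> 'n Q \<otimes> 'n Q)" for k
  define A' where "A' k = (D3 (\<lambda>((x, y), z). - omega_char Neg y) * mode23 k :: 'n Q \<otimes> 'n Q \<otimes> 'n
      Q)" for k
  define B' where "B' k = (D3 (\<lambda>((x, y), z). - omega_char Neg x * omega_char Neg y) *
      mode13 k :: 'n Q \<otimes> 'n Q \<otimes> 'n Q)" for k
  define C where "C k = (D3 (\<lambda>((x, y), z). - omega_char Neg x) * mode13 k :: 'n Q \<otimes> 'n Q \<otimes> 'n Q)"
      for k
  define u where "u = (\<lambda>((x, y), z). phi CARD('n) (\<beta>\<^sup>2) Pos x z y * rchar \<beta> y z)"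
  have \<Phi>: "\<Phi> = D3 f" by (simp add: \<Phi>_def Q_assoc_D3 f_def)
  have hom: "algebra_hom (tensor_map Q_comult id :: 'n Q \<otimes> 'n Q \<Rightarrow> _)"
    by (rule algebra_hom_tensor_map[OF algebra_hom_Q_comult algebra_hom_id])
  have mode: "tensor_map Q_comult id (Rmode k) = A k + B k" for k :: 'n
  proof -
    have "D2 (\<lambda>(x, y). omega_char Neg x) * D2 (\<lambda>(x, y). omega_char Neg (cmul CARD('n) x (- y))) =
        (D2 (\<lambda>(x, y). - omega_char Neg y * sg x y) :: 'n Q \<otimes> 'n Q)"
      unfolding C2.diag_mult
      by (rule diag_cong) (auto simp: omega_char_cmul C4_uminus omega_char_uminus sg_def
          omega_char_square
          mult.left_commute[of "omega_char Neg _" "omega_char Neg _"] simp flip: mult.assoc)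
    moreover have "D2 (\<lambda>(x, y). omega_char Neg (cmul CARD('n) (- x) y)) =
        (D2 (\<lambda>(x, y). - omega_char Neg x * omega_char Neg y * sg x y) :: 'n Q \<otimes> 'n Q)"
      by (rule diag_cong) (auto simp: omega_char_cmul C4_uminus omega_char_uminus sg_def)
    ultimately have "Q_comult (qf Neg k * q\<omega> Neg) =
        D2 (\<lambda>(x, y). - omega_char Neg x * omega_char Neg y * sg x y) * (qf Neg k \<otimes> 1) +
        D2 (\<lambda>(x, y). - omega_char Neg y * sg x y) * (1 \<otimes> qf Neg k)"
      unfolding algebra_homD(3)[OF algebra_hom_Q_comult] Q_comult_qf q\<omega>_D1 Q_comult_D1
      by (simp add: ring_distribs mult.assoc tensor_qf_D2) (simp flip: mult.assoc)
    then have "tensor_map Q_comult id (Rmode k) =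
        (D2 (\<lambda>(x, y). - omega_char Neg x * omega_char Neg y * sg x y) * (qf Neg k \<otimes> 1)) \<otimes> qf Pos k +
        (D2 (\<lambda>(x, y). - omega_char Neg y * sg x y) * (1 \<otimes> qf Neg k)) \<otimes> qf Pos k"
      by (simp only: Rmode_def tensor_map_pure clinear_id algebra_homD(1)[OF algebra_hom_Q_comult]
          tensor_add_left id_apply)
    then show ?thesis
      unfolding A_def B_def tensor_D3 by (simp add: add.commute)
  qed
  have AB: "D3 f * (A' k + B' k) = (A k + B k) * D3 f" for k
  proof -
    have "D3 f * A' k = A k * D3 f"
      unfolding A_def A'_def modes_D3 mult.assoc[symmetric] C3.diag_mult
      by (rule arg_cong[where f = "\<lambda>d. d * _"], rule diag_cong)
        (auto simp: f_def phi_minus phi_uminus3 sg_def sign_square)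
    moreover have "D3 f * B' k = B k * D3 f"
      unfolding B_def B'_def modes_D3 mult.assoc[symmetric] C3.diag_mult
      by (rule arg_cong[where f = "\<lambda>d. d * _"], rule diag_cong)
        (auto simp: f_def phi_minus phi_uminus3 sg_def sign_square)
    ultimately show ?thesis by (simp add: ring_distribs)
  qed
  have C: "D3 u * B' k = C k * D3 u" for k
    unfolding C_def B'_def modes_D3 mult.assoc[symmetric] C3.diag_mult
    by (rule arg_cong[where f = "\<lambda>d. d * _"], rule diag_cong)
      (auto simp: u_def phi_minus rchar_uminus)
  have zero: "B' k * A' k = 0" for k
    unfolding A'_def B'_def mult.assoc[symmetric] modes_D3 unfolding mult.assoc modes_zero by simp
  have commute: "A' k * B' l = B' l * A' k" for k l
    unfolding A'_def B'_def mult.assoc[symmetric] modes_D3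
    unfolding mult.assoc modes_anticommute(2)[of l k] mult_minus_right
    unfolding mult_minus_left[symmetric] diag_minus
    by (rule arg_cong[where f = "\<lambda>d. d * _"], rule diag_cong) (auto simp: omega_char_uminus)
  let ?D = "\<lambda>F. D3 F :: 'n Q \<otimes> 'n Q \<otimes> 'n Q"
  let ?E = "ordered_prod (\<lambda>k. 1 - 2 *\<^sub>C (A' k + B' k))"
  have "tensor_rot \<Phi> * tensor_map Q_comult id (Q_R \<beta>) * \<Phi> =
      D3 (\<lambda>((x, y), z). phi CARD('n) (\<beta>\<^sup>2) Pos z x y) * D3 (\<lambda>((x, y), z). rchar \<beta> (cmul CARD('n) x
          y) z) *
        (ordered_prod (\<lambda>k. 1 - 2 *\<^sub>C (A k + B k)) * D3 f)"
    unfolding hom_Q_R[OF hom] mode tensor_map_comult_D2 \<Phi> permutations_D3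
        by (simp add: f_def mult.assoc)
  also have "ordered_prod (\<lambda>k. 1 - 2 *\<^sub>C (A k + B k)) * D3 f = D3 f * ?E"
    by (rule ordered_prod_intertwine[symmetric]) (rule mode_intertwine, rule AB)
  also have "D3 (\<lambda>((x, y), z). phi CARD('n) (\<beta>\<^sup>2) Pos z x y) *
      D3 (\<lambda>((x, y), z). rchar \<beta> (cmul CARD('n) x y) z) * (D3 f * ?E) =
      D3 (\<lambda>((x, y), z). rchar \<beta> x z) * D3 u * ?E"
    unfolding mult.assoc[symmetric] C3.diag_mult
    by (rule arg_cong[where f = "\<lambda>d. d * _"], rule diag_cong)
      (auto simp: f_def u_def rchar_hexagon2 simp flip: mult.assoc)
  also have "?E = ordered_prod (\<lambda>k. 1 - 2 *\<^sub>C B' k) * ordered_prod (\<lambda>k. 1 - 2 *\<^sub>C A' k)"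
    unfolding one_minus_mult[OF zero, symmetric]
    by (rule ordered_prod_mult) (rule one_minus_commute, rule commute)
  also have "D3 (\<lambda>((x, y), z). rchar \<beta> x z) * D3 u * (ordered_prod (\<lambda>k. 1 - 2 *\<^sub>C B' k) *
      ordered_prod (\<lambda>k. 1 - 2 *\<^sub>C A' k)) =
      D3 (\<lambda>((x, y), z). rchar \<beta> x z) * (D3 u * ordered_prod (\<lambda>k. 1 - 2 *\<^sub>C B' k)) *
          ordered_prod (\<lambda>k. 1 - 2 *\<^sub>C A' k)"
    by (simp only: mult.assoc)
  also have "D3 u * ordered_prod (\<lambda>k. 1 - 2 *\<^sub>C B' k) = ordered_prod (\<lambda>k. 1 - 2 *\<^sub>C C k) * D3 u"
    by (rule ordered_prod_intertwine) (rule mode_intertwine, rule C)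
  also have "?D u = D3 (\<lambda>((x, y), z). f ((x, z), y)) * D3 (\<lambda>((x, y), z). rchar \<beta> y z)"
    unfolding C3.diag_mult by (rule diag_cong) (auto simp: u_def f_def)
  finally show ?thesis
    unfolding Q_R_13' Q_R_23 \<Phi> permutations_D3 A'_def C_def by (simp only: mult.assoc)
qed

section \<open>The ribbon element\<close>

definition vchar :: "complex \<Rightarrow> complex \<Rightarrow> complex" where
  "vchar c z = (if odd_char z then - (c * \<i> * z) else 1)"

text \<open>The values of the central element K^2 = e_0 - e_1.\<close>

definition parity :: "complex \<Rightarrow> complex" where
  "parity z = (if odd_char z then - 1 else 1)"

definition Vmode :: "'n \<Rightarrow> 'n Q" where
  "Vmode k = 1 - 2 *\<^sub>C (qf Pos k * qf Neg k)"

definition Vmode' :: "'n \<Rightarrow> 'n Q" where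
  "Vmode' k = 1 + 2 *\<^sub>C (qf Pos k * qf Neg k * qK\<^sup>2)"

lemma vchar_eq: "qe0 - (c * \<i>) *\<^sub>C (qK * qe1) = D1 (vchar c)"
  unfolding qe0_D1 qe1_D1 qK_D1 C1.diag_mult diag_scaleC diag_diff
  by (rule diag_cong) (auto simp: vchar_def)

lemma Q_ribbon_eq: "Q_ribbon \<beta> = D1 (vchar \<beta>) * ordered_prod Vmode"
  by (simp add: Q_ribbon_def vchar_eq Vmode_def[abs_def])

lemma Q_ribbon_inv_eq: "Q_ribbon_inv \<beta> = D1 (vchar (inverse \<beta>)) * ordered_prod Vmode'"
  by (simp add: Q_ribbon_inv_def vchar_eq Vmode'_def[abs_def])

lemma parity_D1: "D1 parity = 1 - 2 *\<^sub>C qe1"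
  unfolding qe1_D1 one_D1 diag_scaleC diag_diff by (rule diag_cong) (auto simp: parity_def)

lemma parity_qK: "qK\<^sup>2 = D1 parity"
  unfolding qK_D1 C1.diag_power by (rule diag_cong) (auto simp: parity_def power2_eq_square
      odd_char_square)

lemma parity_uminus: "parity (- z) = parity z"
  by (simp add: parity_def)

lemma parity_central: "x * D1 parity = D1 parity * (x :: 'n Q)"
proof -
  have "id x * D1 parity = D1 parity * id x"
  proof (rule Q_intertwine[OF algebra_hom_id algebra_hom_id])
    show "id qK * D1 parity = D1 parity * id (qK :: 'n Q)"
      unfolding qK_D1 id_apply by (rule C1.diag_commute)
    show "id (qf s i) * D1 parity = D1 parity * id (qf s i :: 'n Q)" for s i
      by (simp add: qf_D1 parity_uminus)
  qed
  then show ?thesis by simp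
qed

lemma parity_square: "D1 parity * D1 parity = 1"
  unfolding C1.diag_mult one_D1 by (rule diag_cong) (simp add: parity_def)

lemma parity_parity: "D1 parity * (D1 parity * x) = x"
  by (simp add: parity_square flip: mult.assoc)

lemma parity_qe1: "D1 parity * qe1 = - qe1"
  unfolding qe1_D1 C1.diag_mult diag_minus by (rule diag_cong) (simp add: parity_def)

lemma qf_Neg_Pos: "qf Neg i * qf Pos i = qe1 - qf Pos i * qf Neg i"
  using qf_Pos_Neg[of i i] by (simp add: algebra_simps)

lemma qf_qf': "qf s i * (qf s i * x) = 0"
  by (simp add: qf_square flip: mult.assoc)

text \<open>The relations give f^+ f^- f^+ = e_1 f^+ and f^- f^+ f^- = e_1 f^-, while squares of
  generators vanish. Hence 1 - 2 f^+ f^- acts on a generator as 1 - 2 e_1 = K^2 from one side and as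
  1 from the other.\<close>

lemma Vmode_qf:
  "Vmode k * qf Pos k = D1 parity * qf Pos k" "qf Pos k * Vmode k = qf Pos k"
  "Vmode k * qf Neg k = qf Neg k" "qf Neg k * Vmode k = D1 parity * qf Neg k"
proof -
  have 1: "qf Pos k * (qf Neg k * qf Pos k) = qe1 * qf Pos k"
    unfolding qf_Neg_Pos by (simp add: ring_distribs qf_qf' qe1_qf)
  have 2: "qf Neg k * (qf Pos k * qf Neg k) = qe1 * qf Neg k"
    unfolding mult.assoc[symmetric] qf_Neg_Pos by (simp add: ring_distribs mult.assoc qf_square)
  show "Vmode k * qf Pos k = D1 parity * qf Pos k" "qf Pos k * Vmode k = qf Pos k"
    "Vmode k * qf Neg k = qf Neg k" "qf Neg k * Vmode k = D1 parity * qf Neg k"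
    by (simp_all add: Vmode_def parity_D1 ring_distribs mult.assoc qf_qf' qf_square 1 2)
qed

lemma qf_anticommute': "k \<noteq> j \<Longrightarrow> qf s k * qf t j = - (qf t j * qf s k)"
  using qf_same[of s k j] qf_Pos_Neg[of k j] qf_Pos_Neg[of j k]
  by (cases s; cases t) (simp_all add: eq_neg_iff_add_eq_0 add.commute)

lemma qf_pair_commute: "k \<noteq> j \<Longrightarrow> qf Pos k * qf Neg k * qf t j = qf t j * (qf Pos k * qf Neg k)"
proof -
  assume "k \<noteq> j"
  note a = qf_anticommute'[OF this]
  have "qf Pos k * qf Neg k * qf t j = - (qf Pos k * qf t j * qf Neg k)"
    using a[of Neg t] by (simp add: mult.assoc)
  also have "\<dots> = qf t j * qf Pos k * qf Neg k"
    using a[of Pos t] by simp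
  finally show ?thesis by (simp only: mult.assoc)
qed

lemma Vmode_qf_commute: "k \<noteq> j \<Longrightarrow> Vmode k * qf t j = qf t j * Vmode k"
  using qf_pair_commute[of k j t] by (simp add: Vmode_def ring_distribs)

lemma qf_pair_D1: "qf Pos k * qf Neg k * D1 F = D1 F * (qf Pos k * qf Neg k)"
  by (simp add: mult.assoc qf_D1 qf_D1')

lemma Vmode_D1: "Vmode k * D1 F = D1 F * Vmode k"
  by (simp add: Vmode_def ring_distribs qf_pair_D1)

lemma Vmode'_eq: "Vmode' k = 1 + 2 *\<^sub>C (D1 parity * (qf Pos k * qf Neg k))"
  by (simp add: Vmode'_def parity_qK qf_pair_D1)

lemma Vmode'_D1: "Vmode' k * D1 F = D1 F * Vmode' k"
  by (simp add: Vmode'_eq ring_distribs mult.assoc qf_D1 qf_D1' C1.diag_mult')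
      (simp add: C1.diag_mult mult.commute flip: mult.assoc)

lemma Vmode_commute: "k \<noteq> l \<Longrightarrow> Vmode k * Vmode l = Vmode l * Vmode k"
  "k \<noteq> l \<Longrightarrow> Vmode k * Vmode' l = Vmode' l * Vmode k"
proof -
  assume kl: "k \<noteq> l"
  have c: "Vmode k * (qf Pos l * qf Neg l) = qf Pos l * qf Neg l * Vmode k"
    using Vmode_qf_commute[OF kl] by (metis mult.assoc)
  have c': "Vmode k * (D1 parity * (qf Pos l * qf Neg l)) = D1 parity * (qf Pos l * qf Neg l) *
      Vmode k"
    using c Vmode_D1[of k parity] by (metis mult.assoc)
  show "Vmode k * Vmode l = Vmode l * Vmode k"
    unfolding Vmode_def[of l] by (simp add: ring_distribs c)
  show "Vmode k * Vmode' l = Vmode' l * Vmode k"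
    unfolding Vmode'_eq by (simp add: ring_distribs c')
qed

text \<open>With P = f^+ f^-, multiplication by \<open>Vmode k\<close> takes K^2 P to K^4 P = P, so
  the two correction terms cancel.\<close>

lemma Vmode_inverse: "Vmode k * Vmode' k = 1" "Vmode' k * Vmode k = 1"
proof -
  let ?P = "qf Pos k * qf Neg k"
  have P: "Vmode k * ?P = D1 parity * ?P" by (simp add: Vmode_qf flip: mult.assoc)
  have P': "?P * Vmode k = D1 parity * ?P"
    using Vmode_qf(4)[of k] parity_central[of "qf Pos k"]
        by (simp add: mult.assoc) (simp flip: mult.assoc)
  have "Vmode k * (D1 parity * ?P) = ?P"
    using Vmode_D1[of k parity] by (metis P parity_parity mult.assoc)
  then show "Vmode k * Vmode' k = 1"
    unfolding Vmode'_eq by (simp add: ring_distribs) (simp add: Vmode_def)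
  have "D1 parity * ?P * Vmode k = ?P"
    using P' parity_parity[of ?P] by (simp add: mult.assoc)
  then show "Vmode' k * Vmode k = 1"
    unfolding Vmode'_eq by (simp add: ring_distribs) (simp add: Vmode_def)
qed

lemma vchar_inverse:
  assumes "\<beta> \<noteq> 0"
  shows "vchar \<beta> z * vchar (inverse \<beta>) z = 1"
proof -
  have "\<beta> * \<i> * z * (inverse \<beta> * \<i> * z) = - (\<beta> * inverse \<beta>) * (z * z)"
    by (simp add: algebra_simps)
  with assms show ?thesis by (auto simp: vchar_def odd_char_square)
qed

lemma Q_ribbon_inverse:
  assumes "\<beta> \<noteq> 0"
  shows "Q_ribbon \<beta> * Q_ribbon_inv \<beta> = (1 :: 'n::{finite,linorder} Q)"
    "Q_ribbon_inv \<beta> * Q_ribbon \<beta> = (1 :: 'n Q)"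
proof -
  let ?c = "D1 (vchar \<beta>) :: 'n Q" and ?c' = "D1 (vchar (inverse \<beta>)) :: 'n Q"
  have c: "?c * ?c' = 1" "?c' * ?c = 1"
    unfolding C1.diag_mult one_D1
    using vchar_inverse[OF assms] by (auto simp: mult.commute intro!: diag_cong)
  have E: "ordered_prod Vmode * ordered_prod Vmode' = (1 :: 'n Q)" "ordered_prod Vmode' *
      ordered_prod Vmode = (1 :: 'n Q)"
    by (subst ordered_prod_mult[symmetric]; simp add: Vmode_commute Vmode_inverse ordered_prod_one)+
  have m: "D1 F * ordered_prod Vmode = ordered_prod Vmode * D1 F" "D1 F * ordered_prod Vmode' =
      ordered_prod Vmode' * D1 F"
    for F by (rule ordered_prod_intertwine; simp add: Vmode_D1 Vmode'_D1)+
  have "Q_ribbon \<beta> * Q_ribbon_inv \<beta> = ?c * (ordered_prod Vmode * ?c') * ordered_prod Vmode'"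
    "Q_ribbon_inv \<beta> * Q_ribbon \<beta> = ?c' * (ordered_prod Vmode' * ?c) * ordered_prod Vmode"
    unfolding Q_ribbon_eq Q_ribbon_inv_eq by (simp_all only: mult.assoc)
  moreover have "?c * (?c' * x) = x" "?c' * (?c * x) = x" for x
    using c by (simp_all flip: mult.assoc)
  ultimately show "Q_ribbon \<beta> * Q_ribbon_inv \<beta> = (1 :: 'n Q)" "Q_ribbon_inv \<beta> * Q_ribbon \<beta> =
      (1 :: 'n Q)"
    unfolding m[symmetric] by (simp_all add: mult.assoc E)
qed

lemma Q_ribbon_central: "Q_ribbon \<beta> * x = x * (Q_ribbon \<beta> :: 'n::{finite,linorder} Q)"
proof -
  let ?c = "D1 (vchar \<beta>) :: 'n Q"
  have "id x * Q_ribbon \<beta> = Q_ribbon \<beta> * id x"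
  proof (rule Q_intertwine[OF algebra_hom_id algebra_hom_id])
    have "qK * ordered_prod Vmode = ordered_prod Vmode * (qK :: 'n Q)"
      unfolding qK_D1 by (rule ordered_prod_intertwine) (simp add: Vmode_D1)
    moreover have "qK * ?c = ?c * qK"
      unfolding qK_D1 by (rule C1.diag_commute)
    ultimately show "id qK * Q_ribbon \<beta> = Q_ribbon \<beta> * id (qK :: 'n Q)"
      unfolding Q_ribbon_eq id_apply by (metis mult.assoc)
  next
    fix s and j :: 'n
    have V: "ordered_prod Vmode * qf s j = (D1 parity * qf s j) * ordered_prod Vmode"
    proof (rule ordered_prod_intertwine_single[of j])
      show "Vmode k * qf s j = qf s j * Vmode k" if "k \<noteq> j"
          for k using that by (rule Vmode_qf_commute)
      then show "Vmode k * (D1 parity * qf s j) = D1 parity * qf s j * Vmode k" if "k \<noteq> j" for k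
        using that Vmode_D1[of k parity] by (metis mult.assoc)
      show "Vmode j * qf s j = D1 parity * qf s j * Vmode j"
        by (cases s) (simp_all add: Vmode_qf mult.assoc parity_parity)
    qed
    \<comment> \<open>The product over k leaves a factor K^2 in front of f_j. It is absorbed here
      because \<open>vchar \<beta> (- z) = parity z * vchar \<beta> z\<close>.\<close>
    have "?c * D1 parity * qf s j = qf s j * ?c"
      unfolding qf_D1 C1.diag_mult
      by (rule arg_cong[where f = "\<lambda>d. d * _"], rule diag_cong) (simp add: vchar_def parity_def)
    then show "id (qf s j) * Q_ribbon \<beta> = Q_ribbon \<beta> * id (qf s j)"
      unfolding Q_ribbon_eq id_apply mult.assoc V by (metis mult.assoc)
  qed
  then show ?thesis by simp
qed

text \<open>S exchanges f^+ and f^-, and restoring their order by f^- f^+ = e_1 - f^+ f^- leaves a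
  term e_1. Together with 1 it forms 1 - 2 e_1 = K^2, the common factor.\<close>

lemma Q_antipode_Vmode: "Q_antipode (Vmode k) = D1 parity * (Vmode k :: 'n Q)"
proof -
  note S = algebra_antihomD[OF algebra_antihom_Q_antipode[where 'a = 'n]]
  let ?g = "\<lambda>s z. if odd_char z then sgn_of s * (- 1) ^ CARD('n) * \<i> * z else z"
  have "D1 (\<lambda>z. ?g Neg (- z) * ?g Pos (- (- z))) = (D1 (\<lambda>z. - parity z) :: 'n Q)"
    by (rule diag_cong) (cases "even CARD('n)"; auto simp: parity_def odd_char_square algebra_simps)
  then have "Q_antipode (qf Pos k * qf Neg k) = D1 (\<lambda>z. - parity z) * (qf Neg k * qf Pos k)"
    by (simp add: S Q_antipode_simps qf_D1 qf_D1' mult.assoc C1.diag_mult')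
  also have "\<dots> = - (D1 parity * (qe1 - qf Pos k * qf Neg k))"
    by (simp add: qf_Neg_Pos flip: diag_minus)
  finally have "Q_antipode (qf Pos k * qf Neg k) = qe1 + D1 parity * (qf Pos k * qf Neg k :: 'n Q)"
    by (simp add: ring_distribs parity_qe1)
  then show ?thesis
    unfolding Vmode_def by (simp add: clinear_rules[OF S(1)] S(2) ring_distribs scaleC_add_right)
        (simp add: parity_D1)
qed

text \<open>The N factors K^2 from the product over k give (-1)^N on odd characters. Inverting the
  character in \<open>vchar\<close> gives the same sign, so the two cancel.\<close>

lemma Q_antipode_ribbon: "Q_antipode (Q_ribbon \<beta>) = (Q_ribbon \<beta> :: 'n::{finite,linorder} Q)"
proof -
  note S = algebra_antihom_Q_antipode[where 'a = 'n]
  have comm: "Vmode k * Vmode l = Vmode l * Vmode k" for k l :: 'n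
    by (cases "k = l") (simp_all add: Vmode_commute)
  have V: "Q_antipode (ordered_prod Vmode) = D1 (\<lambda>z. parity z ^ CARD('n)) *
      (ordered_prod Vmode :: 'n Q)"
  proof -
    have "Q_antipode (ordered_prod Vmode) = ordered_prod (\<lambda>k :: 'n. D1 parity * Vmode k)"
      unfolding ordered_prod_antihom[OF S comm] Q_antipode_Vmode ..
    also have "\<dots> = ordered_prod (\<lambda>k :: 'n. D1 parity) * ordered_prod Vmode"
      by (rule ordered_prod_mult) (rule Vmode_D1)
    finally show ?thesis by (simp add: ordered_prod_const C1.diag_power)
  qed
  have "ordered_prod Vmode * D1 F = D1 F * (ordered_prod Vmode :: 'n Q)" for F
    by (rule ordered_prod_intertwine[symmetric]) (simp add: Vmode_D1)
  then have "Q_antipode (Q_ribbon \<beta>) =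
      D1 (\<lambda>z. parity z ^ CARD('n)) * D1 (\<lambda>z. vchar \<beta> (cinv CARD('n) z)) *
          (ordered_prod Vmode :: 'n Q)"
    unfolding Q_ribbon_eq algebra_antihomD(3)[OF S] V Q_antipode_D1 by (simp add: mult.assoc)
  also have "D1 (\<lambda>z. parity z ^ CARD('n)) * D1 (\<lambda>z. vchar \<beta> (cinv CARD('n) z)) =
      (D1 (vchar \<beta>) :: 'n Q)"
    unfolding C1.diag_mult by (rule diag_cong, cases "even CARD('n)") (auto simp: vchar_def
        parity_def cinv_def)
  finally show ?thesis by (simp add: Q_ribbon_eq)
qed

text \<open>Since \<open>vchar (inverse \<beta>)\<close> is the pointwise inverse of
  \<open>vchar \<beta>\<close>, this says that the symmetrised Cartan factor of R is the coboundary
  of that of v. It is checked on all sixteen pairs of characters.\<close>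

lemma rchar_monodromy:
  assumes "\<beta> \<noteq> 0" "x \<in> C4" "y \<in> C4"
  shows "rchar \<beta> y x * rchar \<beta> x y = vchar \<beta> x * vchar \<beta> y * vchar (inverse \<beta>) (cmul N x y)"
proof -
  have 1: "\<beta> * \<i> * \<i> * (inverse \<beta> * \<i> * \<i>) = 1"
    using assms(1) by (simp add: mult.assoc)
  have 2: "\<not> odd_char ((- 1) ^ N)" using odd_char_sign[of N 1] by simp
  show ?thesis
    using assms(2,3)
    by (elim C4E) (simp_all add: rchar_def rsign_def omega_char_values omega_char_uminus vchar_def
        cmul_def 1 2)
qed

lemma tensor_qf_D2':
  "(qf s i \<otimes> 1) * (D2 F * x) = D2 (\<lambda>(x, y). F (- x, y)) * ((qf s i \<otimes> 1) * x)"
  "(1 \<otimes> qf s i) * (D2 F * x) = D2 (\<lambda>(x, y). F (x, - y)) * ((1 \<otimes> qf s i) * x)"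
  "(qf s i \<otimes> qf t j) * (D2 F * x) = D2 (\<lambda>(x, y). F (- x, - y)) * ((qf s i \<otimes> qf t j) * x)"
  by (simp_all add: tensor_qf_D2 flip: mult.assoc)

lemma Q_comult_qf_pair:
  "Q_comult (qf Pos k * qf Neg k :: 'n Q) = (qf Pos k * qf Neg k) \<otimes> 1
    - D2 (\<lambda>(x, y). omega_char Neg x) * (qf Pos k \<otimes> qf Neg k)
    + D2 (\<lambda>(x, y). omega_char Pos x) * (qf Neg k \<otimes> qf Pos k)
    + D2 (\<lambda>(x, y). parity x) * (1 \<otimes> (qf Pos k * qf Neg k))"
proof -
  have 1: "D2 (\<lambda>(x, y). omega_char Neg (- x)) = - (D2 (\<lambda>(x, y). omega_char Neg x) :: 'n Q \<otimes> 'n Q)"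
    unfolding diag_minus by (rule diag_cong) (auto simp: omega_char_uminus)
  have 2: "D2 (\<lambda>(x, y). omega_char Pos x) * D2 (\<lambda>(x, y). omega_char Neg x) =
      (D2 (\<lambda>(x, y). parity x) :: 'n Q \<otimes> 'n Q)"
    unfolding C2.diag_mult by (rule diag_cong) (auto simp: omega_char_Pos_Neg omega_char_square
        parity_def)
  have "Q_comult (qf Pos k * qf Neg k :: 'n Q) = (qf Pos k * qf Neg k) \<otimes> 1
    + D2 (\<lambda>(x, y). omega_char Neg (- x)) * (qf Pos k \<otimes> qf Neg k)
    + D2 (\<lambda>(x, y). omega_char Pos x) * (qf Neg k \<otimes> qf Pos k)
    + D2 (\<lambda>(x, y). omega_char Pos x) * D2 (\<lambda>(x, y). omega_char Neg x) * (1 \<otimes> (qf Pos k * qf Neg k))"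
    unfolding algebra_homD(3)[OF algebra_hom_Q_comult] Q_comult_qf
    by (simp add: ring_distribs mult.assoc tensor_qf_D2' tensor_mult_pure)
  then show ?thesis unfolding 1 2 by simp
qed

lemma Vmode_tensor_D2: "(Vmode k \<otimes> Vmode l) * D2 F = D2 F * (Vmode k \<otimes> Vmode l)"
proof -
  have "moves C4 qp (Vmode k :: 'n Q) (\<lambda>z. z)" for k
    by (simp add: moves_def qp_D1 Vmode_D1)
  from moves_diag[OF moves_tensor[OF this this]] show ?thesis by simp
qed

lemma Vmode_tensor_D2': "(Vmode k \<otimes> Vmode l) * (D2 F * x) = D2 F * ((Vmode k \<otimes> Vmode l) * x)"
  by (simp add: Vmode_tensor_D2 flip: mult.assoc)

lemma Q_comult_Vmode':
  "Q_comult (Vmode' k :: 'n Q) = 1 + 2 *\<^sub>C (D2 (\<lambda>(x, y). parity x * parity y) *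
      Q_comult (qf Pos k * qf Neg k))"
proof -
  have "Q_comult (D1 parity) = (D2 (\<lambda>(x, y). parity x * parity y) :: 'n Q \<otimes> 'n Q)"
    unfolding Q_comult_D1 by (rule diag_cong) (auto simp: parity_def)
  then show ?thesis
    unfolding Vmode'_eq
    by (simp add: clinear_rules[OF algebra_homD(1)[OF algebra_hom_Q_comult]]
        algebra_homD(2,3)[OF algebra_hom_Q_comult])
qed

lemma Vmode_comult_commute:
  assumes "k \<noteq> l"
  shows "Q_comult (Vmode' k) * (Vmode l \<otimes> Vmode l) = (Vmode l \<otimes> Vmode l) * Q_comult (Vmode' k)"
proof -
  note V = Vmode_qf_commute[OF assms[symmetric]]
  have pair: "Vmode l * (qf Pos k * qf Neg k) = qf Pos k * qf Neg k * Vmode l"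
    using V by (metis mult.assoc)
  show ?thesis
    unfolding Q_comult_Vmode' Q_comult_qf_pair
    by (simp add: ring_distribs mult.assoc Vmode_tensor_D2') (simp add: tensor_mult_pure V pair
        mult.assoc)
qed

text \<open>The monodromy for a single k. The function \<open>h\<close> arises from moving the
  flipped mode, with coefficient -omega_-(y), through the Cartan factor r: both arguments of r are
  negated, which contributes -omega_+(y) omega_-(x), and omega_-(y) omega_+(y) is the parity of
  y.\<close>

lemma Vmode_comult:
  fixes k :: "'n"
  defines "h \<equiv> \<lambda>(x, y). parity y * omega_char Neg x"
  shows "(1 - 2 *\<^sub>C (D2 h * (qf Pos k \<otimes> qf Neg k))) * (1 - 2 *\<^sub>C Rmode k) =
    (Vmode k \<otimes> Vmode k) * Q_comult (Vmode' k)"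
proof -
  define P where "P = (qf Pos k * qf Neg k :: 'n Q)"
  define s t where "s = (qf Pos k \<otimes> qf Neg k :: 'n Q \<otimes> 'n Q)"
      and "t = (qf Neg k \<otimes> qf Pos k :: 'n Q \<otimes> 'n Q)"
  let ?V = "Vmode k \<otimes> Vmode k" and ?\<kappa> = "D2 (\<lambda>(x, y). parity y) :: 'n Q \<otimes> 'n Q"
    and ?w = "D2 (\<lambda>(x, y). omega_char Neg x) :: 'n Q \<otimes> 'n Q"
  have VP: "Vmode k * P = D1 parity * P"
    by (simp add: P_def Vmode_qf flip: mult.assoc)
  have PV: "P \<otimes> Vmode k = P \<otimes> 1 - 2 *\<^sub>C (P \<otimes> P)" "Vmode k \<otimes> P = 1 \<otimes> P - 2 *\<^sub>C (P \<otimes> P)"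
    by (simp_all add: Vmode_def P_def tensor_diff_left tensor_diff_right tensor_scale_left
        tensor_scale_right)
  have V: "?V = 1 - 2 *\<^sub>C (P \<otimes> 1) - 2 *\<^sub>C (1 \<otimes> P) + 4 *\<^sub>C (P \<otimes> P)"
    by (simp add: Vmode_def P_def tensor_diff_left tensor_diff_right tensor_scale_left
        tensor_scale_right one_tensor_def
        complex_vector.scale_right_diff_distrib)
  have V1: "?V * (P \<otimes> 1) = D2 (\<lambda>(x, y). parity x) * (P \<otimes> 1 - 2 *\<^sub>C (P \<otimes> P))"
    by (simp add: tensor_mult_pure VP tensor_D2 PV)
  have V2: "?V * (1 \<otimes> P) = ?\<kappa> * (1 \<otimes> P - 2 *\<^sub>C (P \<otimes> P))"
    by (simp add: tensor_mult_pure VP tensor_D2 PV)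
  have Vs: "?V * s = D2 (\<lambda>(x, y). parity x) * s" and Vt: "?V * t = ?\<kappa> * t"
    by (simp_all add: s_def t_def tensor_mult_pure Vmode_qf tensor_D2)
  have "?V * Q_comult (Vmode' k) = ?V + 2 *\<^sub>C (D2 (\<lambda>(x, y). parity x * parity y) * (?V * (P \<otimes> 1)
      - ?w * (?V * s) + D2 (\<lambda>(x, y). omega_char Pos x) * (?V * t) + D2 (\<lambda>(x, y). parity x) *
          (?V * (1 \<otimes> P))))"
    unfolding Q_comult_Vmode' Q_comult_qf_pair unfolding P_def[symmetric] s_def[symmetric]
        t_def[symmetric]
    by (simp add: ring_distribs Vmode_tensor_D2')
  also have "\<dots> = ?V + 2 *\<^sub>C (?\<kappa> * (P \<otimes> 1 - 2 *\<^sub>C (P \<otimes> P)) - D2 h * s + ?w * t + (1 \<otimes> P - 2 *\<^sub>C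
      (P \<otimes> P)))"
  proof -
    \<comment> \<open>The coefficients collapse because omega_- is the parity times omega_+ and the
      parity squares to 1.\<close>
    have "D2 (\<lambda>(x, y). parity x * parity y) * (D2 (\<lambda>(x, y). parity x) * a) = ?\<kappa> * a"
      "D2 (\<lambda>(x, y). parity x * parity y) * (?w * (D2 (\<lambda>(x, y). parity x) * a)) = D2 h * a"
      "D2 (\<lambda>(x, y). parity x * parity y) * (D2 (\<lambda>(x, y). omega_char Pos x) * (?\<kappa> * a)) = ?w * a"
      "D2 (\<lambda>(x, y). parity x * parity y) * (D2 (\<lambda>(x, y). parity x) * (?\<kappa> * a)) = D2 (\<lambda>_. 1) * a"
          for a
      unfolding mult.assoc[symmetric] C2.diag_mult
      by (rule arg_cong[where f = "\<lambda>d. d * _"], rule diag_cong,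
          auto simp: parity_def h_def omega_char_Pos_Neg)+
    then show ?thesis
      unfolding V1 V2 Vs Vt semiring_class.distrib_left ring_class.right_diff_distrib
      by (simp add: C2.diag_one ring_distribs)
  qed
  finally have R: "?V * Q_comult (Vmode' k) =
    ?V + 2 *\<^sub>C (?\<kappa> * (P \<otimes> 1 - 2 *\<^sub>C (P \<otimes> P)) - D2 h * s + ?w * t + (1 \<otimes> P - 2 *\<^sub>C (P \<otimes> P)))" .
  have X: "Rmode k = - (?w * t)"
    unfolding Rmode_D2 t_def mult_minus_left[symmetric] diag_minus
    by (rule arg_cong[where f = "\<lambda>d. d * _"], rule diag_cong) auto
  \<comment> \<open>This is the only cross term on the left-hand side. The relation for f^- f^+
    expresses it by P and e_1, and K^2 = 1 - 2 e_1 in the second leg matches the result with the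
    expansion of the right-hand side.\<close>
  have "s * t = P \<otimes> (qe1 - P)"
    by (simp add: s_def t_def tensor_mult_pure P_def qf_Neg_Pos)
  moreover have "D2 h * s * (?w * t) = - (?\<kappa> * (s * t))"
    unfolding s_def mult.assoc tensor_qf_D2' C2.diag_mult' mult_minus_left[symmetric] diag_minus
    by (rule arg_cong[where f = "\<lambda>d. d * _"], rule diag_cong) (auto simp: h_def omega_char_uminus
        omega_char_square mult.assoc)
  moreover have "?\<kappa> * (P \<otimes> qe1) = - (P \<otimes> qe1)"
    using tensor_D2(2)[of P parity qe1] by (simp add: parity_qe1 tensor_minus_right)
  moreover have "?\<kappa> * (P \<otimes> 1) = P \<otimes> 1 - 2 *\<^sub>C (P \<otimes> qe1)"
    using tensor_D2(2)[of P parity 1] by (simp add: parity_D1 tensor_diff_right tensor_scale_right)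
  ultimately show ?thesis
    unfolding R unfolding V X s_def[symmetric]
    by (simp add: ring_distribs tensor_diff_right scaleC_add_right
        complex_vector.scale_right_diff_distrib)
qed

lemma Q_ribbon_monodromy:
  assumes "\<beta> \<noteq> 0"
  shows "tensor_swap (Q_R \<beta>) * Q_R \<beta> =
      (Q_ribbon \<beta> \<otimes> Q_ribbon \<beta>) * Q_comult (Q_ribbon_inv \<beta> :: 'n::{finite,linorder} Q)"
proof -
  let ?r = "D2 (\<lambda>(x, y). rchar \<beta> x y) :: 'n Q \<otimes> 'n Q"
  define h where "h = (\<lambda>(x, y). parity y * omega_char Neg x)"
  \<comment> \<open>The flipped mode of index k after it has been moved to the right of the Cartan
    factor of R.\<close>
  define M where "M k = (D2 h * (qf Pos k \<otimes> qf Neg k) :: 'n Q \<otimes> 'n Q)" for k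
  define V where "V k = (Vmode k \<otimes> Vmode k :: 'n Q \<otimes> 'n Q)" for k
  let ?M = "ordered_prod (\<lambda>k. 1 - 2 *\<^sub>C M k)"
      and ?X = "ordered_prod (\<lambda>k. 1 - 2 *\<^sub>C Rmode k) :: 'n Q \<otimes> 'n Q"
  have swap: "tensor_swap (Rmode k) = D2 (\<lambda>(x, y). - omega_char Neg y) * (qf Pos k \<otimes> qf Neg k)"
      for k :: 'n
    unfolding Rmode_D2 algebra_homD(3)[OF algebra_hom_tensor_swap]
        diag_tensor_swap tensor_swap_pure by simp
  have M: "?r * M k = tensor_swap (Rmode k) * ?r" for k
    unfolding swap M_def mult.assoc tensor_qf_D2 mult.assoc[symmetric] C2.diag_mult
    by (rule arg_cong[where f = "\<lambda>d. d * _"], rule diag_cong)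
      (auto simp: h_def rchar_uminus C4_uminus omega_char_uminus omega_char_Pos_Neg
        omega_char_square parity_def)
  \<comment> \<open>For distinct indices all generators anticommute, so the signs from the two legs
    cancel, and the Cartan coefficients are invariant when both arguments are negated up to signs
    that agree on the two sides.\<close>
  have comm: "Rmode k * M l = M l * Rmode k" if "k \<noteq> l" for k l
  proof -
    have "(qf Neg k \<otimes> qf Pos k) * (qf Pos l \<otimes> qf Neg l) =
        (qf Pos l \<otimes> qf Neg l) * (qf Neg k \<otimes> qf Pos k)"
      by (simp add: tensor_mult_pure qf_anticommute'[OF that] tensor_minus_left tensor_minus_right)
    then show ?thesis
      unfolding M_def Rmode_D2 mult.assoc tensor_qf_D2' C2.diag_mult'
      by (simp only:) (rule arg_cong[where f = "\<lambda>d. d * _"], rule diag_cong, auto simp: h_def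
          omega_char_uminus parity_uminus)
  qed
  have "tensor_swap (Q_R \<beta>) * Q_R \<beta> =
      D2 (\<lambda>(x, y). rchar \<beta> y x) * (ordered_prod (\<lambda>k. 1 - 2 *\<^sub>C tensor_swap (Rmode k)) * ?r) * ?X"
    unfolding hom_Q_R[OF algebra_hom_tensor_swap] unfolding diag_tensor_swap Q_R_eq
    by (simp add: mult.assoc)
  also have "ordered_prod (\<lambda>k. 1 - 2 *\<^sub>C tensor_swap (Rmode k)) * ?r = ?r * ?M"
    by (rule ordered_prod_intertwine[symmetric]) (rule mode_intertwine, rule M)
  also have "D2 (\<lambda>(x, y). rchar \<beta> y x) * (?r * ?M) * ?X = D2 (\<lambda>(x, y). rchar \<beta> y x) * ?r *
      (?M * ?X)"
    by (simp only: mult.assoc)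
  also have "?M * ?X = ordered_prod (\<lambda>k. (1 - 2 *\<^sub>C M k) * (1 - 2 *\<^sub>C Rmode k))"
    by (rule ordered_prod_mult[symmetric]) (rule one_minus_commute, rule comm)
  also have "\<dots> = ordered_prod (\<lambda>k. V k * Q_comult (Vmode' k))"
    by (rule ordered_prod_cong) (simp only: M_def h_def V_def Vmode_comult)
  also have "\<dots> = ordered_prod V * ordered_prod (\<lambda>k. Q_comult (Vmode' k))"
    by (rule ordered_prod_mult) (unfold V_def, rule Vmode_comult_commute)
  also have "D2 (\<lambda>(x, y). rchar \<beta> y x) * ?r =
      D2 (\<lambda>(x, y). vchar \<beta> x * vchar \<beta> y) * D2 (\<lambda>(x, y). vchar (inverse \<beta>) (cmul CARD('n) x y))"
    unfolding C2.diag_mult by (rule diag_cong) (auto simp: rchar_monodromy[OF assms])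
  also have "D2 (\<lambda>(x, y). vchar \<beta> x * vchar \<beta> y) * D2 (\<lambda>(x, y). vchar (inverse \<beta>) (cmul CARD('n) x
      y)) *
      (ordered_prod V * ordered_prod (\<lambda>k. Q_comult (Vmode' k))) =
      D2 (\<lambda>(x, y). vchar \<beta> x * vchar \<beta> y) *
      (D2 (\<lambda>(x, y). vchar (inverse \<beta>) (cmul CARD('n) x y)) * ordered_prod V) *
        ordered_prod (\<lambda>k. Q_comult (Vmode' k))"
    by (simp only: mult.assoc)
  also have "D2 (\<lambda>(x, y). vchar (inverse \<beta>) (cmul CARD('n) x y)) * ordered_prod V =
      ordered_prod V * D2 (\<lambda>(x, y). vchar (inverse \<beta>) (cmul CARD('n) x y))"
    by (rule ordered_prod_intertwine) (simp only: V_def Vmode_tensor_D2)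
  also have "D2 (\<lambda>(x, y). vchar \<beta> x * vchar \<beta> y) * (ordered_prod V *
      D2 (\<lambda>(x, y). vchar (inverse \<beta>) (cmul CARD('n) x y))) *
      ordered_prod (\<lambda>k. Q_comult (Vmode' k)) =
      (D2 (\<lambda>(x, y). vchar \<beta> x * vchar \<beta> y) * ordered_prod V) *
      (D2 (\<lambda>(x, y). vchar (inverse \<beta>) (cmul CARD('n) x y)) *
        ordered_prod (\<lambda>k. Q_comult (Vmode' k)))"
    by (simp only: mult.assoc)
  also have "D2 (\<lambda>(x, y). vchar (inverse \<beta>) (cmul CARD('n) x y)) *
      ordered_prod (\<lambda>k. Q_comult (Vmode' k)) =
      Q_comult (Q_ribbon_inv \<beta> :: 'n Q)"
    unfolding Q_ribbon_inv_eq algebra_homD(3)[OF algebra_hom_Q_comult] Q_comult_D1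
      ordered_prod_hom[OF algebra_hom_Q_comult] ..
  also have "D2 (\<lambda>(x, y). vchar \<beta> x * vchar \<beta> y) * ordered_prod V = Q_ribbon \<beta> \<otimes> Q_ribbon \<beta>"
  proof -
    have "ordered_prod Vmode \<otimes> ordered_prod Vmode =
        ordered_prod (\<lambda>k. Vmode k \<otimes> 1) * ordered_prod (\<lambda>k. 1 \<otimes> (Vmode k :: 'n Q))"
      by (simp add: tensor_mult_pure flip: ordered_prod_hom[OF algebra_hom_tensor_left]
          ordered_prod_hom[OF algebra_hom_tensor_right])
    also have "\<dots> = ordered_prod V"
      by (subst ordered_prod_mult[symmetric]) (simp_all add: tensor_mult_pure V_def[abs_def])
    finally have "ordered_prod V = ordered_prod Vmode \<otimes> ordered_prod Vmode" ..
    then show ?thesis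
      unfolding Q_ribbon_eq D1_tensor[symmetric] by (simp add: tensor_mult_pure)
  qed
  finally show ?thesis .
qed

theorem proposition3p2:
  fixes \<beta> :: complex
  assumes "\<beta> ^ 4 = (- 1) ^ CARD('n::{finite,linorder})"
  shows "ribbon_quasi_hopf_algebra
    (Q_comult :: 'n Q \<Rightarrow> 'n Q \<otimes> 'n Q) Q_counit (Q_assoc \<beta> Pos) (Q_assoc \<beta> Neg)
    Q_antipode Q_alpha (Q_beta \<beta>) (Q_R \<beta>) (Q_R_inv \<beta>)
    TYPE('u::complex_vector) TYPE('v::complex_vector) TYPE('w::complex_vector)
    (Q_ribbon \<beta>) (Q_ribbon_inv \<beta>)"
proof -
  have \<beta>: "\<beta> \<noteq> 0" using assms by auto
  interpret quasi_hopf_algebra "Q_comult :: 'n Q \<Rightarrow> 'n Q \<otimes> 'n Q" Q_counit "Q_assoc \<beta> Pos"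
      "Q_assoc \<beta> Neg"
    Q_antipode Q_alpha "Q_beta \<beta>"
    by unfold_locales
      (fact algebra_hom_Q_comult algebra_hom_Q_counit Q_counit_left Q_counit_right
        Q_assoc_inverse[OF assms]
        Q_quasi_coassociative Q_pentagon[OF assms] Q_counit_associator algebra_antihom_Q_antipode
        Q_antipode_left Q_antipode_right Q_antipode_associator[OF assms]
            Q_antipode_associator_inverse[OF assms])+
  show ?thesis
    by unfold_locales
      (fact Q_R_inverse[OF \<beta>] braids_modulesI[OF Q_R_flip Q_hexagon1 Q_hexagon2]
        Q_ribbon_central Q_ribbon_inverse[OF \<beta>] Q_antipode_ribbon Q_ribbon_monodromy[OF \<beta>])+
qed

end
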